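(* Let $d\ge1$, let $\eta$ be a probability measure on $\mathbb{S}^{d-1}$, and for $\alpha\in(0,1)$ let $\nu_\alpha$ be the $\alpha$-stable Lévy measure on $\mathbb{R}^d$ given by $$\nu_\alpha(A)=\int_{\mathbb{S}^{d-1}}\int_0^\infty\mathbf{1}_A(r\theta)\,r^{-1-\alpha}\,\mathrm{d}r\,\eta(\mathrm{d}\theta).$$ Let $\lambda_\alpha(\mathrm{d}x)=C_\alpha^{-1}(1\wedge|x|)\,\nu_\alpha(\mathrm{d}x)$ with $C_\alpha=\int_{\mathbb{R}^d}(1\wedge|x|)\,\nu_\alpha(\mathrm{d}x)$, let $\mu_\alpha(S)=\lambda_\alpha((0,\infty)S)$ for Borel $S\subset\mathbb{S}^{d-1}$, and let $\mu$ be the weak limit of $\mu_\alpha$ as $\alpha\uparrow1$ (which exists). Then for every $f\in\mathrm{BV}(\mathbb{R}^d)$ $$\lim_{\alpha\uparrow1}(1-\alpha)\,\mathcal{F}_{\nu_\alpha}(f)=\frac12\int_{\mathbb{S}^{d-1}}\int_{\mathbb{R}^d}|Df\cdot\theta|\,\mu(\mathrm{d}\theta).$$ In particular, if $\eta$ is the uniform probability measure on $\mathbb{S}^{d-1}$, then for every Borel set $E\subset\mathbb{R}^d$ of finite Lebesgue measure with $\mathrm{Per}(E)<\infty$ $$\lim_{\alpha\uparrow1}(1-\alpha)\,\mathrm{Per}_{\nu_\alpha}(E)=\frac{K_{1,d}}{2\kappa_{d-1}}\,\mathrm{Per}(E).$$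
   Context: $a\wedge b=\min(a,b)$. $(0,\infty)S=\{re: r>0,\ e\in S\}$. For a positive Borel measure $\nu$ on $\mathbb{R}^d$: $\mathcal{F}_\nu(u)=\frac12\int_{\mathbb{R}^d}\int_{\mathbb{R}^d}|u(x+y)-u(y)|\,\nu(\mathrm{d}x)\,\mathrm{d}y$ and $\mathrm{Per}_\nu(E)=\int_E\nu(E^c-x)\,\mathrm{d}x$. $\mathrm{BV}(\mathbb{R}^d)$ is the space of $u\in L^1(\mathbb{R}^d)$ whose distributional gradient $Du$ is an $\mathbb{R}^d$-valued Radon measure of finite total variation; $\mathrm{Per}(E)=|D\mathbf{1}_E|(\mathbb{R}^d)$. $|Df\cdot\theta|$ is the total variation measure of the scalar signed measure $Df\cdot\theta$, and $\int_{\mathbb{R}^d}|Df\cdot\theta|$ its total mass. $\sigma$ is the surface measure on $\mathbb{S}^{d-1}$, $\kappa_{d-1}=\sigma(\mathbb{S}^{d-1})$, $K_{1,d}=\int_{\mathbb{S}^{d-1}}|e\cdot\theta|\,\sigma(\mathrm{d}\theta)$ for any unit vector $e$. *)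

theory Defs
  imports "HOL-Probability.Probability"
begin

section \<open>Vector-valued Borel measures\<close>

text \<open>Countable additivity forces the value \<open>0\<close> on the empty set (constant sequence). Values on
  non-Borel sets are irrelevant everywhere below.\<close>

definition vector_measure :: "('a::topological_space set \<Rightarrow> 'b::real_normed_vector) \<Rightarrow> bool" where
  "vector_measure m \<longleftrightarrow>
     (\<forall>E. range E \<subseteq> sets borel \<longrightarrow> disjoint_family E \<longrightarrow>
        (\<lambda>i::nat. m (E i)) sums m (\<Union>i. E i))"

definition variation :: "('a::topological_space set \<Rightarrow> 'b::real_normed_vector) \<Rightarrow> 'a set \<Rightarrow> ennreal" where
  "variation m A =
     (SUP E\<in>{E :: nat \<Rightarrow> 'a set. range E \<subseteq> sets borel \<and> disjoint_family E \<and> (\<Union>i. E i) = A}.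
        \<Sum>i. ennreal (norm (m (E i))))"

text \<open>Jordan decomposition of a scalar signed measure; \<open>ennreal\<close> truncates negative values to \<open>0\<close>,
  which is the value at the empty set and so does not change the supremum.\<close>

definition upper_variation :: "('a::topological_space set \<Rightarrow> real) \<Rightarrow> 'a measure" where
  "upper_variation m =
     measure_of UNIV (sets borel) (\<lambda>A. SUP B\<in>{B\<in>sets borel. B \<subseteq> A}. ennreal (m B))"

definition lower_variation :: "('a::topological_space set \<Rightarrow> real) \<Rightarrow> 'a measure" where
  "lower_variation m = upper_variation (\<lambda>A. - m A)"

definition signed_integral :: "('a::topological_space set \<Rightarrow> real) \<Rightarrow> ('a \<Rightarrow> real) \<Rightarrow> real" where
  "signed_integral m \<phi> =
     (\<integral>x. \<phi> x \<partial>upper_variation m) - (\<integral>x. \<phi> x \<partial>lower_variation m)"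

section \<open>Functions of bounded variation\<close>

fun C_k :: "nat \<Rightarrow> ('a::euclidean_space \<Rightarrow> real) \<Rightarrow> bool" where
  "C_k 0 \<phi> \<longleftrightarrow> continuous_on UNIV \<phi>"
| "C_k (Suc k) \<phi> \<longleftrightarrow>
     \<phi> differentiable_on UNIV \<and> (\<forall>b\<in>Basis. C_k k (\<lambda>x. frechet_derivative \<phi> (at x) b))"

definition test_functions :: "('a::euclidean_space \<Rightarrow> real) set" where
  "test_functions = {\<phi>. (\<forall>k. C_k k \<phi>) \<and> compact (closure {x. \<phi> x \<noteq> 0})}"

definition has_distributional_gradient ::
    "('a::euclidean_space \<Rightarrow> real) \<Rightarrow> ('a set \<Rightarrow> 'a) \<Rightarrow> bool" where
  "has_distributional_gradient u m \<longleftrightarrow>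
     (\<forall>\<phi>\<in>test_functions. \<forall>b\<in>Basis.
        (\<integral>x. u x * frechet_derivative \<phi> (at x) b \<partial>lborel) = - signed_integral (\<lambda>A. m A \<bullet> b) \<phi>)"

text \<open>A finite Borel measure on a Euclidean space is automatically Radon.\<close>

definition is_BV_gradient :: "('a::euclidean_space \<Rightarrow> real) \<Rightarrow> ('a set \<Rightarrow> 'a) \<Rightarrow> bool" where
  "is_BV_gradient u m \<longleftrightarrow>
     vector_measure m \<and> variation m UNIV < \<infinity> \<and> has_distributional_gradient u m"

text \<open>Elements of \<open>L\<^sup>1\<close> are given by Borel measurable representatives.\<close>

definition BV :: "('a::euclidean_space \<Rightarrow> real) set" where
  "BV = {u. integrable lborel u \<and> (\<exists>m. is_BV_gradient u m)}"

text \<open>The choice is harmless: the gradient measure is determined on all Borel sets.\<close>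

definition grad :: "('a::euclidean_space \<Rightarrow> real) \<Rightarrow> 'a set \<Rightarrow> 'a" where
  "grad u = (SOME m. is_BV_gradient u m)"

definition perimeter :: "'a::euclidean_space set \<Rightarrow> ennreal" where
  "perimeter E =
     (if (indicator E :: 'a \<Rightarrow> real) \<in> BV then variation (grad (indicator E)) UNIV else \<infinity>)"

section \<open>Nonlocal functionals\<close>

definition nonlocal_energy :: "'a::euclidean_space measure \<Rightarrow> ('a \<Rightarrow> real) \<Rightarrow> ennreal" where
  "nonlocal_energy \<nu> u = 1 / 2 * (\<integral>\<^sup>+y. (\<integral>\<^sup>+x. ennreal \<bar>u (x + y) - u y\<bar> \<partial>\<nu>) \<partial>lborel)"

definition nonlocal_perimeter :: "'a::euclidean_space measure \<Rightarrow> 'a set \<Rightarrow> ennreal" where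
  "nonlocal_perimeter \<nu> E = (\<integral>\<^sup>+x\<in>E. emeasure \<nu> ((\<lambda>y. y - x) ` (- E)) \<partial>lborel)"

section \<open>Measures on the unit sphere\<close>

abbreviation unit_sphere :: "'a::euclidean_space set" where
  "unit_sphere \<equiv> sphere 0 1"

abbreviation sphere_borel :: "'a::euclidean_space measure" where
  "sphere_borel \<equiv> restrict_space borel unit_sphere"

text \<open>Surface measure by the polar coordinate formula: \<open>d\<close> times the volume of the solid cone over
  the set. In dimension one this is counting measure on the two unit vectors.\<close>

definition surface_measure :: "'a::euclidean_space measure" where
  "surface_measure =
     measure_of unit_sphere (sets sphere_borel)
       (\<lambda>S. of_nat DIM('a) * emeasure lborel {r *\<^sub>R e |r e. 0 < r \<and> r \<le> 1 \<and> e \<in> S})"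

definition sphere_area :: "'a::euclidean_space itself \<Rightarrow> ennreal" where
  "sphere_area _ = emeasure (surface_measure :: 'a measure) unit_sphere"

definition K1 :: "'a::euclidean_space \<Rightarrow> ennreal" where
  "K1 e = (\<integral>\<^sup>+\<theta>. ennreal \<bar>e \<bullet> \<theta>\<bar> \<partial>surface_measure)"

definition uniform_sphere :: "'a::euclidean_space measure" where
  "uniform_sphere = uniform_measure surface_measure unit_sphere"

definition weak_limit_on_sphere ::
    "('i \<Rightarrow> 'a::euclidean_space measure) \<Rightarrow> 'a measure \<Rightarrow> 'i filter \<Rightarrow> bool" where
  "weak_limit_on_sphere M \<mu> F \<longleftrightarrow>
     sets \<mu> = sets sphere_borel \<and> finite_measure \<mu> \<and>
     (\<forall>g :: 'a \<Rightarrow> real. continuous_on unit_sphere g \<longrightarrow> bounded (g ` unit_sphere) \<longrightarrow>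
        ((\<lambda>i. \<integral>\<theta>. g \<theta> \<partial>M i) \<longlongrightarrow> (\<integral>\<theta>. g \<theta> \<partial>\<mu>)) F)"

section \<open>Stable Levy measures\<close>

definition stable_measure :: "'a::euclidean_space measure \<Rightarrow> real \<Rightarrow> 'a measure" where
  "stable_measure \<eta> \<alpha> =
     measure_of UNIV (sets borel)
       (\<lambda>A. \<integral>\<^sup>+\<theta>. (\<integral>\<^sup>+r\<in>{0<..}. indicator A (r *\<^sub>R \<theta>) * ennreal (r powr (- 1 - \<alpha>)) \<partial>lborel) \<partial>\<eta>)"

definition normalizer :: "'a::euclidean_space measure \<Rightarrow> ennreal" where
  "normalizer \<nu> = (\<integral>\<^sup>+x. ennreal (min 1 (norm x)) \<partial>\<nu>)"

definition normalized_measure :: "'a::euclidean_space measure \<Rightarrow> 'a measure" where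
  "normalized_measure \<nu> =
     scale_measure (inverse (normalizer \<nu>)) (density \<nu> (\<lambda>x. ennreal (min 1 (norm x))))"

definition angular_measure :: "'a::euclidean_space measure \<Rightarrow> 'a measure" where
  "angular_measure M =
     measure_of unit_sphere (sets sphere_borel) (\<lambda>S. emeasure M {r *\<^sub>R e |r e. 0 < r \<and> e \<in> S})"

section \<open>The set functions above are measures\<close>

text \<open>\<open>measure_of\<close> yields the null measure when its argument is not a measure; the following facts
  exclude this.\<close>

lemma cone_sets:
  fixes S :: "'a::euclidean_space set"
  assumes "S \<in> sets sphere_borel"
  shows "{r *\<^sub>R e |r e. 0 < r \<and> e \<in> S} \<in> sets borel"
    and "{r *\<^sub>R e |r e. 0 < r \<and> r \<le> 1 \<and> e \<in> S} \<in> sets borel"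
proof -
  have S: "S \<subseteq> unit_sphere" "S \<in> sets borel"
    using assms by (auto simp: sets_restrict_space)
  have eq: "{r *\<^sub>R e |r e. 0 < r \<and> e \<in> S} = {x. x \<noteq> 0 \<and> x /\<^sub>R norm x \<in> S}"
  proof safe
    fix r :: real and e assume *: "0 < r" "e \<in> S"
    with S have e: "norm e = 1" by auto
    show "r *\<^sub>R e = 0 \<Longrightarrow> False" using * e by auto
    show "(r *\<^sub>R e) /\<^sub>R norm (r *\<^sub>R e) \<in> S" using * e by auto
  next
    fix x :: 'a assume "x \<noteq> 0" "x /\<^sub>R norm x \<in> S"
    then show "\<exists>r e. x = r *\<^sub>R e \<and> 0 < r \<and> e \<in> S"
      by (intro exI[of _ "norm x"] exI[of _ "x /\<^sub>R norm x"]) auto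
  qed
  have "{x \<in> space borel. x \<noteq> (0::'a) \<and> x /\<^sub>R norm x \<in> S} \<in> sets borel"
    using S(2) by measurable
  then show 1: "{r *\<^sub>R e |r e. 0 < r \<and> e \<in> S} \<in> sets borel"
    unfolding eq by simp
  have eq2: "{r *\<^sub>R e |r e. 0 < r \<and> r \<le> 1 \<and> e \<in> S} = {r *\<^sub>R e |r e. 0 < r \<and> e \<in> S} \<inter> cball 0 1"
    using S(1) by (force simp: subset_iff)
  show "{r *\<^sub>R e |r e. 0 < r \<and> r \<le> 1 \<and> e \<in> S} \<in> sets borel"
    unfolding eq2 using 1 by auto
qed

lemma disjoint_family_cone:
  fixes S :: "nat \<Rightarrow> 'a::euclidean_space set"
  assumes "range S \<subseteq> sets sphere_borel" "disjoint_family S"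
  shows "disjoint_family (\<lambda>i. {r *\<^sub>R e |r e. 0 < r \<and> e \<in> S i})"
proof -
  have *: "norm e = 1" if "e \<in> S i" for e i
  proof -
    have "S i \<in> sets sphere_borel" using assms(1) by auto
    then show ?thesis using that by (auto simp: sets_restrict_space)
  qed
  have eq: "e = e'" if "r *\<^sub>R e = r' *\<^sub>R e'" "0 < r" "0 < r'" "norm e = 1" "norm e' = 1"
    for r r' :: real and e e' :: 'a
  proof -
    have "norm (r *\<^sub>R e) = norm (r' *\<^sub>R e')" using that(1) by simp
    then have "r = r'" using that(2-) by simp
    then show ?thesis using that by simp
  qed
  show ?thesis
    unfolding disjoint_family_on_def
  proof (intro ballI impI, rule ccontr)
    fix i j :: nat assume "i \<noteq> j"
      and "{r *\<^sub>R e |r e. 0 < r \<and> e \<in> S i} \<inter> {r *\<^sub>R e |r e. 0 < r \<and> e \<in> S j} \<noteq> {}"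
    then obtain r e r' e' where "r *\<^sub>R e = r' *\<^sub>R e'" "0 < r" "0 < r'" "e \<in> S i" "e' \<in> S j"
      by blast
    with eq[OF this(1-3)] * have "e \<in> S i \<inter> S j" by blast
    with \<open>i \<noteq> j\<close> assms(2) show False by (auto simp: disjoint_family_on_def)
  qed
qed

lemma sets_angular_measure: "sets (angular_measure M) = sets (sphere_borel :: 'a::euclidean_space measure)"
proof -
  have "sets (sphere_borel :: 'a measure) \<subseteq> Pow unit_sphere"
      "sigma_sets unit_sphere (sets sphere_borel) = sets (sphere_borel :: 'a measure)"
    using sets.space_closed[of sphere_borel] sets.sigma_sets_eq[of sphere_borel]
    by (simp_all add: space_restrict_space)
  then show ?thesis
    by (simp add: angular_measure_def sets_measure_of_conv)
qed

lemma emeasure_angular_measure: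
  fixes M :: "'a::euclidean_space measure"
  assumes M: "sets M = sets borel" and S: "S \<in> sets sphere_borel"
  shows "emeasure (angular_measure M) S = emeasure M {r *\<^sub>R e |r e. 0 < r \<and> e \<in> S}"
proof (rule emeasure_measure_of[OF angular_measure_def])
  show "sets sphere_borel \<subseteq> Pow unit_sphere"
    using sets.space_closed[of sphere_borel] by (simp add: space_restrict_space)
  show "S \<in> sets (angular_measure M)" using S by (simp add: sets_angular_measure)
  show "positive (sets (angular_measure M)) (\<lambda>S. emeasure M {r *\<^sub>R e |r e. 0 < r \<and> e \<in> S})"
    by (simp add: positive_def)
  show "countably_additive (sets (angular_measure M)) (\<lambda>S. emeasure M {r *\<^sub>R e |r e. 0 < r \<and> e \<in> S})"
    unfolding sets_angular_measure countably_additive_def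
  proof safe
    fix A :: "nat \<Rightarrow> 'a set" assume A: "range A \<subseteq> sets sphere_borel" "disjoint_family A"
    have "(\<Sum>i. emeasure M {r *\<^sub>R e |r e. 0 < r \<and> e \<in> A i}) =
        emeasure M (\<Union>i. {r *\<^sub>R e |r e. 0 < r \<and> e \<in> A i})"
      using A cone_sets(1) by (intro suminf_emeasure disjoint_family_cone) (auto simp: M)
    also have "(\<Union>i. {r *\<^sub>R e |r e. 0 < r \<and> e \<in> A i}) = {r *\<^sub>R e |r e. 0 < r \<and> e \<in> (\<Union>i. A i)}"
      by auto
    finally show "(\<Sum>i. emeasure M {r *\<^sub>R e |r e. 0 < r \<and> e \<in> A i}) =
        emeasure M {r *\<^sub>R e |r e. 0 < r \<and> e \<in> (\<Union>i. A i)}" .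
  qed
qed

lemma sets_surface_measure: "sets (surface_measure :: 'a::euclidean_space measure) = sets sphere_borel"
proof -
  have "sets (sphere_borel :: 'a measure) \<subseteq> Pow unit_sphere"
      "sigma_sets unit_sphere (sets sphere_borel) = sets (sphere_borel :: 'a measure)"
    using sets.space_closed[of sphere_borel] sets.sigma_sets_eq[of sphere_borel]
    by (simp_all add: space_restrict_space)
  then show ?thesis
    by (simp add: surface_measure_def sets_measure_of_conv)
qed

lemma emeasure_surface_measure:
  fixes S :: "'a::euclidean_space set"
  assumes S: "S \<in> sets sphere_borel"
  shows "emeasure surface_measure S =
    of_nat DIM('a) * emeasure lborel {r *\<^sub>R e |r e. 0 < r \<and> r \<le> 1 \<and> e \<in> S}"
proof (rule emeasure_measure_of[OF surface_measure_def])
  let ?c = "\<lambda>S::'a set. {r *\<^sub>R e |r e. 0 < r \<and> r \<le> 1 \<and> e \<in> S}"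
  show "sets sphere_borel \<subseteq> Pow unit_sphere"
    using sets.space_closed[of sphere_borel] by (simp add: space_restrict_space)
  show "S \<in> sets surface_measure" using S by (simp add: sets_surface_measure)
  show "positive (sets surface_measure) (\<lambda>S::'a set. of_nat DIM('a) * emeasure lborel (?c S))"
    by (simp add: positive_def)
  show "countably_additive (sets surface_measure) (\<lambda>S::'a set. of_nat DIM('a) * emeasure lborel (?c S))"
    unfolding sets_surface_measure countably_additive_def
  proof safe
    fix A :: "nat \<Rightarrow> 'a set" assume A: "range A \<subseteq> sets sphere_borel" "disjoint_family A"
    have "disjoint_family (\<lambda>i. ?c (A i))"
      by (rule disjoint_family_on_bisimulation[OF disjoint_family_cone[OF A]]) blast
    then have "(\<Sum>i. emeasure lborel (?c (A i))) = emeasure lborel (\<Union>i. ?c (A i))"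
      using A cone_sets(2) by (intro suminf_emeasure) auto
    also have "(\<Union>i. ?c (A i)) = ?c (\<Union>i. A i)"
      by auto
    finally show "(\<Sum>i. of_nat DIM('a) * emeasure lborel (?c (A i))) =
        of_nat DIM('a) * emeasure lborel (?c (\<Union>i. A i))"
      by simp
  qed
qed

lemma sets_stable_measure: "sets (stable_measure \<eta> \<alpha>) = sets borel"
  by (simp add: stable_measure_def sets_measure_of_conv sets.sigma_sets_eq[of borel, simplified])

lemma emeasure_stable_measure:
  fixes \<eta> :: "'a::euclidean_space measure"
  assumes \<eta>: "sets \<eta> = sets sphere_borel" and A: "A \<in> sets borel"
  shows "emeasure (stable_measure \<eta> \<alpha>) A =
    (\<integral>\<^sup>+\<theta>. (\<integral>\<^sup>+r\<in>{0<..}. indicator A (r *\<^sub>R \<theta>) * ennreal (r powr (- 1 - \<alpha>)) \<partial>lborel) \<partial>\<eta>)"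
proof (rule emeasure_measure_of[OF stable_measure_def])
  let ?g = "\<lambda>(A::'a set) (\<theta>::'a) (r::real). indicator A (r *\<^sub>R \<theta>) * ennreal (r powr (- 1 - \<alpha>)) * indicator {0<..} r"
  show "sets borel \<subseteq> Pow (UNIV :: 'a set)" by simp
  show "A \<in> sets (stable_measure \<eta> \<alpha>)" using A by (simp add: sets_stable_measure)
  show "positive (sets (stable_measure \<eta> \<alpha>)) (\<lambda>A. \<integral>\<^sup>+\<theta>. (\<integral>\<^sup>+r. ?g A \<theta> r \<partial>lborel) \<partial>\<eta>)"
    by (simp add: positive_def)
  have id: "(\<lambda>\<theta>. \<theta>) \<in> \<eta> \<rightarrow>\<^sub>M borel"
    by (subst measurable_cong_sets[OF \<eta> refl]) (rule measurable_restrict_space1, simp)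
  have meas: "(\<lambda>(\<theta>, r). ?g B \<theta> r) \<in> borel_measurable (\<eta> \<Otimes>\<^sub>M lborel)" if "B \<in> sets borel" for B
  proof -
    note [measurable] = that measurable_compose[OF measurable_fst id]
    show ?thesis by measurable
  qed
  show "countably_additive (sets (stable_measure \<eta> \<alpha>)) (\<lambda>A. \<integral>\<^sup>+\<theta>. (\<integral>\<^sup>+r. ?g A \<theta> r \<partial>lborel) \<partial>\<eta>)"
    unfolding sets_stable_measure countably_additive_def
  proof safe
    fix B :: "nat \<Rightarrow> 'a set" assume B: "range B \<subseteq> sets borel" "disjoint_family B"
    then have Bi: "B i \<in> sets borel" for i by auto
    have m1: "(\<lambda>\<theta>. \<integral>\<^sup>+r. ?g (B i) \<theta> r \<partial>lborel) \<in> borel_measurable \<eta>" for i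
      using lborel.borel_measurable_nn_integral[OF meas[OF Bi[of i]]] by simp
    have m2: "(\<lambda>r. ?g (B i) \<theta> r) \<in> borel_measurable lborel" for i \<theta>
    proof -
      note [measurable] = Bi
      show ?thesis by measurable
    qed
    have "(\<Sum>i. \<integral>\<^sup>+\<theta>. (\<integral>\<^sup>+r. ?g (B i) \<theta> r \<partial>lborel) \<partial>\<eta>) =
        (\<integral>\<^sup>+\<theta>. (\<Sum>i. \<integral>\<^sup>+r. ?g (B i) \<theta> r \<partial>lborel) \<partial>\<eta>)"
      by (rule nn_integral_suminf[symmetric]) (rule m1)
    also have "\<dots> = (\<integral>\<^sup>+\<theta>. (\<integral>\<^sup>+r. (\<Sum>i. ?g (B i) \<theta> r) \<partial>lborel) \<partial>\<eta>)"
      by (intro nn_integral_cong nn_integral_suminf[symmetric] m2)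
    also have "\<dots> = (\<integral>\<^sup>+\<theta>. (\<integral>\<^sup>+r. ?g (\<Union>i. B i) \<theta> r \<partial>lborel) \<partial>\<eta>)"
      by (intro nn_integral_cong)
         (simp add: suminf_indicator[OF B(2), symmetric] ennreal_suminf_multc)
    finally show "(\<Sum>i. \<integral>\<^sup>+\<theta>. (\<integral>\<^sup>+r. ?g (B i) \<theta> r \<partial>lborel) \<partial>\<eta>) =
        (\<integral>\<^sup>+\<theta>. (\<integral>\<^sup>+r. ?g (\<Union>i. B i) \<theta> r \<partial>lborel) \<partial>\<eta>)" .
  qed
qed

lemma sets_upper_variation: "sets (upper_variation m) = sets borel"
  by (simp add: upper_variation_def sets_measure_of_conv sets.sigma_sets_eq[of borel, simplified])

lemma vector_measure_empty: "vector_measure m \<Longrightarrow> m {} = 0"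
proof -
  assume "vector_measure m"
  then have "(\<lambda>i::nat. m {}) sums m (\<Union>i::nat. {})"
    unfolding vector_measure_def by (elim allE[of _ "\<lambda>_. {}"]) (auto simp: disjoint_family_on_def)
  then have "(\<lambda>i::nat. m {}) \<longlonglongrightarrow> 0"
    by (intro summable_LIMSEQ_zero) (auto simp: sums_iff)
  then show ?thesis by (simp add: LIMSEQ_const_iff)
qed

lemma emeasure_upper_variation:
  fixes m :: "'a::topological_space set \<Rightarrow> real"
  assumes m: "vector_measure m" and A: "A \<in> sets borel"
  shows "emeasure (upper_variation m) A = (SUP B\<in>{B\<in>sets borel. B \<subseteq> A}. ennreal (m B))"
proof (rule emeasure_measure_of[OF upper_variation_def])
  let ?p = "\<lambda>A. SUP B\<in>{B\<in>sets borel. B \<subseteq> A}. ennreal (m B)"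
  have m0: "m {} = 0" by (rule vector_measure_empty[OF m])
  show "sets borel \<subseteq> Pow (UNIV :: 'a set)" by simp
  show "A \<in> sets (upper_variation m)" using A by (simp add: sets_upper_variation)
  have "{B :: 'a set. B \<in> sets borel \<and> B \<subseteq> {}} = {{}}" by auto
  then show "positive (sets (upper_variation m)) ?p"
    by (simp add: positive_def m0)
  show "countably_additive (sets (upper_variation m)) ?p"
    unfolding sets_upper_variation countably_additive_def
  proof safe
    fix E :: "nat \<Rightarrow> 'a set" assume E: "range E \<subseteq> sets borel" "disjoint_family E"
    have ub: "ennreal (m B) \<le> (\<Sum>i. ?p (E i))" if B: "B \<in> sets borel" "B \<subseteq> (\<Union>i. E i)" for B
    proof -
      have "(\<lambda>i. m (B \<inter> E i)) sums m (\<Union>i. B \<inter> E i)"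
        using m E B unfolding vector_measure_def
        by (elim allE[of _ "\<lambda>i. B \<inter> E i"]) (auto simp: disjoint_family_on_def)
      also have "(\<Union>i. B \<inter> E i) = B" using B(2) by auto
      finally have s: "(\<lambda>n. ennreal (\<Sum>i<n. m (B \<inter> E i))) \<longlonglongrightarrow> ennreal (m B)"
        by (intro tendsto_ennrealI) (simp add: sums_def)
      show ?thesis
      proof (rule LIMSEQ_le_const2[OF s], intro exI allI impI)
        fix n
        have "ennreal (\<Sum>i<n. m (B \<inter> E i)) \<le> ennreal (\<Sum>i<n. max 0 (m (B \<inter> E i)))"
          by (intro ennreal_leI sum_mono) auto
        also have "\<dots> = (\<Sum>i<n. ennreal (max 0 (m (B \<inter> E i))))"
          by (rule sum_ennreal[symmetric]) auto
        also have "\<dots> = (\<Sum>i<n. ennreal (m (B \<inter> E i)))"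
          by (intro sum.cong refl) (auto simp: max_def ennreal_neg)
        also have "\<dots> \<le> (\<Sum>i<n. ?p (E i))"
          using E B by (intro sum_mono SUP_upper) auto
        also have "\<dots> \<le> (\<Sum>i. ?p (E i))"
          by (intro sum_le_suminf) auto
        finally show "ennreal (\<Sum>i<n. m (B \<inter> E i)) \<le> (\<Sum>i. ?p (E i))" .
      qed
    qed
    have lb: "(\<Sum>i<n. ?p (E i)) \<le> ?p (\<Union>i. E i)" for n
    proof -
      have "(\<Sum>i<n. ?p (E i)) \<le> ?p (\<Union>i<n. E i)"
      proof (induction n)
        case 0 show ?case by simp
      next
        case (Suc n)
        have step: "ennreal (m B) + ennreal (m B') \<le> ?p (\<Union>i<Suc n. E i)"
          if B: "B \<in> sets borel" "B \<subseteq> (\<Union>i<n. E i)" "B' \<in> sets borel" "B' \<subseteq> E n" for B B'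
        proof -
          show ?thesis
          proof (cases "m B \<ge> 0 \<and> m B' \<ge> 0")
            case True
            have BB: "B \<inter> B' = {}"
            proof (rule ccontr)
              assume "B \<inter> B' \<noteq> {}"
              then obtain x i where x: "x \<in> E i" "i < n" "x \<in> E n" using B by blast
              moreover have "E i \<inter> E n = {}"
                using E(2) x(2) by (auto simp: disjoint_family_on_def)
              ultimately show False by blast
            qed
            define D where "D i = (if i = 0 then B else if i = Suc 0 then B' else {})" for i :: nat
            have D: "range D \<subseteq> sets borel" "disjoint_family D"
              using that BB by (auto simp: D_def disjoint_family_on_def)
            have "(\<lambda>i. m (D i)) sums m (\<Union>i. D i)"
              using m D unfolding vector_measure_def by auto
            moreover have "(\<lambda>i. m (D i)) sums (\<Sum>i<2. m (D i))"
              by (rule sums_finite) (auto simp: D_def m0)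
            ultimately have "m (\<Union>i. D i) = (\<Sum>i<2. m (D i))" by (rule sums_unique2)
            also have "(\<Union>i. D i) = B \<union> B'"
              by (auto simp: D_def split: if_splits)
            finally have "m (B \<union> B') = m B + m B'"
              by (simp add: D_def numeral_2_eq_2)
            then have "ennreal (m B) + ennreal (m B') = ennreal (m (B \<union> B'))"
              using True by simp
            also have "\<dots> \<le> ?p (\<Union>i<Suc n. E i)"
              using that by (intro SUP_upper) (auto simp: lessThan_Suc)
            finally show ?thesis .
          next
            case False
            then show ?thesis
            proof (cases "m B < 0")
              case True
              then have "ennreal (m B) + ennreal (m B') = ennreal (m B')" by (simp add: ennreal_neg)
              also have "\<dots> \<le> ?p (\<Union>i<Suc n. E i)"
                using that by (intro SUP_upper) (auto simp: lessThan_Suc)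
              finally show ?thesis .
            next
              case F: False
              then have "ennreal (m B) + ennreal (m B') = ennreal (m B)"
                using False by (simp add: ennreal_neg)
              also have "\<dots> \<le> ?p (\<Union>i<Suc n. E i)"
                using that by (intro SUP_upper) (auto simp: lessThan_Suc)
              finally show ?thesis .
            qed
          qed
        qed
        have "?p (\<Union>i<n. E i) + ?p (E n) \<le> ?p (\<Union>i<Suc n. E i)"
        proof -
          have ne: "{B \<in> sets borel. B \<subseteq> X} \<noteq> {}" for X :: "'a set" by auto
          show ?thesis
            by (subst ennreal_SUP_add_left[symmetric, OF ne], rule SUP_least,
                subst ennreal_SUP_add_right[OF ne], rule SUP_least)
               (rule step, auto)
        qed
        then show ?case
          using Suc by (simp only: sum.lessThan_Suc) (meson add_right_mono order_trans)
      qed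
      also have "\<dots> \<le> ?p (\<Union>i. E i)"
        by (intro SUP_subset_mono) auto
      finally show ?thesis .
    qed
    show "(\<Sum>i. ?p (E i)) = ?p (\<Union>i. E i)"
    proof (rule antisym)
      show "(\<Sum>i. ?p (E i)) \<le> ?p (\<Union>i. E i)"
        using lb by (intro suminf_le_const) auto
      show "?p (\<Union>i. E i) \<le> (\<Sum>i. ?p (E i))"
        using ub by (intro SUP_least) auto
    qed
  qed
qed

end

theory Submission
  imports Defs
begin

text \<open>
  In polar coordinates both the normalizer and the truncated angular mass of \<open>\<nu>\<^sub>\<alpha>\<close> factor through the
  same radial integral \<open>1 / (1 - \<alpha>) + 1 / \<alpha>\<close>, so \<open>\<mu>\<^sub>\<alpha> = \<eta>\<close> for every \<open>\<alpha>\<close> and hence \<open>\<mu> = \<eta>\<close>. With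
  \<open>\<omega>\<^sub>\<theta>(r) = \<parallel>f(\<cdot> + r\<theta>) - f\<parallel>\<^sub>1\<close> the energy is
  \<open>1/2 \<integral> \<integral>\<^sub>0\<^sup>\<infinity> \<omega>\<^sub>\<theta>(r) r\<^sup>-\<^sup>1\<^sup>-\<^sup>\<alpha> dr \<eta>(d\<theta>)\<close>, and \<open>(1 - \<alpha>) r\<^sup>-\<^sup>\<alpha> dr\<close> on \<open>(0, 1]\<close> concentrates at \<open>0\<close> as
  \<open>\<alpha> \<up> 1\<close>. It therefore suffices that \<open>\<omega>\<^sub>\<theta>(r) \<le> r V(\<theta>)\<close> and \<open>\<omega>\<^sub>\<theta>(r) / r \<rightarrow> V(\<theta>)\<close> with
  \<open>V(\<theta>) = \<integral> |Df \<cdot> \<theta>|\<close>. Both follow by duality: for a test function \<open>\<phi>\<close> the function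
  \<open>s \<mapsto> \<integral> f(x) \<phi>(x - s\<theta>) dx\<close> has derivative \<open>\<integral> \<phi>(x - s\<theta>) (Df \<cdot> \<theta>)(dx)\<close>, and test functions bounded
  by \<open>1\<close> are norming both for \<open>L\<^sup>1\<close> and for \<open>Df \<cdot> \<theta>\<close>. Dominated convergence over \<open>\<theta>\<close> finishes the
  proof. A set of finite volume gains and loses the same volume under a translation, so its nonlocal
  perimeter is the energy of its indicator, and rotation invariance of the surface measure evaluates
  the right-hand side for uniform \<open>\<eta>\<close>.
\<close>

section \<open>Test functions\<close>

text \<open>The obstacle is that \<open>Df\<close> is given only as a chosen set function, with
  integrals and variations defined through suprema, while all directions \<theta> have to be treated
  at once. Writing \<open>Df = G dM\<close> with one finite measure \<open>M\<close> makes \<theta>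
  enter linearly, as \<open>G x \<bullet> \<theta>\<close>. This yields measurability and a uniform
  bound for V(\<theta>) and, for uniform \<eta>, the exchange of the integrals over x and \<theta>.
  Duality takes the place of mollification. The upper bound is a mean value theorem along translates
  of a test function adapted to the difference of f and its translate; the lower bound needs one
  test function adapted to Df \<sqdot> \<theta> and a derivative at 0. The density (1 - \<alpha>)
  r^(-\<alpha>) has mass \<delta>^(1-\<alpha>) on (0, \<delta>], which tends to 1 for each fixed
  \<delta>, while (1 - \<alpha>) r^(-1-\<alpha>) has mass (1 - \<alpha>)/\<alpha> on (1,
  \<infinity>), which tends to 0. Hence the crude bound 2 ||f||_1 suffices away from the origin. The
  constant in the perimeter formula is the mean of |u \<bullet> \<theta>| over the sphere for a unit
  vector u, halved by the factor 1/2 of the energy.\<close>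

lemma C_k_SucD: "C_k (Suc k) \<phi> \<Longrightarrow> C_k k \<phi>"
proof (induction k arbitrary: \<phi>)
  case 0
  then show ?case by (simp add: differentiable_imp_continuous_on)
next
  case (Suc k)
  then show ?case by auto
qed

lemma frechet_derivative_applyI:
  "(f has_derivative f') (at x) \<Longrightarrow> frechet_derivative f (at x) v = f' v"
  using frechet_derivative_at by metis

lemma C_k_differentiable: "C_k (Suc k) \<phi> \<Longrightarrow> (\<phi> has_derivative frechet_derivative \<phi> (at x)) (at x)"
  by (auto simp: differentiable_on_def frechet_derivative_works)

lemma C_k_const: "C_k k (\<lambda>x. c)"
proof (induction k arbitrary: c)
  case (Suc k)
  have "frechet_derivative (\<lambda>x::'a. c) (at x) b = 0" for x b
    by (rule frechet_derivative_applyI) auto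
  then show ?case using Suc by (simp add: differentiable_on_def)
qed simp

text \<open>\<open>frechet_derivative\<close> is a choice operator. By uniqueness of derivatives any
  explicitly computed derivative may stand for it, so the closure proofs can rely on the usual rules
  of differentiation.\<close>

lemma C_k_SucI:
  assumes "\<And>x. (\<phi> has_derivative \<phi>' x) (at x)" "\<And>b. b \<in> Basis \<Longrightarrow> C_k k (\<lambda>x. \<phi>' x b)"
  shows "C_k (Suc k) \<phi>"
proof -
  have "frechet_derivative \<phi> (at x) = \<phi>' x" for x
    using assms(1) frechet_derivative_at by metis
  then show ?thesis
    using assms by (auto simp: differentiable_on_def differentiable_def)
qed

lemma C_k_add: "C_k k f \<Longrightarrow> C_k k g \<Longrightarrow> C_k k (\<lambda>x. f x + g x)"
proof (induction k arbitrary: f g)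
  case 0 then show ?case by (auto intro: continuous_intros)
next
  case (Suc k)
  show ?case
    by (rule C_k_SucI[OF has_derivative_add[OF C_k_differentiable[OF Suc.prems(1)] C_k_differentiable[OF Suc.prems(2)]]])
       (use Suc in auto)
qed

text \<open>The product rule leaves one factor undifferentiated; \<open>C_k_SucD\<close> lowers its
  order so that the induction hypothesis applies to each summand.\<close>

lemma C_k_mult: "C_k k f \<Longrightarrow> C_k k g \<Longrightarrow> C_k k (\<lambda>x. f x * g x)"
proof (induction k arbitrary: f g)
  case 0 then show ?case by (auto intro: continuous_intros)
next
  case (Suc k)
  show ?case
    by (rule C_k_SucI[OF has_derivative_mult[OF C_k_differentiable[OF Suc.prems(1)] C_k_differentiable[OF Suc.prems(2)]]])
       (use Suc C_k_SucD[OF Suc.prems(1)] C_k_SucD[OF Suc.prems(2)] in \<open>auto intro!: C_k_add\<close>)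
qed

lemma C_k_diff: "C_k k f \<Longrightarrow> C_k k g \<Longrightarrow> C_k k (\<lambda>x. f x - g x)"
  using C_k_add[of k f "\<lambda>x. -1 * g x"] C_k_mult[OF C_k_const[of k "-1"], of g] by simp

lemma C_k_prod: "(\<And>i. i \<in> I \<Longrightarrow> C_k k (f i)) \<Longrightarrow> C_k k (\<lambda>x. \<Prod>i\<in>I. f i x)"
  by (induction I rule: infinite_finite_induct) (auto intro: C_k_mult C_k_const)

lemma C_k_power: "C_k k f \<Longrightarrow> C_k k (\<lambda>x. f x ^ n)"
  by (induction n) (auto intro: C_k_mult C_k_const)

lemma C_k_translate: "C_k k f \<Longrightarrow> C_k k (\<lambda>x. f (x - a))"
proof (induction k arbitrary: f)
  case 0 then show ?case by (auto intro!: continuous_intros elim: continuous_on_compose2)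
next
  case (Suc k)
  have "((\<lambda>x. f (x - a)) has_derivative frechet_derivative f (at (x - a))) (at x)" for x
    by (rule has_derivative_compose[of "\<lambda>x. x - a" "\<lambda>x. x", OF _ C_k_differentiable[OF Suc.prems]])
       (auto intro!: derivative_eq_intros)
  then show ?case
    by (rule C_k_SucI) (use Suc in auto)
qed

text \<open>The family over all \<open>n\<close> is closed under differentiation up to linear combinations, so smoothness
  of \<open>exp (- 1 / t)\<close> at \<open>0\<close> reduces to one induction.\<close>

definition exp_flat :: "nat \<Rightarrow> real \<Rightarrow> real" where
  "exp_flat n t = (if t > 0 then (1 / t) ^ n * exp (- 1 / t) else 0)"

lemma exp_flat_0_bounds: "0 \<le> exp_flat 0 t" "exp_flat 0 t \<le> 1" "exp_flat 0 t > 0 \<longleftrightarrow> t > 0"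
  by (auto simp: exp_flat_def)

text \<open>With x = 1/t this is the decay of x^n / exp x at infinity.\<close>

lemma exp_flat_tendsto_0: "(exp_flat n \<longlongrightarrow> 0) (at_right 0)"
proof -
  have "((\<lambda>x::real. x ^ n / exp x) \<longlongrightarrow> 0) at_top"
    by (rule tendsto_power_div_exp_0)
  then have "((\<lambda>t. inverse t ^ n / exp (inverse t :: real)) \<longlongrightarrow> 0) (at_right 0)"
    by (rule filterlim_compose[OF _ filterlim_inverse_at_top_right])
  then show ?thesis
    by (rule Lim_transform_eventually)
       (auto simp: exp_flat_def exp_minus field_simps eventually_at_filter)
qed

lemma exp_flat_has_derivative:
  "(exp_flat n has_real_derivative exp_flat (n + 2) t - real n * exp_flat (n + 1) t) (at t)"
proof -
  consider "t > 0" | "t < 0" | "t = 0" by linarith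
  then show ?thesis
  proof cases
    case 1
    have "((\<lambda>t. (1 / t) ^ n * exp (- 1 / t)) has_real_derivative exp_flat (n + 2) t - real n * exp_flat (n + 1) t) (at t)"
      using 1 by (auto intro!: derivative_eq_intros simp: exp_flat_def)
        (cases n; simp add: field_simps power2_eq_square)
    moreover have "\<forall>\<^sub>F s in nhds t. (1 / s) ^ n * exp (- 1 / s) = exp_flat n s"
      using eventually_nhds_in_open[of "{0<..}" t] 1 by (auto simp: exp_flat_def elim: eventually_mono)
    ultimately show ?thesis
      by (subst (asm) DERIV_cong_ev) auto
  next
    case 2
    have "((\<lambda>t. 0) has_real_derivative exp_flat (n + 2) t - real n * exp_flat (n + 1) t) (at t)"
      using 2 by (auto simp: exp_flat_def)
    moreover have "\<forall>\<^sub>F s in nhds t. 0 = exp_flat n s"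
      using eventually_nhds_in_open[of "{..<0}" t] 2 by (auto simp: exp_flat_def elim: eventually_mono)
    ultimately show ?thesis
      by (subst (asm) DERIV_cong_ev) auto
  next
    case 3
    \<comment> \<open>For h > 0 the difference quotient of \<open>exp_flat n\<close> at 0 is exactly
      \<open>exp_flat (Suc n) h\<close>, so the one-sided limit is already known.\<close>
    have r: "((\<lambda>h. exp_flat n h / h) \<longlongrightarrow> 0) (at_right 0)"
      by (rule Lim_transform_eventually[OF exp_flat_tendsto_0[of "Suc n"]])
         (auto simp: exp_flat_def eventually_at_filter)
    have l: "((\<lambda>h. exp_flat n h / h) \<longlongrightarrow> 0) (at_left 0)"
      by (rule Lim_transform_eventually[OF tendsto_const])
         (auto simp: exp_flat_def eventually_at_filter)
    have "((\<lambda>h. exp_flat n h / h) \<longlongrightarrow> 0) (at 0)"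
      using filterlim_split_at[OF l r] .
    then show ?thesis using 3 by (simp add: DERIV_def exp_flat_def)
  qed
qed

text \<open>Keeping \<open>n\<close> arbitrary closes the induction: a directional derivative is a
  constant multiple of a combination of members with larger index. Affine arguments are enough
  because a box is an intersection of half-spaces.\<close>

lemma C_k_flat: "C_k k (\<lambda>x. exp_flat n (x \<bullet> w + c))"
proof (induction k arbitrary: n)
  case 0
  have "continuous_on UNIV (exp_flat n)"
    by (auto simp: continuous_on_eq_continuous_at intro!: DERIV_isCont exp_flat_has_derivative)
  then show ?case
    by (auto intro!: continuous_intros elim!: continuous_on_compose2)
next
  case (Suc k)
  have "((\<lambda>x. exp_flat n (x \<bullet> w + c)) has_derivative
      (\<lambda>v. (exp_flat (n + 2) (x \<bullet> w + c) - real n * exp_flat (n + 1) (x \<bullet> w + c)) * (v \<bullet> w))) (at x)" for x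
    by (rule has_derivative_compose[of "\<lambda>x. x \<bullet> w + c" "\<lambda>v. v \<bullet> w", OF _ exp_flat_has_derivative[unfolded has_field_derivative_def]])
       (auto intro!: derivative_eq_intros)
  then show ?case
    by (rule C_k_SucI) (intro C_k_mult C_k_diff C_k_const Suc)
qed

text \<open>There are two factors per coordinate, each positive on one open half-space, so
  positivity holds exactly on the open box. No plateau is built in; taking powers of the
  complementary factor produces one in the limit.\<close>

definition box_bump :: "'a::euclidean_space \<Rightarrow> 'a \<Rightarrow> 'a \<Rightarrow> real" where
  "box_bump l u x = (\<Prod>b\<in>Basis. exp_flat 0 (x \<bullet> b - l \<bullet> b) * exp_flat 0 (u \<bullet> b - x \<bullet> b))"

lemma C_k_box_bump: "C_k k (box_bump l u)"
  using C_k_flat[of k 0 b "- (l \<bullet> b)" for b] C_k_flat[of k 0 "- b" "u \<bullet> b" for b]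
  unfolding box_bump_def by (intro C_k_prod C_k_mult) auto

lemma box_bump_bounds: "0 \<le> box_bump l u x" "box_bump l u x \<le> 1"
  unfolding box_bump_def
  by (auto intro!: prod_nonneg prod_le_1 mult_nonneg_nonneg mult_le_one exp_flat_0_bounds)

lemma box_bump_eq_0_iff: "box_bump l u x = 0 \<longleftrightarrow> x \<notin> box l u"
proof -
  have "exp_flat 0 t = 0 \<longleftrightarrow> \<not> t > 0" for t
    using exp_flat_0_bounds[of t] by linarith
  then show ?thesis
    unfolding box_bump_def by (auto simp: mem_box)
qed

lemma C_k_continuous: "C_k k f \<Longrightarrow> continuous_on UNIV f"
proof (induction k)
  case (Suc k)
  from Suc.IH[OF C_k_SucD[OF Suc.prems]] show ?case .
qed simp

text \<open>By regularity it is enough to approximate an open set \<open>W\<close> that is a finite union of boxes: if \<open>s\<close> is the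
  product of the factors \<open>1 - box_bump\<close>, then \<open>1 - s ^ n\<close> tends to the indicator of \<open>W\<close>, and no smooth step
  function is needed.\<close>

lemma test_functions_approx_indicator:
  fixes M :: "'a::euclidean_space measure"
  assumes "finite_measure M" and sM: "sets M = sets borel" and B: "B \<in> sets borel" and "\<epsilon> > 0"
  obtains \<phi> where "\<phi> \<in> test_functions" "\<And>x. 0 \<le> \<phi> x" "\<And>x. \<phi> x \<le> 1"
    "(\<integral>x. \<bar>\<phi> x - indicator B x\<bar> \<partial>M) < \<epsilon>"
proof -
  interpret finite_measure M by fact
  have B': "B \<in> sets M" using B sM by simp
  have spM: "space M = UNIV" using sets_eq_imp_space_eq[OF sM] by simp
  have [simp]: "borel_measurable M = borel_measurable borel"
    by (intro measurable_cong_sets sM refl)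
  \<comment> \<open>The budget is \<epsilon>/4 for outer and \<epsilon>/4 for inner regularity, so
    \<open>U - K\<close> costs less than \<epsilon>/2; the other half is left for the convergence of
    the powers.\<close>
  have "emeasure M B < emeasure M B + ennreal (\<epsilon>/4)"
    using \<open>\<epsilon> > 0\<close> by (simp add: emeasure_eq_measure ennreal_less_iff flip: ennreal_plus)
  then obtain U where U: "B \<subseteq> U" "open U" "emeasure M U < emeasure M B + ennreal (\<epsilon>/4)"
    using outer_regular[OF sM _ B] by (auto simp: INF_less_iff)
  have "\<exists>K. K \<subseteq> B \<and> compact K \<and> emeasure M B < emeasure M K + ennreal (\<epsilon>/4)"
  \<comment> \<open>Inner regularity yields a compact set only for a level strictly below the
    measure of \<open>B\<close>. No such level exists when that measure is 0, and the empty set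
    serves instead.\<close>
  proof (cases "emeasure M B = 0")
    case True then show ?thesis using \<open>\<epsilon> > 0\<close> by (intro exI[of _ "{}"]) auto
  next
    case False
    then have "measure M B > 0" by (simp add: emeasure_eq_measure zero_less_measure_iff)
    then have "ennreal (measure M B - \<epsilon>/4) < emeasure M B"
      using \<open>\<epsilon> > 0\<close> by (auto simp: emeasure_eq_measure ennreal_less_iff ennreal_lessI)
    then obtain K where K: "K \<subseteq> B" "compact K" "ennreal (measure M B - \<epsilon>/4) < emeasure M K"
      using inner_regular[OF sM _ B] by (auto simp: less_SUP_iff)
    moreover have "emeasure M B < emeasure M K + ennreal (\<epsilon>/4)"
    proof -
      have "measure M B - \<epsilon>/4 < measure M K"
        using K(3) ennreal_leI[of "measure M K" "measure M B - \<epsilon>/4"]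
        by (simp only: emeasure_eq_measure not_less[symmetric]) blast
      then show ?thesis
        using \<open>\<epsilon> > 0\<close> by (simp add: emeasure_eq_measure ennreal_less_iff flip: ennreal_plus)
    qed
    ultimately show ?thesis by blast
  qed
  then obtain K where K: "K \<subseteq> B" "compact K" "emeasure M B < emeasure M K + ennreal (\<epsilon>/4)" by blast
  have KU: "measure M (U - K) < \<epsilon> / 2"
  proof -
    have "measure M U < measure M B + \<epsilon>/4" "measure M B < measure M K + \<epsilon>/4"
      using U(3) K(3) \<open>\<epsilon> > 0\<close> by (auto simp: emeasure_eq_measure ennreal_less_iff simp flip: ennreal_plus)
    moreover have "measure M (U - K) = measure M U - measure M K"
      using K U by (intro finite_measure_Diff) (auto simp: sM compact_imp_closed)
    ultimately show ?thesis by linarith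
  qed
  have "\<exists>l u. x \<in> box l u \<and> cbox l u \<subseteq> U" if "x \<in> K" for x
  proof -
    have "x \<in> U" using that K U by auto
    then show ?thesis
      using open_contains_cbox[of U x] U(2) by metis
  qed
  then obtain l u where lu: "\<And>x. x \<in> K \<Longrightarrow> x \<in> box (l x) (u x) \<and> cbox (l x) (u x) \<subseteq> U" by metis
  obtain F where F: "F \<subseteq> K" "finite F" "K \<subseteq> (\<Union>x\<in>F. box (l x) (u x))"
    using compactE_image[OF K(2), of K "\<lambda>x. box (l x) (u x)"] lu open_box by blast
  define W where "W = (\<Union>x\<in>F. box (l x) (u x))"
  have W: "K \<subseteq> W" "W \<subseteq> U" "open W"
    using F lu box_subset_cbox unfolding W_def by blast+
  define s where "s x = (\<Prod>y\<in>F. 1 - box_bump (l y) (u y) x)" for x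
  have s: "0 \<le> s x" "s x \<le> 1" for x
    unfolding s_def using box_bump_bounds by (auto intro!: prod_nonneg prod_le_1)
  have sW: "s x = 1" if "x \<notin> W" for x
    unfolding s_def using that unfolding W_def by (auto intro!: prod.neutral simp: box_bump_eq_0_iff)
  have sW': "s x < 1" if xW: "x \<in> W" for x
  proof -
    obtain y where y: "y \<in> F" "x \<in> box (l y) (u y)" using xW by (auto simp: W_def)
    have "s x = (1 - box_bump (l y) (u y) x) * (\<Prod>y\<in>F-{y}. 1 - box_bump (l y) (u y) x)"
      unfolding s_def using y F by (simp add: prod.remove)
    also have "\<dots> \<le> (1 - box_bump (l y) (u y) x) * 1"
      using box_bump_bounds by (intro mult_left_mono prod_le_1) auto
    finally have "s x \<le> 1 - box_bump (l y) (u y) x" by simp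
    moreover have "box_bump (l y) (u y) x \<noteq> 0" using y by (simp add: box_bump_eq_0_iff)
    ultimately show ?thesis using box_bump_bounds(1)[of "l y" "u y" x] by linarith
  qed
  define \<phi> where "\<phi> n x = 1 - s x ^ n" for n x
  have C: "C_k k (\<phi> n)" for k n
    unfolding \<phi>_def s_def by (intro C_k_diff C_k_power C_k_prod C_k_const C_k_box_bump)
  have b: "0 \<le> \<phi> n x" "\<phi> n x \<le> 1" for n x
    using s by (auto simp: \<phi>_def power_le_one)
  have bi: "\<bar>\<phi> n x - indicator A x\<bar> \<le> 1" for n x A
    using b[of n x] by (auto simp: indicator_def)
  have test: "\<phi> n \<in> test_functions" for n
  proof -
    have "closure {x. \<phi> n x \<noteq> 0} \<subseteq> (\<Union>x\<in>F. cbox (l x) (u x))"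
    proof (rule closure_minimal)
      show "{x. \<phi> n x \<noteq> 0} \<subseteq> (\<Union>x\<in>F. cbox (l x) (u x))"
        using sW box_subset_cbox by (fastforce simp: \<phi>_def W_def)
      show "closed (\<Union>x\<in>F. cbox (l x) (u x))" using F by auto
    qed
    then have "compact (closure {x. \<phi> n x \<noteq> 0})"
      using F(2) by (meson bounded_UN bounded_cbox bounded_subset closed_closure compact_eq_bounded_closed)
    then show ?thesis using C by (simp add: test_functions_def)
  qed
  have [measurable]: "\<phi> n \<in> borel_measurable borel" for n
    using C_k_continuous[OF C] by (simp add: borel_measurable_continuous_onI)
  have [measurable]: "W \<in> sets borel" "B \<in> sets borel" "K \<in> sets borel" "U \<in> sets borel"
    using W B K U by (auto simp: compact_imp_closed)
  have "(\<lambda>n. \<integral>x. \<bar>\<phi> n x - indicator W x\<bar> \<partial>M) \<longlonglongrightarrow> (\<integral>x. 0 \<partial>M)"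
  proof (rule integral_dominated_convergence[where w = "\<lambda>_. 1"])
    show "AE x in M. (\<lambda>n. \<bar>\<phi> n x - indicator W x\<bar>) \<longlonglongrightarrow> 0"
    proof (intro AE_I2)
      fix x
      show "(\<lambda>n. \<bar>\<phi> n x - indicator W x\<bar>) \<longlonglongrightarrow> 0"
      proof (cases "x \<in> W")
        case True
        then have "(\<lambda>n. s x ^ n) \<longlonglongrightarrow> 0" using s sW' by (intro LIMSEQ_realpow_zero) auto
        then show ?thesis using True s by (simp add: \<phi>_def)
      qed (simp add: \<phi>_def sW)
    qed
    show "AE x in M. norm \<bar>\<phi> n x - indicator W x\<bar> \<le> 1" for n
      using bi by (intro AE_I2) simp
  qed auto
  then have "\<forall>\<^sub>F n in sequentially. (\<integral>x. \<bar>\<phi> n x - indicator W x\<bar> \<partial>M) < \<epsilon> / 2"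
    using \<open>\<epsilon> > 0\<close> by (intro order_tendstoD) auto
  then obtain n where n: "(\<integral>x. \<bar>\<phi> n x - indicator W x\<bar> \<partial>M) < \<epsilon> / 2"
    by (auto simp: eventually_sequentially)
  have int: "integrable M (\<lambda>x. \<bar>\<phi> n x - indicator A x\<bar>)" if [measurable]: "A \<in> sets borel" for A
    using bi by (intro integrable_const_bound[where B=1] AE_I2) auto
  \<comment> \<open>Both \<open>B\<close> and \<open>W\<close> lie between \<open>K\<close> and
    \<open>U\<close>, so their indicators can differ only on \<open>U - K\<close>.\<close>
  have "(\<integral>x. \<bar>\<phi> n x - indicator B x\<bar> \<partial>M) \<le> (\<integral>x. \<bar>\<phi> n x - indicator W x\<bar> + indicator (U - K) x \<partial>M)"
    using K U W by (intro integral_mono Bochner_Integration.integrable_add int integrable_real_indicator)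
      (auto simp: indicator_def sM emeasure_eq_measure)
  also have "\<dots> = (\<integral>x. \<bar>\<phi> n x - indicator W x\<bar> \<partial>M) + measure M (U - K)"
    by (subst Bochner_Integration.integral_add)
       (auto intro!: int integrable_real_indicator simp: sM emeasure_eq_measure spM)
  also have "\<dots> < \<epsilon>" using n KU by simp
  finally show ?thesis using that[of "\<phi> n"] test b by blast
qed

section \<open>Bounded test functions are norming\<close>

lemma test_functions_diff:
  assumes "\<phi> \<in> test_functions" "\<psi> \<in> test_functions"
  shows "(\<lambda>x. \<phi> x - \<psi> x) \<in> test_functions"
proof -
  have "closure {x. \<phi> x - \<psi> x \<noteq> 0} \<subseteq> closure ({x. \<phi> x \<noteq> 0} \<union> {x. \<psi> x \<noteq> 0})"
    by (intro closure_mono) auto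
  then have "compact (closure {x. \<phi> x - \<psi> x \<noteq> 0})"
    using assms unfolding closure_Un test_functions_def
    by (metis (mono_tags, lifting) bounded_Un bounded_subset closed_closure compact_eq_bounded_closed mem_Collect_eq)
  then show ?thesis
    using assms by (auto simp: test_functions_def intro: C_k_diff)
qed

lemma test_function_measurable[measurable_dest]:
  "\<phi> \<in> test_functions \<Longrightarrow> \<phi> \<in> borel_measurable borel"
  using C_k_continuous by (auto simp: test_functions_def intro: borel_measurable_continuous_onI)

text \<open>The sign of \<open>g\<close> is the indicator of {g > 0} minus that of {g < 0}; each is
  approximated with respect to the measure |g| dM. That measure is finite even for Lebesgue
  \<open>M\<close>, so the lemma serves both for differences of translates of f and for the
  gradient. The difference of two functions with values in [0, 1] automatically stays within
  [-1, 1].\<close>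

lemma test_functions_norming:
  fixes M :: "'a::euclidean_space measure"
  assumes sM: "sets M = sets borel" and g: "integrable M g" and "\<epsilon> > 0"
  obtains \<phi> where "\<phi> \<in> test_functions" "\<And>x. \<bar>\<phi> x\<bar> \<le> 1"
    "(\<integral>x. \<bar>g x\<bar> \<partial>M) - \<epsilon> \<le> (\<integral>x. g x * \<phi> x \<partial>M)"
proof -
  define N where "N = density M (\<lambda>x. ennreal \<bar>g x\<bar>)"
  have [simp]: "borel_measurable M = borel_measurable borel"
    by (intro measurable_cong_sets sM refl)
  have gm[measurable]: "g \<in> borel_measurable borel" using g by auto
  have sN: "sets N = sets borel" by (simp add: N_def sM)
  have N: "finite_measure N"
    using g by (intro finite_measureI)
      (auto simp: N_def emeasure_density integrable_iff_bounded cong: nn_integral_cong_simp)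
  define P where "P = {x. g x > 0}"
  define Q where "Q = {x. g x < 0}"
  have PQ[measurable]: "P \<in> sets borel" "Q \<in> sets borel" by (simp_all add: P_def Q_def)
  obtain \<phi> where \<phi>: "\<phi> \<in> test_functions" "\<And>x. 0 \<le> \<phi> x" "\<And>x. \<phi> x \<le> 1"
    "(\<integral>x. \<bar>\<phi> x - indicator P x\<bar> \<partial>N) < \<epsilon>/2"
    using test_functions_approx_indicator[OF N sN PQ(1), of "\<epsilon>/2"] \<open>\<epsilon> > 0\<close> by auto
  obtain \<psi> where \<psi>: "\<psi> \<in> test_functions" "\<And>x. 0 \<le> \<psi> x" "\<And>x. \<psi> x \<le> 1"
    "(\<integral>x. \<bar>\<psi> x - indicator Q x\<bar> \<partial>N) < \<epsilon>/2"
    using test_functions_approx_indicator[OF N sN PQ(2), of "\<epsilon>/2"] \<open>\<epsilon> > 0\<close> by auto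
  note [measurable] = test_function_measurable[OF \<phi>(1)] test_function_measurable[OF \<psi>(1)]
  have b: "\<bar>\<phi> x - \<psi> x\<bar> \<le> 1" for x using \<phi>(2,3)[of x] \<psi>(2,3)[of x] by linarith
  have b2: "\<bar>\<phi> x - indicator P x\<bar> \<le> 1" "\<bar>\<psi> x - indicator Q x\<bar> \<le> 1" for x
    using \<phi>(2,3)[of x] \<psi>(2,3)[of x] by (auto simp: indicator_def)
  have I: "integrable M (\<lambda>x. \<bar>g x\<bar> * h x)" "integrable M (\<lambda>x. g x * h x)"
    if [measurable]: "h \<in> borel_measurable borel" and h: "\<And>x. \<bar>h x\<bar> \<le> 1" for h
    by (rule Bochner_Integration.integrable_bound[OF g]; use h in \<open>auto simp: abs_mult mult_left_le\<close>)+
  have NM: "(\<integral>x. h x \<partial>N) = (\<integral>x. \<bar>g x\<bar> * h x \<partial>M)" if "h \<in> borel_measurable borel" for h :: "'a \<Rightarrow> real"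
    unfolding N_def using that by (subst integral_density) auto
  have "(\<integral>x. \<bar>g x\<bar> \<partial>M) - (\<integral>x. g x * (\<phi> x - \<psi> x) \<partial>M) = (\<integral>x. \<bar>g x\<bar> - g x * (\<phi> x - \<psi> x) \<partial>M)"
    using g b by (subst Bochner_Integration.integral_diff) (auto intro!: I)
  \<comment> \<open>Pointwise, |g| equals g times (indicator of \<open>P\<close> minus indicator of
    \<open>Q\<close>), so the defect is controlled by the two approximation errors.\<close>
  also have "\<dots> \<le> (\<integral>x. \<bar>g x\<bar> * \<bar>\<phi> x - indicator P x\<bar> + \<bar>g x\<bar> * \<bar>\<psi> x - indicator Q x\<bar> \<partial>M)"
  proof (rule integral_mono)
    show "\<bar>g x\<bar> - g x * (\<phi> x - \<psi> x) \<le> \<bar>g x\<bar> * \<bar>\<phi> x - indicator P x\<bar> + \<bar>g x\<bar> * \<bar>\<psi> x - indicator Q x\<bar>" for x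
      using \<phi>(2,3)[of x] \<psi>(2,3)[of x]
      by (cases "g x" "0::real" rule: linorder_cases) (auto simp: P_def Q_def indicator_def algebra_simps)
  qed (use g b b2 in \<open>auto intro!: I\<close>)
  also have "\<dots> = (\<integral>x. \<bar>\<phi> x - indicator P x\<bar> \<partial>N) + (\<integral>x. \<bar>\<psi> x - indicator Q x\<bar> \<partial>N)"
    using b2 by (subst Bochner_Integration.integral_add) (auto intro!: I simp: NM)
  also have "\<dots> < \<epsilon>" using \<phi> \<psi> by simp
  finally show ?thesis
    using that[OF test_functions_diff[OF \<phi>(1) \<psi>(1)] b] by simp
qed

section \<open>Vector measures with densities\<close>

lemma vector_measure_additive:
  assumes "vector_measure m" "A \<in> sets borel" "B \<in> sets borel" "A \<inter> B = {}"
  shows "m (A \<union> B) = m A + m B"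
proof -
  define D where "D i = (if i = 0 then A else if i = Suc 0 then B else {})" for i :: nat
  have D: "range D \<subseteq> sets borel" "disjoint_family D"
    using assms by (auto simp: D_def disjoint_family_on_def)
  have "(\<lambda>i. m (D i)) sums m (\<Union>i. D i)"
    using assms(1) D unfolding vector_measure_def by auto
  moreover have "(\<lambda>i. m (D i)) sums (\<Sum>i<2. m (D i))"
    by (rule sums_finite) (auto simp: D_def vector_measure_empty[OF assms(1)])
  ultimately have "m (\<Union>i. D i) = (\<Sum>i<2. m (D i))" by (rule sums_unique2)
  also have "(\<Union>i. D i) = A \<union> B"
    by (auto simp: D_def split: if_splits)
  finally show ?thesis by (simp add: D_def numeral_2_eq_2)
qed

lemma vector_measure_inner: "vector_measure m \<Longrightarrow> vector_measure (\<lambda>A. m A \<bullet> v)"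
  unfolding vector_measure_def using bounded_linear.sums[OF bounded_linear_inner_left] by blast

lemma vector_measure_uminus: "vector_measure m \<Longrightarrow> vector_measure (\<lambda>A. - m A)"
  unfolding vector_measure_def using sums_minus by blast

text \<open>The partition into \<open>B\<close> and its complement, padded with empty sets, is
  admissible in the supremum. The resulting uniform bound on \<open>m\<close> keeps all Jordan parts
  finite.\<close>

lemma norm_le_variation:
  assumes "B \<in> sets borel"
  shows "ennreal (norm (m B)) \<le> variation m UNIV"
proof -
  define D where "D i = (if i = 0 then B else if i = Suc 0 then -B else {})" for i :: nat
  have D: "range D \<subseteq> sets borel" "disjoint_family D" "(\<Union>i. D i) = UNIV"
    using assms by (auto simp: D_def disjoint_family_on_def split: if_splits)
  have "ennreal (norm (m B)) = (\<Sum>i<1. ennreal (norm (m (D i))))" by (simp add: D_def)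
  also have "\<dots> \<le> (\<Sum>i. ennreal (norm (m (D i))))" by (rule sum_le_suminf) auto
  also have "\<dots> \<le> variation m UNIV"
    unfolding variation_def using D by (intro SUP_upper) auto
  finally show ?thesis .
qed

text \<open>For \<open>B \<subseteq> A\<close> additivity gives m B = m A - m (A - B), and - m (A -
  B) is at most the lower variation of \<open>A\<close>; the supremum over \<open>B\<close> is the
  second claim. It is one half of the Jordan decomposition.\<close>

lemma upper_variation_le:
  assumes m: "vector_measure m" and bound: "\<And>B. B \<in> sets borel \<Longrightarrow> \<bar>m B\<bar> \<le> C"
    and A: "A \<in> sets borel"
  shows "emeasure (upper_variation m) A \<le> ennreal C"
    and "measure (upper_variation m) A \<le> m A + measure (upper_variation (\<lambda>A. - m A)) A"
proof -
  have up: "emeasure (upper_variation m) A \<le> ennreal C"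
    if m: "vector_measure m" and bound: "\<And>B. B \<in> sets borel \<Longrightarrow> \<bar>m B\<bar> \<le> C" for m :: "'a set \<Rightarrow> real"
    using bound by (auto simp: emeasure_upper_variation[OF m A] intro!: SUP_least ennreal_leI dest: abs_le_D1)
  show 1: "emeasure (upper_variation m) A \<le> ennreal C" by (rule up) fact+
  have 2: "emeasure (upper_variation (\<lambda>A. - m A)) A \<le> ennreal C"
    by (rule up[OF vector_measure_uminus[OF m]]) (use bound in auto)
  define n where "n = measure (upper_variation (\<lambda>A. - m A)) A"
  have n: "emeasure (upper_variation (\<lambda>A. - m A)) A = ennreal n"
    unfolding n_def using 2 by (intro emeasure_eq_ennreal_measure) (auto simp: top_unique)
  have n': "- m B \<le> n" if "B \<in> sets borel" "B \<subseteq> A" for B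
  proof -
    have "ennreal (- m B) \<le> ennreal n"
      unfolding n[symmetric] emeasure_upper_variation[OF vector_measure_uminus[OF m] A]
      using that by (intro SUP_upper) auto
    moreover have "0 \<le> n" by (simp add: n_def)
    ultimately show ?thesis by (simp add: ennreal_le_iff)
  qed
  have "emeasure (upper_variation m) A \<le> ennreal (m A + n)"
    unfolding emeasure_upper_variation[OF m A]
  proof (intro SUP_least ennreal_leI)
    fix B assume B: "B \<in> {B \<in> sets borel. B \<subseteq> A}"
    have "m (B \<union> (A - B)) = m B + m (A - B)"
      using B A by (intro vector_measure_additive[OF m]) auto
    also have "B \<union> (A - B) = A" using B by auto
    finally show "m B \<le> m A + n" using n'[of "A - B"] B A by auto
  qed
  \<comment> \<open>Leaving \<open>ennreal\<close> requires a nonnegative right-hand side;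
    \<open>n'\<close> with \<open>B = A\<close> gives - m A \<le> n.\<close>
  then have "measure (upper_variation m) A \<le> m A + n"
    unfolding measure_def using n'[of A] A by (intro enn2real_leI) auto
  then show "measure (upper_variation m) A \<le> m A + measure (upper_variation (\<lambda>A. - m A)) A"
    by (simp add: n_def)
qed

text \<open>The one-sided inequality for \<open>m\<close> and the one for \<open>- m\<close> are the
  two halves of the equality, so no Hahn set has to be constructed.\<close>

lemma jordan_decomposition:
  assumes m: "vector_measure m" and bound: "\<And>B. B \<in> sets borel \<Longrightarrow> \<bar>m B\<bar> \<le> C"
    and A: "A \<in> sets borel"
  shows "m A = measure (upper_variation m) A - measure (lower_variation m) A"
  using upper_variation_le(2)[OF m bound A] upper_variation_le(2)[OF vector_measure_uminus[OF m] _ A] bound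
  by (fastforce simp: lower_variation_def)

text \<open>Finiteness of \<open>N\<close> makes the derivative real-valued almost everywhere and
  integrable, so that densities of Jordan parts can later be subtracted.\<close>

lemma Radon_Nikodym_real:
  assumes M: "finite_measure M" and N: "finite_measure N" and ac: "absolutely_continuous M N"
    and s: "sets N = sets M"
  obtains g :: "'a \<Rightarrow> real" where "integrable M g" "\<And>A. A \<in> sets M \<Longrightarrow> measure N A = (\<integral>x. indicator A x * g x \<partial>M)"
proof -
  interpret M: finite_measure M by fact
  interpret N: finite_measure N by fact
  obtain D where D: "D \<in> borel_measurable M" "AE x in M. RN_deriv M N x = ennreal (D x)" "\<And>x. 0 \<le> D x"
    using M.real_RN_deriv[OF N ac s] by metis
  have "density M (\<lambda>x. ennreal (D x)) = density M (RN_deriv M N)"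
    using D by (intro density_cong) auto
  also have "\<dots> = N" by (rule M.density_RN_deriv[OF ac s])
  finally have dN: "density M (\<lambda>x. ennreal (D x)) = N" .
  have em: "emeasure N A = (\<integral>\<^sup>+x. ennreal (indicator A x * D x) \<partial>M)" if "A \<in> sets M" for A
    unfolding dN[symmetric] using D that
    by (subst emeasure_density) (auto intro!: nn_integral_cong simp: indicator_def)
  have "integrable M D"
    using D em[of "space M"] N.emeasure_finite[of "space M"]
    by (intro integrableI_nonneg) (auto simp: less_top cong: nn_integral_cong)
  moreover have "measure N A = (\<integral>x. indicator A x * D x \<partial>M)" if "A \<in> sets M" for A
    unfolding measure_def em[OF that] using D that
    by (subst integral_eq_nn_integral) auto
  ultimately show ?thesis using that by blast
qed

text \<open>Radon--Nikodym with respect to the sum of the total variations of the coordinates.\<close>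

lemma vector_measure_density:
  fixes m :: "'a::euclidean_space set \<Rightarrow> 'b::euclidean_space"
  assumes m: "vector_measure m" and v: "variation m UNIV < \<infinity>"
  obtains M :: "'a measure" and G where "finite_measure M" "sets M = sets borel" "integrable M G"
    "\<And>A. A \<in> sets borel \<Longrightarrow> m A = (\<integral>x. indicator A x *\<^sub>R G x \<partial>M)"
proof -
  define C where "C = enn2real (variation m UNIV)"
  have C: "norm (m B) \<le> C" if "B \<in> sets borel" for B
    using enn2real_mono[OF norm_le_variation[OF that, of m]] v unfolding C_def by simp
  have Cb: "\<bar>m B \<bullet> b\<bar> \<le> C" if "B \<in> sets borel" "b \<in> Basis" for B b
    using C[OF that(1)] Basis_le_norm[OF that(2), of "m B"] by linarith
  define P where "P b = upper_variation (\<lambda>A. m A \<bullet> b)" for b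
  define N where "N b = lower_variation (\<lambda>A. m A \<bullet> b)" for b
  note mb = vector_measure_inner[OF m]
  have sP: "sets (P b) = sets borel" "sets (N b) = sets borel" for b
    by (simp_all add: P_def N_def lower_variation_def sets_upper_variation)
  have spP: "space (P b) = UNIV" "space (N b) = UNIV" for b
    using sP[of b, THEN sets_eq_imp_space_eq] by auto
  have fP: "finite_measure (P b)" if "b \<in> Basis" for b
    using upper_variation_le(1)[OF mb Cb[OF _ that], of UNIV] spP[of b]
    by (intro finite_measureI) (auto simp: P_def top_unique)
  have fN: "finite_measure (N b)" if "b \<in> Basis" for b
    using upper_variation_le(1)[OF vector_measure_uminus[OF mb], of b C UNIV] Cb[OF _ that] spP[of b]
    by (intro finite_measureI) (auto simp: N_def lower_variation_def top_unique)
  \<comment> \<open>Each Jordan part is a summand and therefore absolutely continuous with respect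
    to the sum. One reference measure for all coordinates allows their densities to be assembled
    into a single vector-valued \<open>G\<close>.\<close>
  define \<mu> where "\<mu> A = (\<Sum>b\<in>Basis. emeasure (P b) A + emeasure (N b) A)" for A
  define M where "M = measure_of UNIV (sets borel) \<mu>"
  have sM: "sets M = sets borel"
    by (simp add: M_def sets_measure_of_conv sets.sigma_sets_eq[of borel, simplified])
  have spM: "space M = UNIV" using sM[THEN sets_eq_imp_space_eq] by simp
  have eM: "emeasure M A = \<mu> A" if "A \<in> sets borel" for A
  proof (rule emeasure_measure_of[OF M_def])
    show "A \<in> sets M" using that sM by simp
    show "positive (sets M) \<mu>" by (simp add: positive_def \<mu>_def)
    show "countably_additive (sets M) \<mu>"
      unfolding countably_additive_def sM
    proof safe
      fix E :: "nat \<Rightarrow> 'a set" assume E: "range E \<subseteq> sets borel" "disjoint_family E"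
      have "(\<Sum>i. \<mu> (E i)) = (\<Sum>b\<in>Basis. (\<Sum>i. emeasure (P b) (E i)) + (\<Sum>i. emeasure (N b) (E i)))"
        unfolding \<mu>_def by (subst suminf_sum) (auto simp: suminf_add[symmetric])
      also have "\<dots> = \<mu> (\<Union>i. E i)"
        unfolding \<mu>_def using E by (intro sum.cong refl arg_cong2[where f="(+)"] suminf_emeasure) (auto simp: sP)
      finally show "(\<Sum>i. \<mu> (E i)) = \<mu> (\<Union>i. E i)" .
    qed
  qed auto
  have fM: "finite_measure M"
  proof (rule finite_measureI)
    have "emeasure (P b) UNIV \<noteq> \<top>" "emeasure (N b) UNIV \<noteq> \<top>" if "b \<in> Basis" for b
      using finite_measure.emeasure_finite[OF fP[OF that], of UNIV] 
        finite_measure.emeasure_finite[OF fN[OF that], of UNIV] by auto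
    then show "emeasure M (space M) \<noteq> \<infinity>"
      unfolding spM by (subst eM) (auto simp: \<mu>_def)
  qed
  have ac: "absolutely_continuous M (P b)" "absolutely_continuous M (N b)" if "b \<in> Basis" for b
    using that by (auto simp: absolutely_continuous_def null_sets_def sM sP eM \<mu>_def)
  have "\<exists>g :: 'a \<Rightarrow> real. integrable M g \<and> (\<forall>A\<in>sets borel. measure (P b) A = (\<integral>x. indicator A x * g x \<partial>M))"
    if "b \<in> Basis" for b
    using Radon_Nikodym_real[OF fM fP[OF that] ac(1)[OF that]] sM sP by metis
  then obtain p :: "'b \<Rightarrow> 'a \<Rightarrow> real" where p: "\<And>b. b \<in> Basis \<Longrightarrow> integrable M (p b)"
    "\<And>b A. b \<in> Basis \<Longrightarrow> A\<in>sets borel \<Longrightarrow> measure (P b) A = (\<integral>x. indicator A x * p b x \<partial>M)" by metis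
  have "\<exists>g :: 'a \<Rightarrow> real. integrable M g \<and> (\<forall>A\<in>sets borel. measure (N b) A = (\<integral>x. indicator A x * g x \<partial>M))"
    if "b \<in> Basis" for b
    using Radon_Nikodym_real[OF fM fN[OF that] ac(2)[OF that]] sM sP by metis
  then obtain n :: "'b \<Rightarrow> 'a \<Rightarrow> real" where n: "\<And>b. b \<in> Basis \<Longrightarrow> integrable M (n b)"
    "\<And>b A. b \<in> Basis \<Longrightarrow> A\<in>sets borel \<Longrightarrow> measure (N b) A = (\<integral>x. indicator A x * n b x \<partial>M)" by metis
  define G where "G x = (\<Sum>b\<in>Basis. (p b x - n b x) *\<^sub>R b)" for x
  have G: "integrable M G"
    unfolding G_def using p n by (intro Bochner_Integration.integrable_sum integrable_scaleR_left Bochner_Integration.integrable_diff) auto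
  have "m A = (\<integral>x. indicator A x *\<^sub>R G x \<partial>M)" if A: "A \<in> sets borel" for A
  proof (rule euclidean_eqI)
    fix b :: 'b assume b: "b \<in> Basis"
    have AM: "A \<in> sets M" using A sM by simp
    have "m A \<bullet> b = measure (P b) A - measure (N b) A"
      unfolding P_def N_def using Cb b by (intro jordan_decomposition[OF mb _ A]) auto
    also have "\<dots> = (\<integral>x. indicator A x * p b x - indicator A x * n b x \<partial>M)"
      unfolding p(2)[OF b A] n(2)[OF b A]
      using p(1)[OF b] n(1)[OF b] integrable_mult_indicator[OF AM, of "p b"] integrable_mult_indicator[OF AM, of "n b"]
      by (subst Bochner_Integration.integral_diff) auto
    also have "\<dots> = (\<integral>x. (indicator A x *\<^sub>R G x) \<bullet> b \<partial>M)"
      using b by (intro Bochner_Integration.integral_cong refl)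
        (simp add: G_def inner_sum_left inner_Basis if_distrib[where f="\<lambda>x. _ * x"] sum.delta right_diff_distrib cong: if_cong)
    also have "\<dots> = (\<integral>x. indicator A x *\<^sub>R G x \<partial>M) \<bullet> b"
      by (rule integral_inner_left) (use integrable_mult_indicator[OF AM G] in auto)
    finally show "m A \<bullet> b = (\<integral>x. indicator A x *\<^sub>R G x \<partial>M) \<bullet> b" .
  qed
  then show ?thesis using that fM sM G by blast
qed

section \<open>Variation and Jordan parts of a measure with density\<close>

lemma nn_integral_partition:
  assumes [measurable]: "h \<in> borel_measurable M" and E: "\<And>i. E i \<in> sets M" "disjoint_family E" "(\<Union>i. E i) = space M"
  shows "(\<Sum>i::nat. \<integral>\<^sup>+x. h x * indicator (E i) x \<partial>M) = (\<integral>\<^sup>+x. h x \<partial>M)"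
proof -
  have "(\<Sum>i. \<integral>\<^sup>+x. h x * indicator (E i) x \<partial>M) = (\<integral>\<^sup>+x. (\<Sum>i. h x * indicator (E i) x) \<partial>M)"
    using E by (intro nn_integral_suminf[symmetric]) auto
  also have "\<dots> = (\<integral>\<^sup>+x. h x \<partial>M)"
    using E by (intro nn_integral_cong) (simp add: suminf_indicator)
  finally show ?thesis .
qed

text \<open>The upper bound is the triangle inequality on each piece of a partition. For the lower
  bound the space is partitioned by the values of \<open>G\<close>: on a piece where
  \<open>G\<close> stays within \<delta> of a constant vector, the norm of the integral and the
  integral of the norm differ by at most 2\<delta> times the mass of the piece.\<close>

lemma variation_density:
  fixes G :: "'a::euclidean_space \<Rightarrow> 'b::euclidean_space"
  assumes M: "finite_measure M" and sM: "sets M = sets borel" and G: "integrable M G"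
    and m: "\<And>A. A \<in> sets borel \<Longrightarrow> m A = (\<integral>x. indicator A x *\<^sub>R G x \<partial>M)"
  shows "variation m UNIV = (\<integral>\<^sup>+x. ennreal (norm (G x)) \<partial>M)"
proof -
  interpret finite_measure M by fact
  have spM: "space M = UNIV" using sM[THEN sets_eq_imp_space_eq] by simp
  have [measurable]: "G \<in> borel_measurable M" using G by auto
  have int: "integrable M (\<lambda>x. indicator A x *\<^sub>R G x)" if "A \<in> sets borel" for A
    using integrable_mult_indicator[of A M G] G that sM by simp
  show ?thesis
  proof (rule antisym)
    show "variation m UNIV \<le> (\<integral>\<^sup>+x. ennreal (norm (G x)) \<partial>M)"
      unfolding variation_def
    proof (rule SUP_least, safe)
      fix E :: "nat \<Rightarrow> 'a set" assume E: "range E \<subseteq> sets borel" "disjoint_family E" "(\<Union>i. E i) = UNIV"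
      have "ennreal (norm (m (E i))) \<le> (\<integral>\<^sup>+x. ennreal (norm (G x)) * indicator (E i) x \<partial>M)" for i
      proof -
        have "ennreal (norm (m (E i))) \<le> (\<integral>\<^sup>+x. ennreal (norm (indicator (E i) x *\<^sub>R G x)) \<partial>M)"
        proof -
          have Ei: "E i \<in> sets borel" using E by auto
          then show ?thesis unfolding m[OF Ei] by (intro integral_norm_bound_ennreal int)
        qed
        also have "\<dots> = (\<integral>\<^sup>+x. ennreal (norm (G x)) * indicator (E i) x \<partial>M)"
          by (intro nn_integral_cong) (auto simp: indicator_def)
        finally show ?thesis .
      qed
      then have "(\<Sum>i. ennreal (norm (m (E i)))) \<le> (\<Sum>i. \<integral>\<^sup>+x. ennreal (norm (G x)) * indicator (E i) x \<partial>M)"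
        by (intro suminf_le) auto
      also have "\<dots> = (\<integral>\<^sup>+x. ennreal (norm (G x)) \<partial>M)"
        using E by (intro nn_integral_partition) (auto simp: sM spM)
      finally show "(\<Sum>i. ennreal (norm (m (E i)))) \<le> (\<integral>\<^sup>+x. ennreal (norm (G x)) \<partial>M)" .
    qed
    show "(\<integral>\<^sup>+x. ennreal (norm (G x)) \<partial>M) \<le> variation m UNIV"
    proof (rule ennreal_le_epsilon)
      fix e :: real assume "e > 0"
      \<comment> \<open>The factor 2 pays for two replacements on each piece: norm G by norm q, and
        m by the measure times q. Adding 1 avoids a division by zero when \<open>M\<close> is
        null.\<close>
      define \<delta> where "\<delta> = e / (2 * (measure M UNIV + 1))"
      have "measure M UNIV + 1 > 0" using measure_nonneg[of M UNIV] by linarith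
      then have \<delta>: "\<delta> > 0" "2 * \<delta> * measure M UNIV \<le> e"
        using \<open>e > 0\<close> by (auto simp: \<delta>_def field_simps)
      obtain Q :: "'b set" where Q: "countable Q" "\<And>X. open X \<Longrightarrow> X \<noteq> {} \<Longrightarrow> \<exists>q\<in>Q. q \<in> X"
        using countable_dense_setE by metis
      have Qne: "Q \<noteq> {}" using Q(2)[of UNIV] by auto
      define q where "q = from_nat_into Q"
      have cov: "\<exists>i. y \<in> ball (q i) \<delta>" for y
      proof -
        obtain z where "z \<in> Q" "z \<in> ball y \<delta>" using Q(2)[of "ball y \<delta>"] \<delta> by auto
        then show ?thesis using from_nat_into_surj[OF Q(1)] unfolding q_def
          by (metis dist_commute mem_ball)
      qed
      define D where "D = disjointed (\<lambda>i. ball (q i) \<delta>)"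
      define E where "E i = G -` D i" for i
      have "range D \<subseteq> sets borel"
        unfolding D_def by (rule sets.range_disjointed_sets) auto
      then have D: "D i \<in> sets borel" "D i \<subseteq> ball (q i) \<delta>" for i
        using disjointed_subset[of "\<lambda>i. ball (q i) \<delta>" i] by (auto simp: D_def)
      have Es: "E i \<in> sets borel" for i
        using measurable_sets[of G M borel, OF _ D(1)] by (simp add: E_def spM sM)
      have Ed: "disjoint_family E"
        using disjoint_family_disjointed[of "\<lambda>i. ball (q i) \<delta>"] unfolding E_def D_def disjoint_family_on_def by blast
      have "(\<Union>i. D i) = UNIV"
        unfolding D_def UN_disjointed_eq using cov by auto
      then have Eu: "(\<Union>i. E i) = UNIV" unfolding E_def vimage_UN[symmetric] by simp
      have key: "(\<integral>\<^sup>+x. ennreal (norm (G x)) * indicator (E i) x \<partial>M) \<le>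
          ennreal (norm (m (E i))) + ennreal (2 * \<delta>) * emeasure M (E i)" for i
      proof -
        have near: "norm (G x - q i) \<le> \<delta>" if "x \<in> E i" for x
          using that D(2)[of i] by (auto simp: E_def dist_norm norm_minus_commute)
        have EM: "E i \<in> sets M" using Es sM by simp
        have intE: "integrable M (\<lambda>x. indicator (E i) x *\<^sub>R c)" for c :: "'c::{banach,second_countable_topology}"
          using integrable_mult_indicator[OF EM, of "\<lambda>_. c"] by simp
        have "norm (G x) \<le> norm (q i) + \<delta>" if "x \<in> E i" for x
          using norm_triangle_sub[of "G x" "q i"] near[OF that] by linarith
        then have "(\<integral>x. norm (indicator (E i) x *\<^sub>R G x) \<partial>M) \<le> (\<integral>x. indicator (E i) x *\<^sub>R (norm (q i) + \<delta>) \<partial>M)"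
          by (intro integral_mono integrable_norm int Es intE) (auto simp: indicator_def)
        also have "\<dots> = measure M (E i) * (norm (q i) + \<delta>)"
          using EM by simp
        finally have 1: "(\<integral>x. norm (indicator (E i) x *\<^sub>R G x) \<partial>M) \<le> measure M (E i) * (norm (q i) + \<delta>)" .
        have ind: "(\<integral>x. indicator (E i) x *\<^sub>R q i \<partial>M) = measure M (E i) *\<^sub>R q i"
          using intE[of "1::real"] EM by (subst integral_scaleR_left) (auto simp: spM)
        have "norm (measure M (E i) *\<^sub>R q i - m (E i)) = norm (\<integral>x. indicator (E i) x *\<^sub>R q i - indicator (E i) x *\<^sub>R G x \<partial>M)"
          using EM by (subst Bochner_Integration.integral_diff) (auto intro!: int Es intE simp: m[OF Es] ind)
        also have "\<dots> \<le> (\<integral>x. norm (indicator (E i) x *\<^sub>R q i - indicator (E i) x *\<^sub>R G x) \<partial>M)"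
          by (rule integral_norm_bound)
        also have "\<dots> \<le> (\<integral>x. indicator (E i) x *\<^sub>R \<delta> \<partial>M)"
          using near
          by (intro integral_mono integrable_norm Bochner_Integration.integrable_diff int Es intE)
             (auto simp: indicator_def norm_minus_commute)
        also have "\<dots> = measure M (E i) * \<delta>" using EM by simp
        finally have 2: "norm (measure M (E i) *\<^sub>R q i - m (E i)) \<le> measure M (E i) * \<delta>" .
        have "measure M (E i) * norm (q i) \<le> norm (m (E i)) + measure M (E i) * \<delta>"
          using norm_triangle_sub[of "measure M (E i) *\<^sub>R q i" "m (E i)"] 2 by simp
        with 1 have 3: "(\<integral>x. norm (indicator (E i) x *\<^sub>R G x) \<partial>M) \<le> norm (m (E i)) + 2 * \<delta> * measure M (E i)"
          by (simp add: algebra_simps)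
        have "(\<integral>\<^sup>+x. ennreal (norm (G x)) * indicator (E i) x \<partial>M) = (\<integral>\<^sup>+x. ennreal (norm (indicator (E i) x *\<^sub>R G x)) \<partial>M)"
          by (intro nn_integral_cong) (auto simp: indicator_def)
        also have "\<dots> = ennreal (\<integral>x. norm (indicator (E i) x *\<^sub>R G x) \<partial>M)"
          by (intro nn_integral_eq_integral integrable_norm int Es) auto
        also have "\<dots> \<le> ennreal (norm (m (E i)) + 2 * \<delta> * measure M (E i))"
          using 3 by (rule ennreal_leI)
        also have "\<dots> = ennreal (norm (m (E i))) + ennreal (2 * \<delta>) * emeasure M (E i)"
          using \<delta> by (simp add: emeasure_eq_measure ennreal_mult)
        finally show ?thesis .
      qed
      have "(\<integral>\<^sup>+x. ennreal (norm (G x)) \<partial>M) = (\<Sum>i. \<integral>\<^sup>+x. ennreal (norm (G x)) * indicator (E i) x \<partial>M)"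
        using Es Ed Eu by (intro nn_integral_partition[symmetric]) (auto simp: sM spM)
      also have "\<dots> \<le> (\<Sum>i. ennreal (norm (m (E i))) + ennreal (2 * \<delta>) * emeasure M (E i))"
        using key by (intro suminf_le) auto
      also have "\<dots> = (\<Sum>i. ennreal (norm (m (E i)))) + ennreal (2 * \<delta>) * (\<Sum>i. emeasure M (E i))"
        by (simp add: suminf_add[symmetric])
      also have "(\<Sum>i. emeasure M (E i)) = emeasure M UNIV"
        unfolding Eu[symmetric] using Es Ed by (intro suminf_emeasure) (auto simp: sM)
      also have "(\<Sum>i. ennreal (norm (m (E i)))) + ennreal (2 * \<delta>) * emeasure M UNIV \<le> variation m UNIV + ennreal e"
      proof (rule add_mono)
        show "(\<Sum>i. ennreal (norm (m (E i)))) \<le> variation m UNIV"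
          unfolding variation_def using Es Ed Eu by (intro SUP_upper) auto
        show "ennreal (2 * \<delta>) * emeasure M UNIV \<le> ennreal e"
          using \<delta> by (simp add: emeasure_eq_measure ennreal_mult[symmetric] ennreal_leI)
      qed
      finally show "(\<integral>\<^sup>+x. ennreal (norm (G x)) \<partial>M) \<le> variation m UNIV + ennreal e" .
    qed
  qed
qed

text \<open>The supremum over subsets of \<open>A\<close> is attained at A \<inter> {g > 0};
  truncation by \<open>ennreal\<close> turns \<open>g\<close> into its positive part.\<close>

lemma upper_variation_density:
  assumes m: "vector_measure m" and sM: "sets M = sets borel" and g: "integrable M g"
    and rep: "\<And>A. A \<in> sets borel \<Longrightarrow> m A = (\<integral>x. indicator A x * g x \<partial>M)"
  shows "upper_variation m = density M (\<lambda>x. ennreal (g x))"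
proof (rule measure_eqI)
  show "sets (upper_variation m) = sets (density M (\<lambda>x. ennreal (g x)))"
    by (simp add: sets_upper_variation sM)
  fix A assume "A \<in> sets (upper_variation m)"
  then have A: "A \<in> sets borel" "A \<in> sets M" by (auto simp: sets_upper_variation sM)
  have gm[measurable]: "g \<in> borel_measurable M" using g by auto
  have int: "integrable M (\<lambda>x. indicator A x * g x)" if "A \<in> sets borel" for A
    using integrable_mult_indicator[of A M g] g that sM by simp
  have "(SUP B\<in>{B\<in>sets borel. B \<subseteq> A}. ennreal (m B)) = (\<integral>\<^sup>+x. ennreal (g x) * indicator A x \<partial>M)"
  proof (rule antisym)
    show "(SUP B\<in>{B\<in>sets borel. B \<subseteq> A}. ennreal (m B)) \<le> (\<integral>\<^sup>+x. ennreal (g x) * indicator A x \<partial>M)"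
    proof (rule SUP_least, safe)
      fix B assume B: "B \<in> sets borel" "B \<subseteq> A"
      have i: "integrable M (\<lambda>x. max 0 (indicator B x * g x))" using int[OF B(1)] by auto
      have "m B \<le> (\<integral>x. max 0 (indicator B x * g x) \<partial>M)"
        unfolding rep[OF B(1)] by (intro integral_mono int B i) auto
      then have "ennreal (m B) \<le> (\<integral>\<^sup>+x. ennreal (max 0 (indicator B x * g x)) \<partial>M)"
        by (subst nn_integral_eq_integral[OF i]) (auto intro: ennreal_leI)
      also have "\<dots> \<le> (\<integral>\<^sup>+x. ennreal (g x) * indicator A x \<partial>M)"
        using B by (intro nn_integral_mono) (auto simp: indicator_def max_def ennreal_neg)
      finally show "ennreal (m B) \<le> (\<integral>\<^sup>+x. ennreal (g x) * indicator A x \<partial>M)" .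
    qed
    define B where "B = A \<inter> {x \<in> space M. 0 < g x}"
    have "B \<in> sets M" using A by (simp add: B_def)
    then have B: "B \<in> sets borel" "B \<subseteq> A" by (auto simp: sM B_def)
    have "(\<integral>\<^sup>+x. ennreal (g x) * indicator A x \<partial>M) = (\<integral>\<^sup>+x. ennreal (indicator B x * g x) \<partial>M)"
      by (intro nn_integral_cong) (auto simp: indicator_def B_def ennreal_neg)
    also have "\<dots> = ennreal (m B)"
      unfolding rep[OF B(1)] by (intro nn_integral_eq_integral int B) (auto simp: indicator_def B_def)
    also have "\<dots> \<le> (SUP B\<in>{B\<in>sets borel. B \<subseteq> A}. ennreal (m B))"
      using B by (intro SUP_upper) auto
    finally show "(\<integral>\<^sup>+x. ennreal (g x) * indicator A x \<partial>M) \<le> (SUP B\<in>{B\<in>sets borel. B \<subseteq> A}. ennreal (m B))" .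
  qed
  then show "emeasure (upper_variation m) A = emeasure (density M (\<lambda>x. ennreal (g x))) A"
    using A by (simp add: emeasure_upper_variation[OF m] emeasure_density)
qed

text \<open>Both Jordan parts have densities with respect to the same \<open>M\<close>, namely the
  positive and negative parts of \<open>g\<close>, and their difference is \<open>g\<close>.
  Boundedness of \<phi> makes both integrals finite, so they may be subtracted under one integral
  sign.\<close>

lemma signed_integral_density:
  assumes m: "vector_measure m" and sM: "sets M = sets borel" and g: "integrable M g"
    and rep: "\<And>A. A \<in> sets borel \<Longrightarrow> m A = (\<integral>x. indicator A x * g x \<partial>M)"
    and \<phi>: "\<phi> \<in> borel_measurable borel" and b: "\<And>x. \<bar>\<phi> x\<bar> \<le> K"
  shows "signed_integral m \<phi> = (\<integral>x. \<phi> x * g x \<partial>M)"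
proof -
  have gm[measurable]: "g \<in> borel_measurable M" using g by auto
  have \<phi>m[measurable]: "\<phi> \<in> borel_measurable M" using \<phi> by (simp add: measurable_cong_sets[OF sM refl])
  have 1: "upper_variation m = density M (\<lambda>x. ennreal (max 0 (g x)))"
    using upper_variation_density[OF m sM g rep] by simp
  have "upper_variation (\<lambda>A. - m A) = density M (\<lambda>x. ennreal (- g x))"
    using g by (intro upper_variation_density[OF vector_measure_uminus[OF m] sM]) (auto simp: rep)
  then have 2: "lower_variation m = density M (\<lambda>x. ennreal (max 0 (- g x)))"
    by (simp add: lower_variation_def)
  have I: "integrable M (\<lambda>x. h x * \<phi> x)" if "h \<in> borel_measurable M" "\<And>x. \<bar>h x\<bar> \<le> \<bar>g x\<bar>" for h
  proof (rule Bochner_Integration.integrable_bound)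
    show "integrable M (\<lambda>x. K * g x)" using g by simp
    show "AE x in M. norm (h x * \<phi> x) \<le> norm (K * g x)"
    proof (rule AE_I2)
      fix x
      have "\<bar>h x\<bar> * \<bar>\<phi> x\<bar> \<le> \<bar>g x\<bar> * \<bar>K\<bar>"
        using that(2)[of x] b[of x] by (intro mult_mono) auto
      then show "norm (h x * \<phi> x) \<le> norm (K * g x)" by (simp add: abs_mult mult.commute)
    qed
  qed (use that in measurable)
  have "signed_integral m \<phi> = (\<integral>x. max 0 (g x) * \<phi> x \<partial>M) - (\<integral>x. max 0 (- g x) * \<phi> x \<partial>M)"
    unfolding signed_integral_def 1 2 by (subst (1 2) integral_density) auto
  also have "\<dots> = (\<integral>x. max 0 (g x) * \<phi> x - max 0 (- g x) * \<phi> x \<partial>M)"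
    by (intro Bochner_Integration.integral_diff[symmetric] I) auto
  also have "\<dots> = (\<integral>x. \<phi> x * g x \<partial>M)"
    by (intro Bochner_Integration.integral_cong) (auto simp: max_def)
  finally show ?thesis .
qed

section \<open>Translates of functions of bounded variation\<close>

lemma lborel_translate:
  fixes h :: "'a::euclidean_space \<Rightarrow> 'b::{banach, second_countable_topology}"
  assumes "h \<in> borel_measurable borel"
  shows "(\<integral>x. h (x + c) \<partial>lborel) = (\<integral>x. h x \<partial>lborel)"
    and "integrable lborel (\<lambda>x. h (x + c)) \<longleftrightarrow> integrable lborel h"
proof -
  have d: "distr lborel borel (\<lambda>x. x + c) = (lborel :: 'a measure)"
    using lborel_distr_plus[of c] by (subst add.commute)
  show "(\<integral>x. h (x + c) \<partial>lborel) = (\<integral>x. h x \<partial>lborel)"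
    using assms by (subst (2) d[symmetric], subst integral_distr) auto
  show "integrable lborel (\<lambda>x. h (x + c)) \<longleftrightarrow> integrable lborel h"
    using assms by (subst (2) d[symmetric], subst integrable_distr_eq) auto
qed

section \<open>Bounds for test functions and their derivatives\<close>

lemma test_function_C_k: "\<phi> \<in> test_functions \<Longrightarrow> C_k k \<phi>"
  by (simp add: test_functions_def)

lemma test_function_has_derivative:
  "\<phi> \<in> test_functions \<Longrightarrow> (\<phi> has_derivative frechet_derivative \<phi> (at x)) (at x)"
  using C_k_differentiable test_function_C_k by blast

lemma bounded_if_compact_support:
  fixes g :: "'a::topological_space \<Rightarrow> real"
  assumes "continuous_on UNIV g" "compact K" "\<And>x. x \<notin> K \<Longrightarrow> g x = 0"
  obtains L where "L \<ge> 0" "\<And>x. \<bar>g x\<bar> \<le> L"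
proof -
  have "bounded (g ` K)"
    using assms by (intro compact_imp_bounded compact_continuous_image) (auto intro: continuous_on_subset)
  then obtain L where L: "\<And>x. x \<in> K \<Longrightarrow> \<bar>g x\<bar> \<le> L" by (auto simp: bounded_iff)
  have "\<bar>g x\<bar> \<le> max 0 L" for x using L[of x] assms(3)[of x] by (cases "x \<in> K") auto
  then show ?thesis using that[of "max 0 L"] by auto
qed

lemma test_function_bounded:
  assumes "\<phi> \<in> test_functions"
  obtains L where "L \<ge> 0" "\<And>x. \<bar>\<phi> x\<bar> \<le> L"
proof (rule bounded_if_compact_support[of \<phi> "closure {x. \<phi> x \<noteq> 0}"])
  show "continuous_on UNIV \<phi>" using test_function_C_k[OF assms, of 0] by simp
  show "compact (closure {x. \<phi> x \<noteq> 0})" using assms by (simp add: test_functions_def)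
  show "\<phi> x = 0" if "x \<notin> closure {x. \<phi> x \<noteq> 0}" for x
    using that closure_subset[of "{x. \<phi> x \<noteq> 0}"] by auto
qed (use that in auto)

text \<open>The distributional gradient is tested only in basis directions; this expansion carries
  integration by parts over to an arbitrary direction.\<close>

lemma frechet_derivative_sum_Basis:
  fixes \<phi> :: "'a::euclidean_space \<Rightarrow> real"
  assumes "(\<phi> has_derivative D) (at x)"
  shows "D v = (\<Sum>b\<in>Basis. (v \<bullet> b) * D b)"
proof -
  have l: "linear D" using assms by (rule has_derivative_linear)
  have "D v = D (\<Sum>b\<in>Basis. (v \<bullet> b) *\<^sub>R b)" by (simp add: euclidean_representation)
  also have "\<dots> = (\<Sum>b\<in>Basis. (v \<bullet> b) * D b)"
    by (simp add: linear_sum[OF l] linear_cmul[OF l])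
  finally show ?thesis .
qed

text \<open>Off the closed support \<phi> vanishes on a neighbourhood, hence so does its derivative.
  The partial derivatives are thus continuous with compact support, hence bounded, and linearity
  combines them.\<close>

lemma test_function_derivative_bounded:
  fixes \<phi> :: "'a::euclidean_space \<Rightarrow> real"
  assumes \<phi>: "\<phi> \<in> test_functions"
  obtains L where "L \<ge> 0" "\<And>x v. \<bar>frechet_derivative \<phi> (at x) v\<bar> \<le> L * norm v"
proof -
  let ?K = "closure {x. \<phi> x \<noteq> 0}"
  have out: "frechet_derivative \<phi> (at x) v = 0" if x: "x \<notin> ?K" for x v
  proof (rule frechet_derivative_applyI)
    show "(\<phi> has_derivative (\<lambda>v. 0)) (at x)"
    proof (rule has_derivative_transform_within_open[where s = "- ?K"])
      show "((\<lambda>x. 0) has_derivative (\<lambda>v. 0)) (at x)" by simp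
      show "0 = \<phi> y" if "y \<in> - ?K" for y
        using that closure_subset[of "{x. \<phi> x \<noteq> 0}"] by auto
    qed (use x in auto)
  qed
  have "\<exists>L\<ge>0. \<forall>x. \<bar>frechet_derivative \<phi> (at x) b\<bar> \<le> L" if "b \<in> Basis" for b
  proof -
    have "continuous_on UNIV (\<lambda>x. frechet_derivative \<phi> (at x) b)"
      using test_function_C_k[OF \<phi>, of 1] that by simp
    moreover have "compact ?K" using \<phi> by (simp add: test_functions_def)
    ultimately obtain L where "L \<ge> 0" "\<And>x. \<bar>frechet_derivative \<phi> (at x) b\<bar> \<le> L"
      using bounded_if_compact_support[of "\<lambda>x. frechet_derivative \<phi> (at x) b" ?K] out by blast
    then show ?thesis by blast
  qed
  then obtain L where L: "\<And>b. b \<in> Basis \<Longrightarrow> L b \<ge> 0" "\<And>b x. b \<in> Basis \<Longrightarrow> \<bar>frechet_derivative \<phi> (at x) b\<bar> \<le> L b"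
    by metis
  have "\<bar>frechet_derivative \<phi> (at x) v\<bar> \<le> (\<Sum>b\<in>Basis. L b) * norm v" for x v
  proof -
    have "\<bar>frechet_derivative \<phi> (at x) v\<bar> \<le> (\<Sum>b\<in>Basis. \<bar>(v \<bullet> b) * frechet_derivative \<phi> (at x) b\<bar>)"
      unfolding frechet_derivative_sum_Basis[OF test_function_has_derivative[OF \<phi>], of x v] by (rule sum_abs)
    also have "\<dots> \<le> (\<Sum>b\<in>Basis. norm v * L b)"
      unfolding abs_mult using L Basis_le_norm by (intro sum_mono mult_mono) auto
    also have "\<dots> = (\<Sum>b\<in>Basis. L b) * norm v"
      by (simp only: sum_distrib_right) (simp only: mult.commute)
    finally show ?thesis .
  qed
  moreover have "(\<Sum>b\<in>Basis. L b) \<ge> 0" using L by (intro sum_nonneg)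
  ultimately show ?thesis using that by blast
qed

text \<open>The Lipschitz constant provides the dominating function for the difference quotients in
  \<open>pairing_has_derivative\<close>.\<close>

lemma test_function_lipschitz:
  fixes \<phi> :: "'a::euclidean_space \<Rightarrow> real"
  assumes \<phi>: "\<phi> \<in> test_functions"
  obtains L where "L \<ge> 0" "\<And>x y. \<bar>\<phi> x - \<phi> y\<bar> \<le> L * norm (x - y)"
proof -
  obtain L where L: "L \<ge> 0" "\<And>x v. \<bar>frechet_derivative \<phi> (at x) v\<bar> \<le> L * norm v"
    using test_function_derivative_bounded[OF \<phi>] by blast
  have "norm (\<phi> x - \<phi> y) \<le> L * norm (x - y)" for x y
    by (rule differentiable_bound[where S=UNIV and f'="\<lambda>x. frechet_derivative \<phi> (at x)"])
       (use test_function_has_derivative[OF \<phi>] L in \<open>auto intro!: onorm_le\<close>)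
  then show ?thesis using that L by auto
qed

lemma test_function_translate:
  assumes \<phi>: "\<phi> \<in> test_functions"
  shows "(\<lambda>x. \<phi> (x - a)) \<in> test_functions"
proof -
  have "{x. \<phi> (x - a) \<noteq> 0} = (+) a ` {x. \<phi> x \<noteq> 0}"
    by (auto intro!: image_eqI[of _ _ "_ - a"])
  then have "compact (closure {x. \<phi> (x - a) \<noteq> 0})"
    using \<phi> by (simp add: closure_translation test_functions_def compact_translation)
  then show ?thesis using \<phi> by (auto simp: test_functions_def intro: C_k_translate)
qed

lemma integrable_mult_bounded:
  fixes f h :: "'a \<Rightarrow> real"
  assumes f: "integrable M f" and [measurable]: "h \<in> borel_measurable M" and b: "\<And>x. \<bar>h x\<bar> \<le> K"
  shows "integrable M (\<lambda>x. f x * h x)"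
proof (rule Bochner_Integration.integrable_bound)
  show "integrable M (\<lambda>x. K * f x)" using f by simp
  show "(\<lambda>x. f x * h x) \<in> borel_measurable M" using f by measurable
  show "AE x in M. norm (f x * h x) \<le> norm (K * f x)"
    using b order_trans[OF b abs_ge_self]
    by (intro AE_I2) (auto simp: abs_mult mult.commute[of "\<bar>K\<bar>"] intro!: mult_left_mono)
qed

text \<open>The limit arguments see \<open>grad f\<close> only through this pair. \<open>M\<close>
  and \<open>G\<close> are fixed before the direction \<open>v\<close>, so \<open>v\<close> becomes
  a parameter of the integrand rather than of the measure. Integration by parts extends from basis
  vectors to every \<open>v\<close> because both sides are linear in \<open>v\<close>.\<close>

lemma BV_representation:
  fixes f :: "'a::euclidean_space \<Rightarrow> real"
  assumes f: "f \<in> BV"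
  obtains M :: "'a measure" and G where "finite_measure M" "sets M = sets borel" "integrable M G"
    "variation (grad f) UNIV = (\<integral>\<^sup>+x. ennreal (norm (G x)) \<partial>M)"
    "\<And>v. variation (\<lambda>A. grad f A \<bullet> v) UNIV = (\<integral>\<^sup>+x. ennreal \<bar>G x \<bullet> v\<bar> \<partial>M)"
    "\<And>\<phi> v. \<phi> \<in> test_functions \<Longrightarrow>
      (\<integral>x. f x * frechet_derivative \<phi> (at x) v \<partial>lborel) = - (\<integral>x. \<phi> x * (G x \<bullet> v) \<partial>M)"
proof -
  have fi: "integrable lborel f" and "\<exists>m. is_BV_gradient f m" using f by (auto simp: BV_def)
  then have "is_BV_gradient f (grad f)" unfolding grad_def by (metis someI_ex)
  then have m: "vector_measure (grad f)" "variation (grad f) UNIV < \<infinity>"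
    and dg: "has_distributional_gradient f (grad f)" by (auto simp: is_BV_gradient_def)
  obtain M :: "'a measure" and G where M: "finite_measure M" "sets M = sets borel" and G: "integrable M G"
    and rep: "\<And>A. A \<in> sets borel \<Longrightarrow> grad f A = (\<integral>x. indicator A x *\<^sub>R G x \<partial>M)"
    using vector_measure_density[OF m] by metis
  have repv: "grad f A \<bullet> v = (\<integral>x. indicator A x * (G x \<bullet> v) \<partial>M)" if "A \<in> sets borel" for A v
    using integrable_mult_indicator[of A M G] G that M(2) by (simp add: rep flip: integral_inner_left)
  have Gv: "integrable M (\<lambda>x. G x \<bullet> v)" for v using G by simp
  have vv: "variation (\<lambda>A. grad f A \<bullet> v) UNIV = (\<integral>\<^sup>+x. ennreal \<bar>G x \<bullet> v\<bar> \<partial>M)" for v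
    using variation_density[OF M Gv[of v], of "\<lambda>A. grad f A \<bullet> v"] repv by simp
  have parts: "(\<integral>x. f x * frechet_derivative \<phi> (at x) v \<partial>lborel) = - (\<integral>x. \<phi> x * (G x \<bullet> v) \<partial>M)"
    if \<phi>: "\<phi> \<in> test_functions" for \<phi> v
  proof -
    obtain L where L: "\<And>x. \<bar>\<phi> x\<bar> \<le> L" using test_function_bounded[OF \<phi>] by blast
    obtain K where K: "\<And>x v. \<bar>frechet_derivative \<phi> (at x) v\<bar> \<le> K * norm v"
      using test_function_derivative_bounded[OF \<phi>] by blast
    note \<phi>m = test_function_measurable[OF \<phi>]
    have \<phi>M: "\<phi> \<in> borel_measurable M" using \<phi>m by (simp add: measurable_cong_sets[OF M(2) refl])
    have b: "(\<integral>x. f x * frechet_derivative \<phi> (at x) b \<partial>lborel) = - (\<integral>x. \<phi> x * (G x \<bullet> b) \<partial>M)" if "b \<in> Basis" for b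
      using dg \<phi> that signed_integral_density[OF vector_measure_inner[OF m(1)] M(2) Gv repv \<phi>m L]
      by (simp add: has_distributional_gradient_def)
    have i1: "integrable lborel (\<lambda>x. (v \<bullet> b) * (f x * frechet_derivative \<phi> (at x) b))" if "b \<in> Basis" for b
    proof -
      have "continuous_on UNIV (\<lambda>x. frechet_derivative \<phi> (at x) b)"
        using test_function_C_k[OF \<phi>, of 1] that by simp
      then have "(\<lambda>x. frechet_derivative \<phi> (at x) b) \<in> borel_measurable lborel"
        by (simp add: borel_measurable_continuous_onI)
      then show ?thesis
        using integrable_mult_bounded[OF fi _ K[of _ b]] by simp
    qed
    have i2: "integrable M (\<lambda>x. (v \<bullet> b) * (\<phi> x * (G x \<bullet> b)))" for b
      using integrable_mult_bounded[OF Gv[of b] \<phi>M L] by (simp add: mult.commute)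
    have "(\<integral>x. f x * frechet_derivative \<phi> (at x) v \<partial>lborel) =
        (\<integral>x. (\<Sum>b\<in>Basis. (v \<bullet> b) * (f x * frechet_derivative \<phi> (at x) b)) \<partial>lborel)"
      by (intro Bochner_Integration.integral_cong refl,
          subst frechet_derivative_sum_Basis[OF test_function_has_derivative[OF \<phi>]])
         (simp add: sum_distrib_left mult_ac)
    also have "\<dots> = (\<Sum>b\<in>Basis. (v \<bullet> b) * (\<integral>x. f x * frechet_derivative \<phi> (at x) b \<partial>lborel))"
      using i1 by (subst Bochner_Integration.integral_sum) auto
    also have "\<dots> = - (\<Sum>b\<in>Basis. (v \<bullet> b) * (\<integral>x. \<phi> x * (G x \<bullet> b) \<partial>M))"
      by (simp add: b sum_negf)
    also have "(\<Sum>b\<in>Basis. (v \<bullet> b) * (\<integral>x. \<phi> x * (G x \<bullet> b) \<partial>M)) =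
        (\<integral>x. (\<Sum>b\<in>Basis. (v \<bullet> b) * (\<phi> x * (G x \<bullet> b))) \<partial>M)"
      using i2 by (subst Bochner_Integration.integral_sum) auto
    also have "\<dots> = (\<integral>x. \<phi> x * (G x \<bullet> v) \<partial>M)"
      by (intro Bochner_Integration.integral_cong refl, subst (3) euclidean_inner)
         (simp add: sum_distrib_left mult_ac)
    finally show ?thesis .
  qed
  show ?thesis
    using that[OF M G variation_density[OF M G rep] vv parts] by blast
qed

text \<open>Since f is merely integrable, the translation is placed on the test function. Its
  difference quotients are bounded by L |\<theta>|, so L |\<theta>| |f| dominates. Absorbing the
  shift \<open>s\<close> into \<psi> reduces the claim to a derivative at 0.\<close>

lemma pairing_has_derivative:
  fixes f :: "'a::euclidean_space \<Rightarrow> real"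
  assumes f: "integrable lborel f" and \<phi>: "\<phi> \<in> test_functions"
  shows "((\<lambda>s. \<integral>x. f x * \<phi> (x - s *\<^sub>R \<theta>) \<partial>lborel) has_real_derivative
      - (\<integral>x. f x * frechet_derivative (\<lambda>x. \<phi> (x - s *\<^sub>R \<theta>)) (at x) \<theta> \<partial>lborel)) (at s)"
proof -
  define \<psi> where "\<psi> x = \<phi> (x - s *\<^sub>R \<theta>)" for x
  have \<psi>: "\<psi> \<in> test_functions" unfolding \<psi>_def by (rule test_function_translate[OF \<phi>])
  note [measurable] = test_function_measurable[OF \<psi>] borel_measurable_integrable[OF f]
  obtain L where L: "L \<ge> 0" "\<And>x y. \<bar>\<psi> x - \<psi> y\<bar> \<le> L * norm (x - y)"
    using test_function_lipschitz[OF \<psi>] by blast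
  obtain B where B: "\<And>x. \<bar>\<psi> x\<bar> \<le> B" using test_function_bounded[OF \<psi>] by blast
  have int: "integrable lborel (\<lambda>x. f x * \<psi> (x - a))" for a
    by (intro integrable_mult_bounded[OF f _ B]) measurable
  have "((\<lambda>h. ((\<integral>x. f x * \<psi> (x - h *\<^sub>R \<theta>) \<partial>lborel) - (\<integral>x. f x * \<psi> x \<partial>lborel)) / h) \<longlongrightarrow>
      (\<integral>x. - (f x * frechet_derivative \<psi> (at x) \<theta>) \<partial>lborel)) (at 0)"
    unfolding tendsto_at_iff_sequentially
  proof safe
    fix X :: "nat \<Rightarrow> real" assume X: "\<forall>i. X i \<in> UNIV - {0}" "X \<longlonglongrightarrow> 0"
    then have X0: "X i \<noteq> 0" for i by auto
    have "(\<lambda>i. \<integral>x. f x * ((\<psi> (x - X i *\<^sub>R \<theta>) - \<psi> x) / X i) \<partial>lborel) \<longlonglongrightarrow>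
        (\<integral>x. - (f x * frechet_derivative \<psi> (at x) \<theta>) \<partial>lborel)"
    proof (rule integral_dominated_convergence[where w = "\<lambda>x. L * norm \<theta> * \<bar>f x\<bar>"])
      have lim: "(\<lambda>i. f x * ((\<psi> (x - X i *\<^sub>R \<theta>) - \<psi> x) / X i)) \<longlonglongrightarrow> - (f x * frechet_derivative \<psi> (at x) \<theta>)" for x
      proof -
        have "((\<lambda>h. \<psi> (x - h *\<^sub>R \<theta>)) has_derivative (\<lambda>h. frechet_derivative \<psi> (at (x - 0 *\<^sub>R \<theta>)) (- (h *\<^sub>R \<theta>)))) (at 0)"
          by (rule has_derivative_compose[OF _ test_function_has_derivative[OF \<psi>]])
             (auto intro!: derivative_eq_intros)
        moreover have "frechet_derivative \<psi> (at x) (- (h *\<^sub>R \<theta>)) = - frechet_derivative \<psi> (at x) \<theta> * h" for h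
          using has_derivative_linear[OF test_function_has_derivative[OF \<psi>, of x]]
          by (simp add: linear_neg linear_cmul)
        ultimately have "((\<lambda>h. \<psi> (x - h *\<^sub>R \<theta>)) has_real_derivative - frechet_derivative \<psi> (at x) \<theta>) (at 0)"
          unfolding has_field_derivative_def by (auto elim!: has_derivative_eq_rhs)
        then have "((\<lambda>h. (\<psi> (x - h *\<^sub>R \<theta>) - \<psi> x) / h) \<longlongrightarrow> - frechet_derivative \<psi> (at x) \<theta>) (at 0)"
          by (simp add: DERIV_def)
        then have "(\<lambda>i. (\<psi> (x - X i *\<^sub>R \<theta>) - \<psi> x) / X i) \<longlonglongrightarrow> - frechet_derivative \<psi> (at x) \<theta>"
          using X by (auto simp: tendsto_at_iff_sequentially o_def)
        from tendsto_mult_left[OF this, of "f x"] show ?thesis by simp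
      qed
      then show "AE x in lborel. (\<lambda>i. f x * ((\<psi> (x - X i *\<^sub>R \<theta>) - \<psi> x) / X i)) \<longlonglongrightarrow> - (f x * frechet_derivative \<psi> (at x) \<theta>)"
        by simp
      \<comment> \<open>Measurability of the derivative comes for free: it is a pointwise limit of
        measurable difference quotients.\<close>
      show "(\<lambda>x. - (f x * frechet_derivative \<psi> (at x) \<theta>)) \<in> borel_measurable lborel"
        by (rule borel_measurable_LIMSEQ_real[OF lim]) measurable
      show "AE x in lborel. norm (f x * ((\<psi> (x - X i *\<^sub>R \<theta>) - \<psi> x) / X i)) \<le> L * norm \<theta> * \<bar>f x\<bar>" for i
      proof (rule AE_I2)
        fix x
        have "\<bar>(\<psi> (x - X i *\<^sub>R \<theta>) - \<psi> x) / X i\<bar> \<le> L * norm \<theta>"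
          using L(2)[of "x - X i *\<^sub>R \<theta>" x] X0[of i] by (simp add: abs_divide divide_le_eq mult_ac)
        from mult_left_mono[OF this, of "\<bar>f x\<bar>"]
        show "norm (f x * ((\<psi> (x - X i *\<^sub>R \<theta>) - \<psi> x) / X i)) \<le> L * norm \<theta> * \<bar>f x\<bar>"
          by (simp only: real_norm_def abs_mult) (simp add: mult_ac)
      qed
      show "integrable lborel (\<lambda>x. L * norm \<theta> * \<bar>f x\<bar>)" using f by simp
    qed measurable
    moreover have "(\<integral>x. f x * ((\<psi> (x - X i *\<^sub>R \<theta>) - \<psi> x) / X i) \<partial>lborel) =
        ((\<integral>x. f x * \<psi> (x - X i *\<^sub>R \<theta>) \<partial>lborel) - (\<integral>x. f x * \<psi> x \<partial>lborel)) / X i" for i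
      using int[of "X i *\<^sub>R \<theta>"] int[of 0]
      by (simp add: right_diff_distrib diff_divide_distrib)
    ultimately show "((\<lambda>h. ((\<integral>x. f x * \<psi> (x - h *\<^sub>R \<theta>) \<partial>lborel) - (\<integral>x. f x * \<psi> x \<partial>lborel)) / h) \<circ> X) \<longlonglongrightarrow>
      (\<integral>x. - (f x * frechet_derivative \<psi> (at x) \<theta>) \<partial>lborel)"
      by (simp only: o_def)
  qed
  moreover have "\<psi> (x - h *\<^sub>R \<theta>) = \<phi> (x - (s + h) *\<^sub>R \<theta>)" for x h
    by (simp add: \<psi>_def algebra_simps)
  moreover have "(\<lambda>x. \<phi> (x - s *\<^sub>R \<theta>)) = \<psi>" by (simp add: \<psi>_def fun_eq_iff)
  ultimately show ?thesis
    by (simp add: DERIV_def \<psi>_def)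
qed

text \<open>A change of variables turns the pairing of f(x + r\<theta>) - f(x) with \<phi> into an
  increment of \<Phi>. In the upper bound \<phi> may depend on r, and the mean value theorem
  converts a bound on the derivative into one on the increment. In the lower bound \<phi> is chosen
  for \<open>G x \<bullet> \<theta>\<close> before r tends to 0, so the derivative at 0 is
  enough.\<close>

lemma BV_translation:
  fixes f :: "'a::euclidean_space \<Rightarrow> real"
  assumes f: "integrable lborel f" and sM: "sets M = sets borel" and G: "integrable M G"
    and parts: "\<And>\<phi>. \<phi> \<in> test_functions \<Longrightarrow>
      (\<integral>x. f x * frechet_derivative \<phi> (at x) \<theta> \<partial>lborel) = - (\<integral>x. \<phi> x * (G x \<bullet> \<theta>) \<partial>M)"
  shows "r \<ge> 0 \<Longrightarrow> (\<integral>x. \<bar>f (x + r *\<^sub>R \<theta>) - f x\<bar> \<partial>lborel) \<le> r * (\<integral>x. \<bar>G x \<bullet> \<theta>\<bar> \<partial>M)"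
    and "((\<lambda>r. (\<integral>x. \<bar>f (x + r *\<^sub>R \<theta>) - f x\<bar> \<partial>lborel) / r) \<longlongrightarrow> (\<integral>x. \<bar>G x \<bullet> \<theta>\<bar> \<partial>M)) (at_right 0)"
proof -
  note [measurable] = borel_measurable_integrable[OF f]
  have fm: "f \<in> borel_measurable borel" by simp
  define \<omega> where "\<omega> r = (\<integral>x. \<bar>f (x + r *\<^sub>R \<theta>) - f x\<bar> \<partial>lborel)" for r
  define V where "V = (\<integral>x. \<bar>G x \<bullet> \<theta>\<bar> \<partial>M)"
  have G\<theta>: "integrable M (\<lambda>x. G x \<bullet> \<theta>)" using G by simp
  have fd: "integrable lborel (\<lambda>x. f (x + r *\<^sub>R \<theta>) - f x)" for r
    using f lborel_translate(2)[OF fm] by simp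
  define \<Phi> where "\<Phi> \<phi> s = (\<integral>x. f x * \<phi> (x - s *\<^sub>R \<theta>) \<partial>lborel)" for \<phi> s
  have deriv: "(\<Phi> \<phi> has_real_derivative (\<integral>x. \<phi> (x - s *\<^sub>R \<theta>) * (G x \<bullet> \<theta>) \<partial>M)) (at s)"
    if "\<phi> \<in> test_functions" for \<phi> s
    using pairing_has_derivative[OF f that, of \<theta> s] parts[OF test_function_translate[OF that, of "s *\<^sub>R \<theta>"]]
    unfolding \<Phi>_def by simp
  have shift: "(\<integral>x. (f (x + r *\<^sub>R \<theta>) - f x) * \<phi> x \<partial>lborel) = \<Phi> \<phi> r - \<Phi> \<phi> 0"
    if \<phi>: "\<phi> \<in> test_functions" for \<phi> r
  proof -
    note [measurable] = test_function_measurable[OF \<phi>]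
    obtain B where B: "\<And>x. \<bar>\<phi> x\<bar> \<le> B" using test_function_bounded[OF \<phi>] by blast
    have "integrable lborel (\<lambda>x. f (x + r *\<^sub>R \<theta>))" using f lborel_translate(2)[OF fm] by simp
    then have "integrable lborel (\<lambda>x. f (x + r *\<^sub>R \<theta>) * \<phi> x)" "integrable lborel (\<lambda>x. f x * \<phi> x)"
      by (intro integrable_mult_bounded[OF _ _ B] f; simp)+
    moreover have "(\<integral>x. f (x + r *\<^sub>R \<theta>) * \<phi> x \<partial>lborel) = \<Phi> \<phi> r"
      using lborel_translate(1)[of "\<lambda>x. f x * \<phi> (x - r *\<^sub>R \<theta>)" "r *\<^sub>R \<theta>"] by (simp add: \<Phi>_def)
    ultimately show ?thesis by (simp add: left_diff_distrib \<Phi>_def)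
  qed
  have up: "\<omega> r \<le> r * V" if r: "r \<ge> 0" for r
  proof (rule field_le_epsilon)
    fix e :: real assume "e > 0"
    obtain \<phi> where \<phi>: "\<phi> \<in> test_functions" "\<And>x. \<bar>\<phi> x\<bar> \<le> 1"
      "\<omega> r - e \<le> (\<integral>x. (f (x + r *\<^sub>R \<theta>) - f x) * \<phi> x \<partial>lborel)"
      unfolding \<omega>_def using test_functions_norming[OF sets_lborel fd \<open>e > 0\<close>] by blast
    note [measurable] = test_function_measurable[OF \<phi>(1)]
    \<comment> \<open>Translates of \<phi> are still bounded by 1, so the estimate holds for every
      \<open>s\<close>, in particular at the unknown intermediate point of the mean value
      theorem.\<close>
    have bd: "(\<integral>x. \<phi> (x - s *\<^sub>R \<theta>) * (G x \<bullet> \<theta>) \<partial>M) \<le> V" for s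
      unfolding V_def
    proof (rule integral_mono)
      have "(\<lambda>x. \<phi> (x - s *\<^sub>R \<theta>)) \<in> borel_measurable M"
        by (subst measurable_cong_sets[OF sM refl]) measurable
      from integrable_mult_bounded[OF G\<theta> this \<phi>(2)]
      show "integrable M (\<lambda>x. \<phi> (x - s *\<^sub>R \<theta>) * (G x \<bullet> \<theta>))" by (simp add: mult.commute)
      show "integrable M (\<lambda>x. \<bar>G x \<bullet> \<theta>\<bar>)" using G\<theta> by simp
      show "\<phi> (x - s *\<^sub>R \<theta>) * (G x \<bullet> \<theta>) \<le> \<bar>G x \<bullet> \<theta>\<bar>" for x
      proof -
        have "\<phi> (x - s *\<^sub>R \<theta>) * (G x \<bullet> \<theta>) \<le> \<bar>\<phi> (x - s *\<^sub>R \<theta>)\<bar> * \<bar>G x \<bullet> \<theta>\<bar>"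
          by (metis abs_ge_self abs_mult)
        also have "\<dots> \<le> 1 * \<bar>G x \<bullet> \<theta>\<bar>" by (intro mult_right_mono \<phi>) auto
        finally show ?thesis by simp
      qed
    qed
    have "\<Phi> \<phi> r - \<Phi> \<phi> 0 \<le> r * V"
    proof (cases "r = 0")
      case False
      then have "r > 0" using r by simp
      then obtain z where "\<Phi> \<phi> r - \<Phi> \<phi> 0 = (r - 0) * (\<integral>x. \<phi> (x - z *\<^sub>R \<theta>) * (G x \<bullet> \<theta>) \<partial>M)"
        using MVT2[of 0 r "\<Phi> \<phi>", OF _ deriv[OF \<phi>(1)]] by blast
      then show ?thesis using bd[of z] r by (simp add: mult_left_mono)
    qed simp
    then show "\<omega> r \<le> r * V + e" using \<phi>(3) shift[OF \<phi>(1)] by simp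
  qed
  then show "r \<ge> 0 \<Longrightarrow> (\<integral>x. \<bar>f (x + r *\<^sub>R \<theta>) - f x\<bar> \<partial>lborel) \<le> r * (\<integral>x. \<bar>G x \<bullet> \<theta>\<bar> \<partial>M)"
    by (simp add: \<omega>_def V_def)
  have "((\<lambda>r. \<omega> r / r) \<longlongrightarrow> V) (at_right 0)"
  proof (rule order_tendstoI)
    fix a assume "V < a"
    then show "\<forall>\<^sub>F r in at_right 0. \<omega> r / r < a"
    proof -
      have "\<omega> r / r < a" if "r > 0" for r
        using order_le_less_trans[OF up[of r] mult_strict_left_mono[OF \<open>V < a\<close> that]] that
        by (simp add: divide_less_eq mult.commute)
      then show ?thesis by (simp add: eventually_at_filter)
    qed
  next
    fix a assume "a < V"
    define e where "e = (V - a) / 2"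
    have e: "e > 0" "a < V - e" using \<open>a < V\<close> by (auto simp: e_def field_simps)
    obtain \<phi> where \<phi>: "\<phi> \<in> test_functions" "\<And>x. \<bar>\<phi> x\<bar> \<le> 1"
      "V - e \<le> (\<integral>x. (G x \<bullet> \<theta>) * \<phi> x \<partial>M)"
      unfolding V_def using test_functions_norming[OF sM G\<theta> e(1)] by blast
    note [measurable] = test_function_measurable[OF \<phi>(1)]
    have "((\<lambda>r. (\<Phi> \<phi> r - \<Phi> \<phi> 0) / r) \<longlongrightarrow> (\<integral>x. \<phi> x * (G x \<bullet> \<theta>) \<partial>M)) (at_right 0)"
      using deriv[OF \<phi>(1), of 0] unfolding DERIV_def by (auto intro: tendsto_within_subset)
    moreover have "a < (\<integral>x. \<phi> x * (G x \<bullet> \<theta>) \<partial>M)"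
      using \<phi>(3) e by (simp add: mult.commute)
    ultimately have "\<forall>\<^sub>F r in at_right 0. a < (\<Phi> \<phi> r - \<Phi> \<phi> 0) / r" by (rule order_tendstoD)
    moreover have "\<forall>\<^sub>F r::real in at_right 0. r > 0" by (simp add: eventually_at_filter)
    ultimately show "\<forall>\<^sub>F r in at_right 0. a < \<omega> r / r"
    proof eventually_elim
      case (elim r)
      have "\<Phi> \<phi> r - \<Phi> \<phi> 0 = (\<integral>x. (f (x + r *\<^sub>R \<theta>) - f x) * \<phi> x \<partial>lborel)" using shift[OF \<phi>(1)] by simp
      also have "\<dots> \<le> \<omega> r"
        unfolding \<omega>_def
      proof (rule integral_mono)
        show "integrable lborel (\<lambda>x. (f (x + r *\<^sub>R \<theta>) - f x) * \<phi> x)"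
          by (intro integrable_mult_bounded[OF fd _ \<phi>(2)]) measurable
        show "(f (x + r *\<^sub>R \<theta>) - f x) * \<phi> x \<le> \<bar>f (x + r *\<^sub>R \<theta>) - f x\<bar>" for x
        proof -
          have "(f (x + r *\<^sub>R \<theta>) - f x) * \<phi> x \<le> \<bar>f (x + r *\<^sub>R \<theta>) - f x\<bar> * \<bar>\<phi> x\<bar>"
            by (metis abs_ge_self abs_mult)
          also have "\<dots> \<le> \<bar>f (x + r *\<^sub>R \<theta>) - f x\<bar> * 1" by (intro mult_left_mono \<phi>) auto
          finally show ?thesis by simp
        qed
      qed (use fd in auto)
      finally show ?case using elim divide_right_mono[of "\<Phi> \<phi> r - \<Phi> \<phi> 0" "\<omega> r" r] by linarith
    qed
  qed
  then show "((\<lambda>r. (\<integral>x. \<bar>f (x + r *\<^sub>R \<theta>) - f x\<bar> \<partial>lborel) / r) \<longlongrightarrow> (\<integral>x. \<bar>G x \<bullet> \<theta>\<bar> \<partial>M)) (at_right 0)"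
    by (simp add: \<omega>_def V_def)
qed

section \<open>Stable measures in polar coordinates\<close>

lemma measurable_ident_sphere:
  assumes "sets \<eta> = sets sphere_borel"
  shows "(\<lambda>\<theta>. \<theta>) \<in> \<eta> \<rightarrow>\<^sub>M borel"
  by (subst measurable_cong_sets[OF assms refl]) (rule measurable_restrict_space1, simp)

lemma space_sphere:
  assumes "sets \<eta> = sets sphere_borel"
  shows "space \<eta> = unit_sphere"
  using sets_eq_imp_space_eq[OF assms] by (simp add: space_restrict_space)

text \<open>The stable measure is the image of a measure with density on the product of \<eta> and
  Lebesgue measure under (\<theta>, r) \<mapsto> r\<theta>. The polar formula for functions is then
  the change of variables rule.\<close>

lemma nn_integral_stable_measure:
  fixes \<eta> :: "'a::euclidean_space measure"
  assumes \<eta>: "sets \<eta> = sets sphere_borel" and h: "h \<in> borel_measurable borel"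
  shows "(\<integral>\<^sup>+x. h x \<partial>stable_measure \<eta> \<alpha>) =
    (\<integral>\<^sup>+\<theta>. (\<integral>\<^sup>+r\<in>{0<..}. h (r *\<^sub>R \<theta>) * ennreal (r powr (- 1 - \<alpha>)) \<partial>lborel) \<partial>\<eta>)"
proof -
  note [measurable] = measurable_compose[OF measurable_fst measurable_ident_sphere[OF \<eta>]] h
  define k :: "'a \<times> real \<Rightarrow> ennreal" where "k = (\<lambda>(\<theta>, r). ennreal (r powr (- 1 - \<alpha>)) * indicator {0<..} r)"
  have k[measurable]: "k \<in> borel_measurable (\<eta> \<Otimes>\<^sub>M lborel)" unfolding k_def by measurable
  have T[measurable]: "(\<lambda>p. snd p *\<^sub>R fst p) \<in> (\<eta> \<Otimes>\<^sub>M lborel) \<rightarrow>\<^sub>M borel" by measurable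
  have eq: "stable_measure \<eta> \<alpha> = distr (density (\<eta> \<Otimes>\<^sub>M lborel) k) borel (\<lambda>p. snd p *\<^sub>R fst p)"
  proof (rule measure_eqI)
    fix A assume "A \<in> sets (stable_measure \<eta> \<alpha>)"
    then have A[measurable]: "A \<in> sets borel" by (simp add: sets_stable_measure)
    have "emeasure (distr (density (\<eta> \<Otimes>\<^sub>M lborel) k) borel (\<lambda>p. snd p *\<^sub>R fst p)) A =
        (\<integral>\<^sup>+p. indicator A p \<partial>distr (density (\<eta> \<Otimes>\<^sub>M lborel) k) borel (\<lambda>p. snd p *\<^sub>R fst p))"
      by simp
    also have "\<dots> = (\<integral>\<^sup>+p. k p * indicator A (snd p *\<^sub>R fst p) \<partial>(\<eta> \<Otimes>\<^sub>M lborel))"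
      by (subst nn_integral_distr) (auto simp: nn_integral_density)
    also have "\<dots> = (\<integral>\<^sup>+\<theta>. \<integral>\<^sup>+r. k (\<theta>, r) * indicator A (r *\<^sub>R \<theta>) \<partial>lborel \<partial>\<eta>)"
      by (subst lborel.nn_integral_fst[symmetric]) auto
    also have "\<dots> = emeasure (stable_measure \<eta> \<alpha>) A"
      by (subst emeasure_stable_measure[OF \<eta> A]) (auto simp: k_def mult_ac intro!: nn_integral_cong)
    finally show "emeasure (stable_measure \<eta> \<alpha>) A =
        emeasure (distr (density (\<eta> \<Otimes>\<^sub>M lborel) k) borel (\<lambda>p. snd p *\<^sub>R fst p)) A" ..
  qed (simp add: sets_stable_measure)
  have "(\<integral>\<^sup>+x. h x \<partial>stable_measure \<eta> \<alpha>) = (\<integral>\<^sup>+p. k p * h (snd p *\<^sub>R fst p) \<partial>(\<eta> \<Otimes>\<^sub>M lborel))"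
    unfolding eq by (subst nn_integral_distr) (auto simp: nn_integral_density)
  also have "\<dots> = (\<integral>\<^sup>+\<theta>. \<integral>\<^sup>+r. k (\<theta>, r) * h (r *\<^sub>R \<theta>) \<partial>lborel \<partial>\<eta>)"
    by (subst lborel.nn_integral_fst[symmetric]) auto
  finally show ?thesis by (simp add: k_def mult_ac)
qed

section \<open>Radial power integrals and the angular measure\<close>

lemma nn_integral_powr_from_0:
  assumes "\<alpha> < 1" "\<delta> > 0"
  shows "(\<integral>\<^sup>+r\<in>{0<..\<delta>}. ennreal (r powr - \<alpha>) \<partial>lborel) = ennreal (\<delta> powr (1 - \<alpha>) / (1 - \<alpha>))"
proof -
  \<comment> \<open>By convention \<open>0 powr _ = 0\<close>, so including the endpoint does not
    change the integrand anywhere.\<close>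
  have "(\<integral>\<^sup>+r\<in>{0<..\<delta>}. ennreal (r powr - \<alpha>) \<partial>lborel) = (\<integral>\<^sup>+r\<in>{0..\<delta>}. ennreal (r powr - \<alpha>) \<partial>lborel)"
    by (intro nn_integral_cong) (auto simp: indicator_def)
  also have "\<dots> = ennreal (\<delta> powr (- \<alpha> + 1) / (- \<alpha> + 1))"
    using assms by (intro nn_integral_has_integral_lebesgue' has_integral_powr_from_0) auto
  finally show ?thesis by (simp add: add.commute)
qed

lemma nn_integral_powr_to_infinity:
  assumes "\<alpha> > 0"
  shows "(\<integral>\<^sup>+r\<in>{1<..}. ennreal (r powr (- 1 - \<alpha>)) \<partial>lborel) = ennreal (1 / \<alpha>)"
proof -
  \<comment> \<open>The integrand is 1 at the added endpoint, so the two sides agree only almost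
    everywhere.\<close>
  have "(\<integral>\<^sup>+r\<in>{1<..}. ennreal (r powr (- 1 - \<alpha>)) \<partial>lborel) = (\<integral>\<^sup>+r\<in>{1..}. ennreal (r powr (- 1 - \<alpha>)) \<partial>lborel)"
    using AE_lborel_singleton[of "1::real"] by (intro nn_integral_cong_AE) (auto simp: indicator_def)
  also have "\<dots> = ennreal (- (1 powr (- 1 - \<alpha> + 1)) / (- 1 - \<alpha> + 1))"
    using assms by (intro nn_integral_has_integral_lebesgue' has_integral_powr_to_inf) auto
  finally show ?thesis by simp
qed

lemma nn_integral_truncated_powr:
  assumes "0 < \<alpha>" "\<alpha> < 1"
  shows "(\<integral>\<^sup>+r\<in>{0<..}. ennreal (min 1 r) * ennreal (r powr (- 1 - \<alpha>)) \<partial>lborel) = ennreal (1 / (1 - \<alpha>) + 1 / \<alpha>)"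
proof -
  have "(\<integral>\<^sup>+r\<in>{0<..}. ennreal (min 1 r) * ennreal (r powr (- 1 - \<alpha>)) \<partial>lborel) =
      (\<integral>\<^sup>+r. ennreal (r powr - \<alpha>) * indicator {0<..1} r + ennreal (r powr (- 1 - \<alpha>)) * indicator {1<..} r \<partial>lborel)"
  proof (intro nn_integral_cong)
    fix r :: real
    have "r * r powr (- 1 - \<alpha>) = r powr - \<alpha>" if "r > 0"
      using that by (simp add: powr_mult_base)
    then show "ennreal (min 1 r) * ennreal (r powr (- 1 - \<alpha>)) * indicator {0<..} r =
        ennreal (r powr - \<alpha>) * indicator {0<..1} r + ennreal (r powr (- 1 - \<alpha>)) * indicator {1<..} r"
      by (auto simp: indicator_def min_def ennreal_mult[symmetric])
  qed
  also have "\<dots> = ennreal (1 / (1 - \<alpha>)) + ennreal (1 / \<alpha>)"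
    using assms nn_integral_powr_from_0[of \<alpha> 1] nn_integral_powr_to_infinity[of \<alpha>]
    by (subst nn_integral_add) auto
  finally show ?thesis using assms by (simp add: ennreal_plus)
qed

text \<open>An open ray from the origin is either contained in the cone over \<open>S\<close> or
  disjoint from it. The cone indicator is therefore constant along rays and leaves the radial
  integral, which no longer depends on the direction.\<close>

lemma angular_normalized_stable_measure:
  fixes \<eta> :: "'a::euclidean_space measure"
  assumes "prob_space \<eta>" and \<eta>: "sets \<eta> = sets sphere_borel" and \<alpha>: "0 < \<alpha>" "\<alpha> < 1"
  shows "angular_measure (normalized_measure (stable_measure \<eta> \<alpha>)) = \<eta>"
proof -
  interpret prob_space \<eta> by fact
  define C where "C = ennreal (1 / (1 - \<alpha>) + 1 / \<alpha>)"
  have C: "C \<noteq> 0" "C \<noteq> \<infinity>" unfolding C_def using \<alpha> by (auto simp: add_pos_pos)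
  have W: "(\<integral>\<^sup>+x. ennreal (min 1 (norm x)) * indicator {r *\<^sub>R e |r e. 0 < r \<and> e \<in> S} x \<partial>stable_measure \<eta> \<alpha>) = C * emeasure \<eta> S"
    if S: "S \<in> sets \<eta>" for S
  proof -
    have c[measurable]: "{r *\<^sub>R e |r e. 0 < r \<and> e \<in> S} \<in> sets borel" using cone_sets(1) S \<eta> by simp
    have Ss: "S \<subseteq> unit_sphere" using sets.sets_into_space[OF S] space_sphere[OF \<eta>] by simp
    have ind: "indicator {r *\<^sub>R e |r e. 0 < r \<and> e \<in> S} (r *\<^sub>R \<theta>) = (indicator S \<theta> :: ennreal)"
      if "r > 0" "\<theta> \<in> unit_sphere" for r \<theta>
    proof -
      have "\<theta> \<in> S" if *: "r *\<^sub>R \<theta> = r' *\<^sub>R e" "r' > 0" "e \<in> S" for r' e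
      proof -
        have "norm e = 1" using * Ss by auto
        have "norm (r *\<^sub>R \<theta>) = norm (r' *\<^sub>R e)" using * by simp
        then have "r = r'" using *(2) \<open>norm e = 1\<close> \<open>r > 0\<close> \<open>\<theta> \<in> unit_sphere\<close> by simp
        then show ?thesis using * by simp
      qed
      then show ?thesis using that by (auto simp: indicator_def)
    qed
    have "(\<integral>\<^sup>+x. ennreal (min 1 (norm x)) * indicator {r *\<^sub>R e |r e. 0 < r \<and> e \<in> S} x \<partial>stable_measure \<eta> \<alpha>) =
        (\<integral>\<^sup>+\<theta>. (\<integral>\<^sup>+r\<in>{0<..}. (ennreal (min 1 (norm (r *\<^sub>R \<theta>))) * indicator {r *\<^sub>R e |r e. 0 < r \<and> e \<in> S} (r *\<^sub>R \<theta>)) *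
          ennreal (r powr (- 1 - \<alpha>)) \<partial>lborel) \<partial>\<eta>)"
      by (rule nn_integral_stable_measure[OF \<eta>]) measurable
    also have "\<dots> = (\<integral>\<^sup>+\<theta>. C * indicator S \<theta> \<partial>\<eta>)"
    proof (intro nn_integral_cong)
      fix \<theta> assume "\<theta> \<in> space \<eta>"
      then have \<theta>: "\<theta> \<in> unit_sphere" using space_sphere[OF \<eta>] by simp
      have "(\<integral>\<^sup>+r\<in>{0<..}. (ennreal (min 1 (norm (r *\<^sub>R \<theta>))) * indicator {r *\<^sub>R e |r e. 0 < r \<and> e \<in> S} (r *\<^sub>R \<theta>)) *
          ennreal (r powr (- 1 - \<alpha>)) \<partial>lborel) =
          (\<integral>\<^sup>+r. (ennreal (min 1 r) * ennreal (r powr (- 1 - \<alpha>)) * indicator {0<..} r) * indicator S \<theta> \<partial>lborel)"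
      proof (intro nn_integral_cong)
        fix r :: real
        show "ennreal (min 1 (norm (r *\<^sub>R \<theta>))) * indicator {r *\<^sub>R e |r e. 0 < r \<and> e \<in> S} (r *\<^sub>R \<theta>) *
            ennreal (r powr (- 1 - \<alpha>)) * indicator {0<..} r =
            (ennreal (min 1 r) * ennreal (r powr (- 1 - \<alpha>)) * indicator {0<..} r) * indicator S \<theta>"
          using \<theta> ind[OF _ \<theta>, of r] by (cases "r > 0") (auto simp: mult_ac)
      qed
      also have "\<dots> = C * indicator S \<theta>"
        using nn_integral_truncated_powr[OF \<alpha>] by (subst nn_integral_multc) (auto simp: C_def)
      finally show "(\<integral>\<^sup>+r\<in>{0<..}. (ennreal (min 1 (norm (r *\<^sub>R \<theta>))) * indicator {r *\<^sub>R e |r e. 0 < r \<and> e \<in> S} (r *\<^sub>R \<theta>)) *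
          ennreal (r powr (- 1 - \<alpha>)) \<partial>lborel) = C * indicator S \<theta>" .
    qed
    also have "\<dots> = C * emeasure \<eta> S" using S by (simp add: nn_integral_cmult_indicator)
    finally show ?thesis .
  qed
  \<comment> \<open>The cone over the whole sphere misses only the origin, where the weight
    \<open>min 1 (norm x)\<close> vanishes; the normalizer is thus the case
    \<open>S = unit_sphere\<close>.\<close>
  have "normalizer (stable_measure \<eta> \<alpha>) =
      (\<integral>\<^sup>+x. ennreal (min 1 (norm x)) * indicator {r *\<^sub>R e |r e. 0 < r \<and> e \<in> unit_sphere} x \<partial>stable_measure \<eta> \<alpha>)"
    unfolding normalizer_def
  proof (intro nn_integral_cong)
    fix x :: 'a
    have "x \<noteq> 0 \<Longrightarrow> \<exists>r e. x = r *\<^sub>R e \<and> 0 < r \<and> norm e = 1"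
      by (intro exI[of _ "norm x"] exI[of _ "x /\<^sub>R norm x"]) auto
    then show "ennreal (min 1 (norm x)) =
        ennreal (min 1 (norm x)) * indicator {r *\<^sub>R e |r e. 0 < r \<and> e \<in> unit_sphere} x"
      by (cases "x = 0") (auto simp: indicator_def)
  qed
  also have "\<dots> = C * emeasure \<eta> unit_sphere"
    using W[of unit_sphere] sets.top[of \<eta>] space_sphere[OF \<eta>] by simp
  also have "\<dots> = C" using emeasure_space_1 space_sphere[OF \<eta>] by simp
  finally have N: "normalizer (stable_measure \<eta> \<alpha>) = C" .
  show ?thesis
  proof (rule measure_eqI)
    show "sets (angular_measure (normalized_measure (stable_measure \<eta> \<alpha>))) = sets \<eta>"
      by (simp add: sets_angular_measure \<eta>)
    fix S assume "S \<in> sets (angular_measure (normalized_measure (stable_measure \<eta> \<alpha>)))"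
    then have S: "S \<in> sets \<eta>" "S \<in> sets sphere_borel" by (auto simp: sets_angular_measure \<eta>)
    have s: "sets (normalized_measure (stable_measure \<eta> \<alpha>)) = sets borel"
      by (simp add: normalized_measure_def sets_stable_measure)
    have "emeasure (angular_measure (normalized_measure (stable_measure \<eta> \<alpha>))) S = inverse C * (C * emeasure \<eta> S)"
      unfolding emeasure_angular_measure[OF s S(2)] W[OF S(1), symmetric]
      by (simp add: normalized_measure_def N, subst emeasure_density)
         (auto simp: sets_stable_measure measurable_cong_sets[OF sets_stable_measure refl] cone_sets(1)[OF S(2)])
    \<comment> \<open>Cancellation in \<open>ennreal\<close> requires \<open>C\<close> to be neither
      0 nor infinite, which holds for 0 < \<alpha> < 1.\<close>
    also have "\<dots> = emeasure \<eta> S"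
      using C by (simp add: mult.assoc[symmetric] ennreal_inverse_mult less_top zero_less_iff_neq_zero)
         (metis ennreal_divide_self ennreal_times_divide infinity_ennreal_def mult.commute mult_1 divide_ennreal_def)
    finally show "emeasure (angular_measure (normalized_measure (stable_measure \<eta> \<alpha>))) S = emeasure \<eta> S" .
  qed
qed

text \<open>Closed sets form a generator stable under intersection, and the indicator of a closed
  set is the limit of the continuous tents max 0 (1 - n dist(x, C)), to which dominated convergence
  applies.\<close>

lemma finite_borel_measure_eqI:
  fixes P Q :: "'a::metric_space measure"
  assumes P: "finite_measure P" "sets P = sets borel" and Q: "finite_measure Q" "sets Q = sets borel"
    and eq: "\<And>g :: 'a \<Rightarrow> real. continuous_on UNIV g \<Longrightarrow> bounded (range g) \<Longrightarrow> (\<integral>x. g x \<partial>P) = (\<integral>x. g x \<partial>Q)"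
  shows "P = Q"
proof (rule measure_eqI_generator_eq[where E = "Collect closed" and \<Omega> = UNIV and A = "\<lambda>_. UNIV"])
  interpret P: finite_measure P by fact
  interpret Q: finite_measure Q by fact
  show "Int_stable (Collect (closed :: 'a set \<Rightarrow> bool))" by (auto simp: Int_stable_def)
  show "sets P = sigma_sets UNIV (Collect closed)" "sets Q = sigma_sets UNIV (Collect closed)"
    unfolding P Q by (simp_all add: borel_eq_closed)
  show "emeasure P UNIV \<noteq> \<infinity>" by simp
  fix C :: "'a set" assume "C \<in> Collect closed"
  then have C: "closed C" by simp
  show "emeasure P C = emeasure Q C"
  \<comment> \<open>By convention \<open>infdist x {} = 0\<close>, which would make every
    \<open>g n\<close> constantly 1; the empty set is therefore treated apart.\<close>
  proof (cases "C = {}")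
    case False
    define g where "g n x = max 0 (1 - real n * infdist x C)" for n x
    have cont: "continuous_on UNIV (g n)" for n
      unfolding g_def by (intro continuous_intros continuous_on_infdist)
    have bd: "0 \<le> g n x" "g n x \<le> 1" for n x by (auto simp: g_def infdist_nonneg)
    have lim: "(\<lambda>n. g n x) \<longlonglongrightarrow> indicator C x" for x
    proof (cases "x \<in> C")
      case False
      then have "infdist x C > 0" using in_closed_iff_infdist_zero[OF C \<open>C \<noteq> {}\<close>] infdist_nonneg[of x C] by fastforce
      then obtain N where N: "1 < real N * infdist x C" using reals_Archimedean3 by blast
      have "\<forall>\<^sub>F n in sequentially. g n x = indicator C x"
        unfolding eventually_sequentially
      proof (intro exI allI impI)
        fix n assume "N \<le> n"
        then have "real N * infdist x C \<le> real n * infdist x C"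
          by (intro mult_right_mono) (auto simp: infdist_nonneg)
        then show "g n x = indicator C x" using N False by (simp add: g_def)
      qed
      then show ?thesis by (rule tendsto_eventually)
    qed (simp add: g_def)
    have conv: "(\<lambda>n. \<integral>x. g n x \<partial>R) \<longlonglongrightarrow> measure R C" if R: "finite_measure R" "sets R = sets borel" for R
    proof -
      interpret R: finite_measure R by fact
      have [measurable]: "g n \<in> borel_measurable R" for n
        by (simp add: measurable_cong_sets[OF R(2) refl] borel_measurable_continuous_onI cont)
      have CR: "C \<in> sets R" using C R by auto
      have "(\<lambda>n. \<integral>x. g n x \<partial>R) \<longlonglongrightarrow> (\<integral>x. indicator C x \<partial>R)"
        by (rule integral_dominated_convergence[where w="\<lambda>_. 1"])
           (use bd lim CR in \<open>auto simp: abs_le_iff intro!: AE_I2 order_trans[OF _ bd(1)]\<close>)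
      then show ?thesis using CR by simp
    qed
    have "bounded (range (g n))" for n
      using bd by (intro boundedI[of _ 1]) (auto simp: abs_le_iff intro!: order_trans[OF _ bd(1)])
    then have "(\<lambda>n. \<integral>x. g n x \<partial>P) = (\<lambda>n. \<integral>x. g n x \<partial>Q)"
      using eq[OF cont] by auto
    then have "measure P C = measure Q C"
      using LIMSEQ_unique[OF conv[OF P]] conv[OF Q] by simp
    then show ?thesis by (simp add: P.emeasure_eq_measure Q.emeasure_eq_measure)
  qed simp
qed auto

lemma eventually_angular_stable_eq:
  fixes \<eta> :: "'a::euclidean_space measure"
  assumes "prob_space \<eta>" and "sets \<eta> = sets sphere_borel"
  shows "\<forall>\<^sub>F \<alpha> in at_left (1::real). angular_measure (normalized_measure (stable_measure \<eta> \<alpha>)) = \<eta>"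
  using eventually_at_left_real[of 0 1]
  by (auto elim!: eventually_mono intro!: angular_normalized_stable_measure[OF assms])

lemma weak_limit_stable:
  fixes \<eta> :: "'a::euclidean_space measure"
  assumes p: "prob_space \<eta>" and \<eta>: "sets \<eta> = sets sphere_borel"
  shows "weak_limit_on_sphere (\<lambda>\<alpha>. angular_measure (normalized_measure (stable_measure \<eta> \<alpha>))) \<eta> (at_left 1)"
  unfolding weak_limit_on_sphere_def
proof (intro conjI allI impI)
  show "finite_measure \<eta>" using p by (simp add: prob_space.axioms)
  fix g :: "'a \<Rightarrow> real"
  show "((\<lambda>\<alpha>. \<integral>\<theta>. g \<theta> \<partial>angular_measure (normalized_measure (stable_measure \<eta> \<alpha>))) \<longlongrightarrow> (\<integral>\<theta>. g \<theta> \<partial>\<eta>)) (at_left 1)"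
    using eventually_angular_stable_eq[OF p \<eta>] by (intro tendsto_eventually) (auto elim: eventually_mono)
qed (rule \<eta>)

text \<open>Limits of real integrals are unique, so both measures integrate continuous functions on
  the sphere alike. Pushing them forward along the inclusion into the ambient space allows a
  comparison on all Borel sets, since restrictions of bounded continuous functions are admissible on
  the sphere.\<close>

lemma weak_limit_stable_unique:
  fixes \<eta> :: "'a::euclidean_space measure"
  assumes p: "prob_space \<eta>" and \<eta>: "sets \<eta> = sets sphere_borel"
    and w: "weak_limit_on_sphere (\<lambda>\<alpha>. angular_measure (normalized_measure (stable_measure \<eta> \<alpha>))) \<mu> (at_left 1)"
  shows "\<mu> = \<eta>"
proof -
  interpret prob_space \<eta> by fact
  have \<mu>: "sets \<mu> = sets sphere_borel" "finite_measure \<mu>" using w by (auto simp: weak_limit_on_sphere_def)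
  have eq: "(\<integral>\<theta>. g \<theta> \<partial>\<mu>) = (\<integral>\<theta>. g \<theta> \<partial>\<eta>)" if "continuous_on unit_sphere g" "bounded (g ` unit_sphere)" for g :: "'a \<Rightarrow> real"
  proof (rule tendsto_unique[OF trivial_limit_at_left_real[of 1]])
    show "((\<lambda>\<alpha>. \<integral>\<theta>. g \<theta> \<partial>angular_measure (normalized_measure (stable_measure \<eta> \<alpha>))) \<longlongrightarrow> (\<integral>\<theta>. g \<theta> \<partial>\<mu>)) (at_left 1)"
      using w that by (auto simp: weak_limit_on_sphere_def)
    show "((\<lambda>\<alpha>. \<integral>\<theta>. g \<theta> \<partial>angular_measure (normalized_measure (stable_measure \<eta> \<alpha>))) \<longlongrightarrow> (\<integral>\<theta>. g \<theta> \<partial>\<eta>)) (at_left 1)"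
      using weak_limit_stable[OF p \<eta>] that by (auto simp: weak_limit_on_sphere_def)
  qed
  note m = measurable_ident_sphere[OF \<eta>] measurable_ident_sphere[OF \<mu>(1)]
  have d: "distr \<mu> borel (\<lambda>x. x) = distr \<eta> borel (\<lambda>x. x)"
  proof (rule finite_borel_measure_eqI)
    show "finite_measure (distr \<mu> borel (\<lambda>x. x))" "finite_measure (distr \<eta> borel (\<lambda>x. x))"
      using m \<mu>(2) by (auto intro!: finite_measure.finite_measure_distr finite_measure_axioms)
    fix g :: "'a \<Rightarrow> real" assume g: "continuous_on UNIV g" "bounded (range g)"
    then have [measurable]: "g \<in> borel_measurable borel" by (simp add: borel_measurable_continuous_onI)
    show "(\<integral>x. g x \<partial>distr \<mu> borel (\<lambda>x. x)) = (\<integral>x. g x \<partial>distr \<eta> borel (\<lambda>x. x))"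
      using eq[of g] continuous_on_subset[OF g(1)] bounded_subset[OF g(2), of "g ` unit_sphere"] m
      by (auto simp: integral_distr)
  qed auto
  show ?thesis
  proof (rule measure_eqI)
    fix A assume A: "A \<in> sets \<mu>"
    then have As: "A \<subseteq> unit_sphere" "A \<in> sets borel" using \<mu> by (auto simp: sets_restrict_space)
    have "emeasure (distr \<mu> borel (\<lambda>x. x)) A = emeasure (distr \<eta> borel (\<lambda>x. x)) A" by (simp add: d)
    then show "emeasure \<mu> A = emeasure \<eta> A"
      using As m by (simp add: emeasure_distr space_sphere[OF \<eta>] space_sphere[OF \<mu>(1)] Int_absorb2)
  qed (simp add: \<mu> \<eta>)
qed

section \<open>The limit of the nonlocal energy\<close>

text \<open>The integral is split at r = 1, with the linear bound on \<open>w\<close> below and the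
  constant bound above. The explicit error term serves both as the upper half of the limit and as a
  bound uniform in the direction.\<close>

lemma radial_integral_le:
  assumes \<alpha>: "0 < \<alpha>" "\<alpha> < 1" and V: "V \<ge> 0" and K: "K \<ge> 0"
    and wV: "\<And>r. r > 0 \<Longrightarrow> w r \<le> r * V" and wK: "\<And>r. w r \<le> K"
  shows "ennreal (1 - \<alpha>) * (\<integral>\<^sup>+r\<in>{0<..}. ennreal (w r) * ennreal (r powr (- 1 - \<alpha>)) \<partial>lborel)
      \<le> ennreal (V + K * ((1 - \<alpha>) / \<alpha>))"
proof -
  have "(\<integral>\<^sup>+r\<in>{0<..}. ennreal (w r) * ennreal (r powr (- 1 - \<alpha>)) \<partial>lborel) \<le>
      (\<integral>\<^sup>+r. ennreal V * (ennreal (r powr - \<alpha>) * indicator {0<..1} r) +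
        ennreal K * (ennreal (r powr (- 1 - \<alpha>)) * indicator {1<..} r) \<partial>lborel)"
  proof (intro nn_integral_mono)
    fix r :: real
    consider "r \<le> 0" | "0 < r" "r \<le> 1" | "1 < r" by linarith
    then show "ennreal (w r) * ennreal (r powr (- 1 - \<alpha>)) * indicator {0<..} r \<le>
        ennreal V * (ennreal (r powr - \<alpha>) * indicator {0<..1} r) +
        ennreal K * (ennreal (r powr (- 1 - \<alpha>)) * indicator {1<..} r)"
    proof cases
      case 2
      have "r * r powr (- 1 - \<alpha>) = r powr - \<alpha>" using 2 by (simp add: powr_mult_base)
      then have e: "r * V * r powr (- 1 - \<alpha>) = V * r powr - \<alpha>" by (simp add: mult_ac)
      have "ennreal (w r) * ennreal (r powr (- 1 - \<alpha>)) \<le> ennreal (r * V) * ennreal (r powr (- 1 - \<alpha>))"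
        using wV[of r] 2 by (intro mult_right_mono ennreal_leI) auto
      also have "\<dots> = ennreal V * ennreal (r powr - \<alpha>)"
        using 2 V e by (simp only: ennreal_mult[symmetric] mult_nonneg_nonneg powr_ge_zero less_imp_le)
      finally show ?thesis using 2 by simp
    next
      case 3
      then show ?thesis using wK[of r] by (auto intro!: mult_right_mono ennreal_leI)
    qed auto
  qed
  also have "\<dots> = ennreal V * ennreal (1 / (1 - \<alpha>)) + ennreal K * ennreal (1 / \<alpha>)"
    using \<alpha> nn_integral_powr_from_0[of \<alpha> 1] nn_integral_powr_to_infinity[of \<alpha>]
    by (subst nn_integral_add) (auto simp: nn_integral_cmult)
  also have "\<dots> = ennreal (V * (1 / (1 - \<alpha>)) + K * (1 / \<alpha>))"
    using \<alpha> V K by (simp add: ennreal_mult'[symmetric])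
  finally have "ennreal (1 - \<alpha>) * (\<integral>\<^sup>+r\<in>{0<..}. ennreal (w r) * ennreal (r powr (- 1 - \<alpha>)) \<partial>lborel)
      \<le> ennreal (1 - \<alpha>) * ennreal (V * (1 / (1 - \<alpha>)) + K * (1 / \<alpha>))"
    by (intro mult_left_mono) auto
  also have "\<dots> = ennreal ((1 - \<alpha>) * (V * (1 / (1 - \<alpha>)) + K * (1 / \<alpha>)))"
    using \<alpha> by (intro ennreal_mult'[symmetric]) auto
  also have "(1 - \<alpha>) * (V * (1 / (1 - \<alpha>)) + K * (1 / \<alpha>)) = V + K * ((1 - \<alpha>) / \<alpha>)"
    using \<alpha> by (simp add: distrib_left)
  finally show ?thesis .
qed

text \<open>The upper half is \<open>radial_integral_le\<close>, whose error term vanishes. For the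
  lower half only a short interval at 0 is kept, on which \<open>w r\<close> exceeds
  \<open>a * r\<close>; it contributes a (\<delta>/2)^(1-\<alpha>), which tends to
  \<open>a\<close>.\<close>

lemma radial_integral_tendsto:
  assumes V: "V \<ge> 0" and K: "K \<ge> 0" and w0: "\<And>r. 0 \<le> w r"
    and wV: "\<And>r. r > 0 \<Longrightarrow> w r \<le> r * V" and wK: "\<And>r. w r \<le> K"
    and lim: "((\<lambda>r. w r / r) \<longlongrightarrow> V) (at_right 0)"
  shows "((\<lambda>\<alpha>. ennreal (1 - \<alpha>) * (\<integral>\<^sup>+r\<in>{0<..}. ennreal (w r) * ennreal (r powr (- 1 - \<alpha>)) \<partial>lborel))
      \<longlongrightarrow> ennreal V) (at_left 1)" (is "(?I \<longlongrightarrow> _) _")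
proof (rule order_tendstoI)
  have ev: "\<forall>\<^sub>F \<alpha> in at_left (1::real). 0 < \<alpha> \<and> \<alpha> < 1"
    using eventually_at_left_real[of 0 1] by (auto elim: eventually_mono)
  fix x assume x: "ennreal V < x"
  have "((\<lambda>\<alpha>. V + K * ((1 - \<alpha>) / \<alpha>)) \<longlongrightarrow> V + K * ((1 - 1) / 1)) (at_left 1)"
    by (intro tendsto_intros) auto
  then have "((\<lambda>\<alpha>. ennreal (V + K * ((1 - \<alpha>) / \<alpha>))) \<longlongrightarrow> ennreal V) (at_left 1)"
    by (intro tendsto_ennrealI) simp
  from order_tendstoD(2)[OF this x] ev
  show "\<forall>\<^sub>F \<alpha> in at_left 1. ?I \<alpha> < x"
  proof eventually_elim
    case (elim \<alpha>)
    from radial_integral_le[OF _ _ V K wV wK, of \<alpha>] elim show ?case by (auto elim: order_le_less_trans)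
  qed
next
  have ev: "\<forall>\<^sub>F \<alpha> in at_left (1::real). 0 < \<alpha> \<and> \<alpha> < 1"
    using eventually_at_left_real[of 0 1] by (auto elim: eventually_mono)
  fix x assume x: "x < ennreal V"
  then obtain b where b: "x = ennreal b" "0 \<le> b" by (cases x) auto
  then have bV: "b < V" using x by (simp add: ennreal_less_iff)
  \<comment> \<open>The midpoint leaves room on both sides: \<open>a < V\<close> gives the bound
    near 0, and \<open>b < a\<close> absorbs the factor (\<delta>/2)^(1-\<alpha>) before it reaches
    1.\<close>
  define a where "a = (b + V) / 2"
  have a: "0 \<le> a" "b < a" "a < V" using b bV V by (auto simp: a_def)
  obtain \<delta> where \<delta>: "\<delta> > 0" "\<And>r. 0 < r \<Longrightarrow> r < \<delta> \<Longrightarrow> a < w r / r"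
    using order_tendstoD(1)[OF lim a(3)] unfolding eventually_at_right_field by auto
  \<comment> \<open>The bound on \<open>w r / r\<close> holds for r strictly below \<delta>, whereas
    the power integral is over a half-closed interval, hence \<delta>/2.\<close>
  have low: "ennreal (a * (\<delta>/2) powr (1 - \<alpha>)) \<le> ?I \<alpha>" if \<alpha>: "0 < \<alpha>" "\<alpha> < 1" for \<alpha>
  proof -
    have "ennreal (a * (\<delta>/2) powr (1 - \<alpha>)) = ennreal (1 - \<alpha>) * (ennreal a * ennreal ((\<delta>/2) powr (1 - \<alpha>) / (1 - \<alpha>)))"
      using \<alpha> a by (simp add: ennreal_mult[symmetric] ennreal_mult'[symmetric])
    also have "ennreal a * ennreal ((\<delta>/2) powr (1 - \<alpha>) / (1 - \<alpha>)) =
        (\<integral>\<^sup>+r. ennreal a * (ennreal (r powr - \<alpha>) * indicator {0<..\<delta>/2} r) \<partial>lborel)"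
      using \<delta> \<alpha> by (subst nn_integral_cmult) (auto simp: nn_integral_powr_from_0)
    also have "\<dots> \<le> (\<integral>\<^sup>+r\<in>{0<..}. ennreal (w r) * ennreal (r powr (- 1 - \<alpha>)) \<partial>lborel)"
    proof (intro nn_integral_mono)
      fix r :: real
      show "ennreal a * (ennreal (r powr - \<alpha>) * indicator {0<..\<delta>/2} r) \<le>
          ennreal (w r) * ennreal (r powr (- 1 - \<alpha>)) * indicator {0<..} r"
      proof (cases "0 < r \<and> r \<le> \<delta> / 2")
        case True
        have "r * r powr (- 1 - \<alpha>) = r powr - \<alpha>" using True by (simp add: powr_mult_base)
        then have "a * r powr - \<alpha> = (a * r) * r powr (- 1 - \<alpha>)" by (simp add: mult_ac)
        also have "\<dots> \<le> w r * r powr (- 1 - \<alpha>)"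
          using \<delta>(2)[of r] True \<delta>(1) by (intro mult_right_mono) (auto simp: less_divide_eq)
        finally show ?thesis
          using True a w0[of r] by (simp add: ennreal_mult[symmetric] ennreal_leI)
      qed auto
    qed
    finally show ?thesis by (simp add: mult_left_mono)
  qed
  have "((\<lambda>\<alpha>. a * (\<delta>/2) powr (1 - \<alpha>)) \<longlongrightarrow> a * (\<delta>/2) powr (1 - 1)) (at_left 1)"
    using \<delta>(1) by (intro tendsto_intros) auto
  then have "((\<lambda>\<alpha>. a * (\<delta>/2) powr (1 - \<alpha>)) \<longlongrightarrow> a) (at_left 1)" using \<delta>(1) by simp
  from order_tendstoD(1)[OF this a(2)] ev
  show "\<forall>\<^sub>F \<alpha> in at_left 1. x < ?I \<alpha>"
  proof eventually_elim
    case (elim \<alpha>)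
    have "x < ennreal (a * (\<delta>/2) powr (1 - \<alpha>))" using elim b by (simp add: ennreal_less_iff)
    also have "\<dots> \<le> ?I \<alpha>" using elim by (intro low) auto
    finally show ?case .
  qed
qed

text \<open>The exchange takes place in polar coordinates, where every factor is \<eta> or a
  Lebesgue measure, so Tonelli applies without discussing \<sigma>-finiteness of the stable measure.
  The general \<open>h\<close> covers both the energy and the perimeter.\<close>

lemma nn_integral_stable_measure_swap:
  fixes \<eta> :: "'a::euclidean_space measure" and h :: "'a \<Rightarrow> 'a \<Rightarrow> ennreal"
  assumes p: "prob_space \<eta>" and \<eta>: "sets \<eta> = sets sphere_borel"
    and h[measurable]: "(\<lambda>(x, y). h x y) \<in> borel_measurable (borel \<Otimes>\<^sub>M borel)"
  shows "(\<integral>\<^sup>+y. (\<integral>\<^sup>+x. h x y \<partial>stable_measure \<eta> \<alpha>) \<partial>lborel) =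
    (\<integral>\<^sup>+\<theta>. (\<integral>\<^sup>+r\<in>{0<..}. (\<integral>\<^sup>+y. h (r *\<^sub>R \<theta>) y \<partial>lborel) * ennreal (r powr (- 1 - \<alpha>)) \<partial>lborel) \<partial>\<eta>)"
proof -
  interpret prob_space \<eta> by fact
  interpret P1: pair_sigma_finite \<eta> "lborel :: 'a measure" ..
  note [measurable] = measurable_ident_sphere[OF \<eta>]
  define F :: "'a \<Rightarrow> 'a \<Rightarrow> real \<Rightarrow> ennreal" where
    "F y \<theta> r = h (r *\<^sub>R \<theta>) y * ennreal (r powr (- 1 - \<alpha>)) * indicator {0<..} r" for y \<theta> r
  have "(\<integral>\<^sup>+y. (\<integral>\<^sup>+x. h x y \<partial>stable_measure \<eta> \<alpha>) \<partial>lborel) =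
      (\<integral>\<^sup>+y. (\<integral>\<^sup>+\<theta>. (\<integral>\<^sup>+r. F y \<theta> r \<partial>lborel) \<partial>\<eta>) \<partial>lborel)"
    unfolding F_def by (subst nn_integral_stable_measure[OF \<eta>]) auto
  also have "\<dots> = (\<integral>\<^sup>+\<theta>. (\<integral>\<^sup>+y. (\<integral>\<^sup>+r. F y \<theta> r \<partial>lborel) \<partial>lborel) \<partial>\<eta>)"
    unfolding F_def by (intro P1.Fubini') measurable
  also have "\<dots> = (\<integral>\<^sup>+\<theta>. (\<integral>\<^sup>+r. (\<integral>\<^sup>+y. F y \<theta> r \<partial>lborel) \<partial>lborel) \<partial>\<eta>)"
    unfolding F_def by (intro nn_integral_cong lborel_pair.Fubini') measurable
  also have "\<dots> = (\<integral>\<^sup>+\<theta>. (\<integral>\<^sup>+r\<in>{0<..}. (\<integral>\<^sup>+y. h (r *\<^sub>R \<theta>) y \<partial>lborel) * ennreal (r powr (- 1 - \<alpha>)) \<partial>lborel) \<partial>\<eta>)"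
    unfolding F_def by (simp add: nn_integral_multc)
  finally show ?thesis .
qed

lemma nonlocal_energy_stable_measure:
  fixes \<eta> :: "'a::euclidean_space measure"
  assumes p: "prob_space \<eta>" and \<eta>: "sets \<eta> = sets sphere_borel" and f: "integrable lborel f"
  shows "nonlocal_energy (stable_measure \<eta> \<alpha>) f =
    1 / 2 * (\<integral>\<^sup>+\<theta>. (\<integral>\<^sup>+r\<in>{0<..}. ennreal (\<integral>y. \<bar>f (y + r *\<^sub>R \<theta>) - f y\<bar> \<partial>lborel) * ennreal (r powr (- 1 - \<alpha>)) \<partial>lborel) \<partial>\<eta>)"
proof -
  have fm[measurable]: "f \<in> borel_measurable borel" using f by simp
  have "(\<integral>\<^sup>+y. ennreal \<bar>f (z + y) - f y\<bar> \<partial>lborel) = ennreal (\<integral>y. \<bar>f (y + z) - f y\<bar> \<partial>lborel)" for z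
    unfolding add.commute[of z] using f lborel_translate(2)[OF fm] by (intro nn_integral_eq_integral) auto
  then show ?thesis
    unfolding nonlocal_energy_def by (subst nn_integral_stable_measure_swap[OF p \<eta>]) auto
qed

lemma nonlocal_energy_tendsto:
  fixes \<eta> :: "'a::euclidean_space measure"
  assumes p: "prob_space \<eta>" and \<eta>: "sets \<eta> = sets sphere_borel" and f: "f \<in> BV"
  shows "((\<lambda>\<alpha>. ennreal (1 - \<alpha>) * nonlocal_energy (stable_measure \<eta> \<alpha>) f) \<longlongrightarrow>
             1 / 2 * (\<integral>\<^sup>+\<theta>. variation (\<lambda>A. grad f A \<bullet> \<theta>) UNIV \<partial>\<eta>)) (at_left 1)"
proof -
  interpret prob_space \<eta> by fact
  have fi: "integrable lborel f" using f by (simp add: BV_def)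
  note [measurable] = borel_measurable_integrable[OF fi] measurable_ident_sphere[OF \<eta>]
  have fm: "f \<in> borel_measurable borel" by simp
  obtain M :: "'a measure" and G where M: "finite_measure M" "sets M = sets borel" and G: "integrable M G"
    and "variation (grad f) UNIV = (\<integral>\<^sup>+x. ennreal (norm (G x)) \<partial>M)"
    and vv: "\<And>v. variation (\<lambda>A. grad f A \<bullet> v) UNIV = (\<integral>\<^sup>+x. ennreal \<bar>G x \<bullet> v\<bar> \<partial>M)"
    and parts: "\<And>\<phi> v. \<phi> \<in> test_functions \<Longrightarrow>
      (\<integral>x. f x * frechet_derivative \<phi> (at x) v \<partial>lborel) = - (\<integral>x. \<phi> x * (G x \<bullet> v) \<partial>M)"
    by (rule BV_representation[OF f]) (rule that)
  interpret M: finite_measure M by fact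
  define V where "V \<theta> = (\<integral>x. \<bar>G x \<bullet> \<theta>\<bar> \<partial>M)" for \<theta>
  define \<omega> where "\<omega> \<theta> r = (\<integral>y. \<bar>f (y + r *\<^sub>R \<theta>) - f y\<bar> \<partial>lborel)" for \<theta> r
  \<comment> \<open>The triangle inequality and translation invariance bound the modulus by twice
    the L1 norm for every r.\<close>
  define K where "K = 2 * (\<integral>y. \<bar>f y\<bar> \<partial>lborel)"
  have K: "K \<ge> 0" by (simp add: K_def)
  have Vv: "variation (\<lambda>A. grad f A \<bullet> \<theta>) UNIV = ennreal (V \<theta>)" for \<theta>
    unfolding vv V_def using G by (intro nn_integral_eq_integral) auto
  have V0: "V \<theta> \<ge> 0" for \<theta> by (simp add: V_def)
  have \<omega>0: "\<omega> \<theta> r \<ge> 0" for \<theta> r by (simp add: \<omega>_def)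
  have \<omega>V: "\<omega> \<theta> r \<le> r * V \<theta>" if "r > 0" for \<theta> r
    unfolding \<omega>_def V_def using BV_translation(1)[OF fi M(2) G parts] that by simp
  have \<omega>lim: "((\<lambda>r. \<omega> \<theta> r / r) \<longlongrightarrow> V \<theta>) (at_right 0)" for \<theta>
    unfolding \<omega>_def V_def by (rule BV_translation(2)[OF fi M(2) G parts])
  have \<omega>K: "\<omega> \<theta> r \<le> K" for \<theta> r
  proof -
    have i: "integrable lborel (\<lambda>y. f (y + r *\<^sub>R \<theta>))" using fi lborel_translate(2)[OF fm] by simp
    have "\<omega> \<theta> r \<le> (\<integral>y. \<bar>f (y + r *\<^sub>R \<theta>)\<bar> + \<bar>f y\<bar> \<partial>lborel)"
      unfolding \<omega>_def using i fi by (intro integral_mono) auto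
    also have "\<dots> = (\<integral>y. \<bar>f (y + r *\<^sub>R \<theta>)\<bar> \<partial>lborel) + (\<integral>y. \<bar>f y\<bar> \<partial>lborel)"
      using i fi by simp
    also have "(\<integral>y. \<bar>f (y + r *\<^sub>R \<theta>)\<bar> \<partial>lborel) = (\<integral>y. \<bar>f y\<bar> \<partial>lborel)"
      using lborel_translate(1)[of "\<lambda>y. \<bar>f y\<bar>" "r *\<^sub>R \<theta>"] by simp
    finally show ?thesis by (simp add: K_def)
  qed
  define V1 where "V1 = (\<integral>x. norm (G x) \<partial>M)"
  have VV1: "V \<theta> \<le> V1" if "\<theta> \<in> space \<eta>" for \<theta>
  proof -
    have "norm \<theta> = 1" using that space_sphere[OF \<eta>] by simp
    then show ?thesis
      unfolding V_def V1_def using G Cauchy_Schwarz_ineq2[of "G _" \<theta>] by (intro integral_mono) auto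
  qed
  define I where "I \<alpha> \<theta> = ennreal (1 - \<alpha>) * (\<integral>\<^sup>+r\<in>{0<..}. ennreal (\<omega> \<theta> r) * ennreal (r powr (- 1 - \<alpha>)) \<partial>lborel)" for \<alpha> \<theta>
  \<comment> \<open>Joint measurability in (\<theta>, r) is read off the nonnegative form of the
    integral over y.\<close>
  have Wm: "(\<lambda>(\<theta>, r). ennreal (\<omega> \<theta> r)) \<in> borel_measurable (\<eta> \<Otimes>\<^sub>M lborel)"
  proof -
    have "(\<lambda>p. ennreal \<bar>f (snd p + snd (fst p) *\<^sub>R fst (fst p)) - f (snd p)\<bar>) \<in> borel_measurable ((\<eta> \<Otimes>\<^sub>M lborel) \<Otimes>\<^sub>M lborel)"
      by measurable
    then have "(\<lambda>(\<theta>, r). \<integral>\<^sup>+y. ennreal \<bar>f (y + r *\<^sub>R \<theta>) - f y\<bar> \<partial>lborel) \<in> borel_measurable (\<eta> \<Otimes>\<^sub>M lborel)"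
      by measurable
    moreover have "(\<integral>\<^sup>+y. ennreal \<bar>f (y + r *\<^sub>R \<theta>) - f y\<bar> \<partial>lborel) = ennreal (\<omega> \<theta> r)" for \<theta> r
      unfolding \<omega>_def using fi lborel_translate(2)[OF fm] by (intro nn_integral_eq_integral) auto
    ultimately show ?thesis by simp
  qed
  have Im: "I \<alpha> \<in> borel_measurable \<eta>" for \<alpha>
  proof -
    have "(\<lambda>(\<theta>, r). ennreal (\<omega> \<theta> r) * ennreal (r powr (- 1 - \<alpha>)) * indicator {0<..} r) \<in> borel_measurable (\<eta> \<Otimes>\<^sub>M lborel)"
      using Wm by measurable
    from lborel.borel_measurable_nn_integral[OF this] show ?thesis unfolding I_def by measurable
  qed
  have Vm: "(\<lambda>\<theta>. ennreal (V \<theta>)) \<in> borel_measurable \<eta>"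
  proof -
    note [measurable] = borel_measurable_integrable[OF G]
    have "(\<lambda>\<theta>. \<integral>\<^sup>+x. ennreal \<bar>G x \<bullet> \<theta>\<bar> \<partial>M) \<in> borel_measurable \<eta>" by measurable
    then show ?thesis by (simp add: vv[symmetric] Vv)
  qed
  have "((\<lambda>\<alpha>. \<integral>\<^sup>+\<theta>. I \<alpha> \<theta> \<partial>\<eta>) \<longlongrightarrow> (\<integral>\<^sup>+\<theta>. ennreal (V \<theta>) \<partial>\<eta>)) (at_left 1)"
  \<comment> \<open>Dominated convergence is sequential. Staying above 1/2 keeps (1 -
    \<alpha>)/\<alpha> at most 1, so the constant V1 + K dominates for all directions at
    once.\<close>
  proof (rule tendsto_at_left_sequentially[of "1/2"])
    fix S :: "nat \<Rightarrow> real" assume S: "\<And>n. S n < 1" "\<And>n. 1/2 < S n" "S \<longlonglongrightarrow> 1"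
    have Sf: "filterlim S (at_left 1) sequentially"
      unfolding filterlim_at using S by (auto simp: less_imp_neq)
    show "(\<lambda>n. \<integral>\<^sup>+\<theta>. I (S n) \<theta> \<partial>\<eta>) \<longlonglongrightarrow> (\<integral>\<^sup>+\<theta>. ennreal (V \<theta>) \<partial>\<eta>)"
    proof (rule nn_integral_dominated_convergence[where w = "\<lambda>_. ennreal (V1 + K)"])
      show "AE \<theta> in \<eta>. (\<lambda>n. I (S n) \<theta>) \<longlonglongrightarrow> ennreal (V \<theta>)"
        unfolding I_def
        by (intro AE_I2 filterlim_compose[OF radial_integral_tendsto[OF V0 K \<omega>0 \<omega>V \<omega>K \<omega>lim] Sf])
      show "AE \<theta> in \<eta>. I (S n) \<theta> \<le> ennreal (V1 + K)" for n
      proof (rule AE_I2)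
        fix \<theta> assume \<theta>: "\<theta> \<in> space \<eta>"
        have s: "0 < S n" "S n < 1" "1 / 2 < S n" using S(1,2)[of n] by auto
        have "I (S n) \<theta> \<le> ennreal (V \<theta> + K * ((1 - S n) / S n))"
          unfolding I_def using s by (intro radial_integral_le V0 K \<omega>V \<omega>K) auto
        also have "\<dots> \<le> ennreal (V1 + K)"
        proof (intro ennreal_leI add_mono VV1 \<theta>)
          have "(1 - S n) / S n \<le> 1" using s by (simp add: divide_le_eq)
          then show "K * ((1 - S n) / S n) \<le> K" using K s by (intro mult_left_le) auto
        qed
        finally show "I (S n) \<theta> \<le> ennreal (V1 + K)" .
      qed
    qed (use Im Vm in \<open>auto simp: emeasure_space_1\<close>)
  qed simp
  \<comment> \<open>Pulling a constant factor through a limit in \<open>ennreal\<close> requires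
    that the constant be finite.\<close>
  moreover have half: "(1 / 2 :: ennreal) < \<top>"
    using divide_ennreal[of 1 2] by (metis ennreal_1 ennreal_less_top ennreal_numeral zero_less_one zero_le_one zero_less_numeral)
  ultimately have "((\<lambda>\<alpha>. 1 / 2 * (\<integral>\<^sup>+\<theta>. I \<alpha> \<theta> \<partial>\<eta>)) \<longlongrightarrow> 1 / 2 * (\<integral>\<^sup>+\<theta>. ennreal (V \<theta>) \<partial>\<eta>)) (at_left 1)"
    by (intro ennreal_tendsto_cmult) (use half in auto)
  moreover have "1 / 2 * (\<integral>\<^sup>+\<theta>. I \<alpha> \<theta> \<partial>\<eta>) = ennreal (1 - \<alpha>) * nonlocal_energy (stable_measure \<eta> \<alpha>) f" for \<alpha>
  proof -
    have "(\<lambda>(\<theta>, r). ennreal (\<omega> \<theta> r) * ennreal (r powr (- 1 - \<alpha>)) * indicator {0<..} r) \<in> borel_measurable (\<eta> \<Otimes>\<^sub>M lborel)"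
      using Wm by measurable
    from lborel.borel_measurable_nn_integral[OF this]
    have "(\<integral>\<^sup>+\<theta>. I \<alpha> \<theta> \<partial>\<eta>) = ennreal (1 - \<alpha>) * (\<integral>\<^sup>+\<theta>. (\<integral>\<^sup>+r\<in>{0<..}. ennreal (\<omega> \<theta> r) * ennreal (r powr (- 1 - \<alpha>)) \<partial>lborel) \<partial>\<eta>)"
      unfolding I_def by (subst nn_integral_cmult) auto
    then show ?thesis
      unfolding nonlocal_energy_stable_measure[OF p \<eta> fi] \<omega>_def by (simp add: mult.left_commute)
  qed
  ultimately show ?thesis by (simp add: Vv)
qed

section \<open>Rotation invariance and perimeters\<close>

lemma lborel_distr_diff: "distr lborel borel (\<lambda>y. x - y) = (lborel :: 'a::euclidean_space measure)"
  using lborel_affine[of "-1" x] by (simp add: density_1)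

text \<open>The Tonelli argument for uniqueness of Haar measure; it gives rotation invariance of \<open>lborel\<close> on an
  abstract Euclidean space.\<close>

lemma translation_invariant_measure_commute:
  fixes \<nu> :: "'a::euclidean_space measure"
  assumes "sigma_finite_measure \<nu>" and s: "sets \<nu> = sets borel"
    and inv: "\<And>c. distr \<nu> borel (\<lambda>x. x + c) = \<nu>"
    and A: "A \<in> sets borel" and B: "B \<in> sets borel"
  shows "emeasure \<nu> A * emeasure lborel B = emeasure \<nu> B * emeasure lborel A"
proof -
  interpret sigma_finite_measure \<nu> by fact
  interpret P: pair_sigma_finite \<nu> "lborel :: 'a measure" ..
  note [measurable] = A B
  note [measurable_cong] = s
  have inv_lborel: "distr lborel borel (\<lambda>y. y + x) = (lborel :: 'a measure)" for x
    using lborel_distr_plus[of x] by (subst add.commute)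
  have "emeasure \<nu> A * emeasure lborel B = (\<integral>\<^sup>+x. indicator A x * emeasure lborel B \<partial>\<nu>)"
    using A s by (subst nn_integral_multc) auto
  \<comment> \<open>This double integral is evaluated in two ways: invariance of
    \<open>lborel\<close> gives the left-hand side; shifting x by y under \<nu> and then reflecting
    y to x - y gives the right-hand side.\<close>
  also have "\<dots> = (\<integral>\<^sup>+x. (\<integral>\<^sup>+y. indicator A x * indicator B (y + x) \<partial>lborel) \<partial>\<nu>)"
  proof (intro nn_integral_cong)
    fix x
    have "emeasure lborel B = (\<integral>\<^sup>+y. indicator B y \<partial>distr lborel borel (\<lambda>y. y + x))"
      unfolding inv_lborel using B by simp
    also have "\<dots> = (\<integral>\<^sup>+y. indicator B (y + x) \<partial>lborel)"
      by (rule nn_integral_distr) measurable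
    finally show "indicator A x * emeasure lborel B = (\<integral>\<^sup>+y. indicator A x * indicator B (y + x) \<partial>lborel)"
      by (simp add: nn_integral_cmult)
  qed
  also have "\<dots> = (\<integral>\<^sup>+y. (\<integral>\<^sup>+x. indicator A x * indicator B (y + x) \<partial>\<nu>) \<partial>lborel)"
    by (intro P.Fubini'[symmetric]) measurable
  also have "\<dots> = (\<integral>\<^sup>+y. (\<integral>\<^sup>+x. indicator A (x - y) * indicator B x \<partial>\<nu>) \<partial>lborel)"
  proof (rule nn_integral_cong)
    fix y
    have "(\<integral>\<^sup>+x. indicator A (x - y) * indicator B x \<partial>\<nu>) =
        (\<integral>\<^sup>+x. indicator A (x - y) * indicator B x \<partial>distr \<nu> borel (\<lambda>x. x + y))"
      unfolding inv ..
    also have "\<dots> = (\<integral>\<^sup>+x. indicator A (x + y - y) * indicator B (x + y) \<partial>\<nu>)"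
      by (rule nn_integral_distr) measurable
    finally show "(\<integral>\<^sup>+x. indicator A x * indicator B (y + x) \<partial>\<nu>) = (\<integral>\<^sup>+x. indicator A (x - y) * indicator B x \<partial>\<nu>)"
      by (simp add: add.commute)
  qed
  also have "\<dots> = (\<integral>\<^sup>+x. (\<integral>\<^sup>+y. indicator A (x - y) * indicator B x \<partial>lborel) \<partial>\<nu>)"
    by (intro P.Fubini') measurable
  also have "\<dots> = (\<integral>\<^sup>+x. emeasure lborel A * indicator B x \<partial>\<nu>)"
  proof (intro nn_integral_cong)
    fix x
    have "emeasure lborel A = (\<integral>\<^sup>+y. indicator A y \<partial>distr lborel borel (\<lambda>y. x - y))"
      unfolding lborel_distr_diff using A by simp
    also have "\<dots> = (\<integral>\<^sup>+y. indicator A (x - y) \<partial>lborel)"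
      by (rule nn_integral_distr) measurable
    finally show "(\<integral>\<^sup>+y. indicator A (x - y) * indicator B x \<partial>lborel) = emeasure lborel A * indicator B x"
      by (simp add: nn_integral_multc)
  qed
  also have "\<dots> = emeasure \<nu> B * emeasure lborel A"
    using B s by (subst nn_integral_cmult) (auto simp: mult.commute)
  finally show ?thesis .
qed

text \<open>Since \<open>Q\<close> is its own inverse, Q x + c = Q (x + Q c), so the image measure
  is again translation invariant. It agrees with \<open>lborel\<close> on the unit ball, whose
  measure is positive and finite, and this makes the factor of proportionality 1.\<close>

lemma lborel_distr_isometric_involution:
  fixes Q :: "'a::euclidean_space \<Rightarrow> 'a"
  assumes lin: "linear Q" and invol: "\<And>x. Q (Q x) = x" and norm: "\<And>x. norm (Q x) = norm x"
  shows "distr lborel borel Q = lborel"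
proof -
  have Q[measurable]: "Q \<in> borel_measurable borel"
    using lin by (intro borel_measurable_continuous_onI linear_continuous_on linear_conv_bounded_linear[THEN iffD1])
  let ?\<nu> = "distr lborel borel Q"
  have vim: "Q -` ball 0 r = ball 0 r" for r by (auto simp: norm)
  have ball: "emeasure ?\<nu> (ball 0 r) = emeasure lborel (ball 0 r :: 'a set)" for r
    by (subst emeasure_distr) (auto simp: vim)
  have fin: "emeasure lborel (ball 0 r :: 'a set) < \<infinity>" for r
    by (rule emeasure_bounded_finite) simp
  have sf: "sigma_finite_measure ?\<nu>"
  proof
    show "\<exists>A. countable A \<and> A \<subseteq> sets ?\<nu> \<and> \<Union> A = space ?\<nu> \<and> (\<forall>a\<in>A. emeasure ?\<nu> a \<noteq> \<infinity>)"
    proof (intro exI[of _ "range (\<lambda>n::nat. ball (0::'a) (real n))"] conjI)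
      show "\<Union> (range (\<lambda>n::nat. ball (0::'a) (real n))) = space ?\<nu>"
        using reals_Archimedean2 by auto
      show "\<forall>a\<in>range (\<lambda>n::nat. ball (0::'a) (real n)). emeasure ?\<nu> a \<noteq> \<infinity>"
        using fin by (auto simp: ball less_top[symmetric])
    qed auto
  qed
  have inv: "distr ?\<nu> borel (\<lambda>x. x + c) = ?\<nu>" for c
  proof -
    have "distr ?\<nu> borel (\<lambda>x. x + c) = distr (distr lborel borel (\<lambda>x. x + Q c)) borel Q"
      by (simp add: distr_distr o_def linear_add[OF lin] invol)
    also have "distr lborel borel (\<lambda>x. x + Q c) = (lborel :: 'a measure)"
      using lborel_distr_plus[of "Q c"] by (subst add.commute)
    finally show ?thesis .
  qed
  show ?thesis
  proof (rule measure_eqI)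
    fix A assume "A \<in> sets ?\<nu>"
    then have A: "A \<in> sets borel" by simp
    let ?b = "emeasure lborel (ball 0 1 :: 'a set)"
    have "emeasure ?\<nu> A * ?b = emeasure lborel A * ?b"
      using translation_invariant_measure_commute[OF sf _ inv A, of "ball 0 1"] by (simp add: ball mult.commute)
    moreover have "?b \<noteq> \<infinity>" using fin[of 1] by simp
    moreover have "?b \<noteq> 0"
    proof
      assume "?b = 0"
      then have "ball (0::'a) 1 \<in> null_sets lborel" by auto
      then have "ball (0::'a) 1 = {}"
        by (meson null_sets_completionI open_ball negligible_iff_null_sets open_not_negligible)
      then show False by simp
    qed
    ultimately show "emeasure ?\<nu> A = emeasure lborel A"
      by (metis ennreal_mult_divide_eq infinity_ennreal_def)
  qed simp
qed

text \<open>The reflection in the hyperplane orthogonal to \<open>v\<close>; for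
  \<open>v = 0\<close> the quotient is 0 and the map is the identity.\<close>

definition reflect :: "'a::euclidean_space \<Rightarrow> 'a \<Rightarrow> 'a" where
  "reflect v x = x - (2 * (v \<bullet> x) / (v \<bullet> v)) *\<^sub>R v"

lemma reflect_isometric_involution:
  shows "linear (reflect v)" and "reflect v (reflect v x) = x"
    and "y \<bullet> reflect v x = reflect v y \<bullet> x" and "norm (reflect v x) = norm x"
proof -
  show "linear (reflect v)"
    by (rule linearI) (auto simp: reflect_def inner_add_right algebra_simps add_divide_distrib)
  show inv: "reflect v (reflect v x) = x" for x
    by (cases "v = 0") (auto simp: reflect_def inner_diff_right scaleR_left_distrib[symmetric] algebra_simps)
  show sa: "y \<bullet> reflect v x = reflect v y \<bullet> x" for x y
    by (simp add: reflect_def inner_diff_right inner_diff_left inner_commute mult_ac)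
  show "norm (reflect v x) = norm x"
    using sa[of "reflect v x" x] inv by (simp add: norm_eq_sqrt_inner)
qed

text \<open>Equal norms give 2 (e - e') \<bullet> e = |e - e'|^2. Hence a single reflection already
  carries one unit vector to any other, and general rotations can be avoided.\<close>

lemma reflect_swaps:
  assumes "norm e = norm e'"
  shows "reflect (e - e') e = e'"
proof (cases "e = e'")
  case False
  have "e \<bullet> e = e' \<bullet> e'" using assms by (simp add: norm_eq)
  then have "2 * ((e - e') \<bullet> e) = (e - e') \<bullet> (e - e')"
    by (simp add: inner_diff_left inner_diff_right inner_commute)
  then show ?thesis using False by (simp add: reflect_def)
qed (simp add: reflect_def)

text \<open>The cone definition says that surface measure is the image of d times Lebesgue measure
  on the punctured unit ball under x \<mapsto> x/|x|. Symmetries of \<open>lborel\<close> thereby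
  pass to the sphere.\<close>

lemma nn_integral_surface_measure:
  fixes h :: "'a::euclidean_space \<Rightarrow> ennreal"
  assumes [measurable]: "h \<in> borel_measurable borel"
  shows "(\<integral>\<^sup>+\<theta>. h \<theta> \<partial>surface_measure) =
    (\<integral>\<^sup>+x. of_nat DIM('a) * indicator (cball 0 1 - {0}) x * h (x /\<^sub>R norm x) \<partial>lborel)"
proof -
  let ?k = "\<lambda>x::'a. of_nat DIM('a) * indicator (cball 0 1 - {0}) x :: ennreal"
  note m[measurable] = measurable_ident_sphere[OF sets_surface_measure]
  have [measurable]: "cball 0 1 - {0} \<in> sets (borel :: 'a measure)" by auto
  have eq: "distr surface_measure borel (\<lambda>x. x) = distr (density lborel ?k) borel (\<lambda>x::'a. x /\<^sub>R norm x)"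
  proof (rule measure_eqI)
    fix A :: "'a set" assume "A \<in> sets (distr surface_measure borel (\<lambda>x. x))"
    then have A[measurable]: "A \<in> sets borel" by simp
    let ?S = "A \<inter> unit_sphere"
    have S: "?S \<in> sets sphere_borel" using A by (auto simp: sets_restrict_space)
    have ind: "indicator {r *\<^sub>R e |r e. 0 < r \<and> r \<le> 1 \<and> e \<in> ?S} x =
        (indicator (cball 0 1 - {0}) x * indicator A (x /\<^sub>R norm x) :: ennreal)" for x
    proof -
      have "x \<in> {r *\<^sub>R e |r e. 0 < r \<and> r \<le> 1 \<and> e \<in> ?S} \<longleftrightarrow> x \<in> cball 0 1 - {0} \<and> x /\<^sub>R norm x \<in> A"
      proof
        assume "x \<in> cball 0 1 - {0} \<and> x /\<^sub>R norm x \<in> A"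
        then show "x \<in> {r *\<^sub>R e |r e. 0 < r \<and> r \<le> 1 \<and> e \<in> ?S}"
          unfolding mem_Collect_eq
          by (intro exI[of _ "norm x"] exI[of _ "x /\<^sub>R norm x"]) auto
      qed auto
      then show ?thesis by (auto simp: indicator_def)
    qed
    have "emeasure (distr surface_measure borel (\<lambda>x. x)) A = emeasure surface_measure ?S"
      by (subst emeasure_distr) (auto simp: space_sphere[OF sets_surface_measure])
    also have "\<dots> = of_nat DIM('a) * (\<integral>\<^sup>+x. indicator {r *\<^sub>R e |r e. 0 < r \<and> r \<le> 1 \<and> e \<in> ?S} x \<partial>lborel)"
      using cone_sets(2)[OF S] by (simp add: emeasure_surface_measure[OF S])
    also have "\<dots> = (\<integral>\<^sup>+x. ?k x * indicator A (x /\<^sub>R norm x) \<partial>lborel)"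
      unfolding ind by (subst nn_integral_cmult[symmetric]) (auto simp: mult.assoc)
    also have "\<dots> = (\<integral>\<^sup>+x. indicator A x \<partial>distr (density lborel ?k) borel (\<lambda>x::'a. x /\<^sub>R norm x))"
      by (subst nn_integral_distr) (auto simp: nn_integral_density)
    also have "\<dots> = emeasure (distr (density lborel ?k) borel (\<lambda>x::'a. x /\<^sub>R norm x)) A" by simp
    finally show "emeasure (distr surface_measure borel (\<lambda>x. x)) A =
      emeasure (distr (density lborel ?k) borel (\<lambda>x::'a. x /\<^sub>R norm x)) A" .
  qed simp
  have "(\<integral>\<^sup>+\<theta>. h \<theta> \<partial>surface_measure) = (\<integral>\<^sup>+\<theta>. h \<theta> \<partial>distr surface_measure borel (\<lambda>x. x))"
    by (subst nn_integral_distr) auto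
  also have "\<dots> = (\<integral>\<^sup>+x. ?k x * h (x /\<^sub>R norm x) \<partial>lborel)"
    unfolding eq by (subst nn_integral_distr) (auto simp: nn_integral_density)
  finally show ?thesis .
qed

text \<open>The reflection exchanging the two vectors preserves \<open>lborel\<close> and the
  punctured ball and commutes with radial projection; being self-adjoint, it can be moved from x
  onto \<open>e\<close>.\<close>

lemma K1_eq_if_norm_eq:
  fixes e e' :: "'a::euclidean_space"
  assumes "norm e = norm e'"
  shows "K1 e = K1 e'"
proof -
  let ?Q = "reflect (e - e')"
  have Q[measurable]: "?Q \<in> borel_measurable borel"
    using reflect_isometric_involution(1) by (intro borel_measurable_continuous_onI linear_continuous_on linear_conv_bounded_linear[THEN iffD1])
  have d: "distr lborel borel ?Q = (lborel :: 'a measure)"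
    by (intro lborel_distr_isometric_involution reflect_isometric_involution)
  let ?k = "\<lambda>x::'a. of_nat DIM('a) * indicator (cball 0 1 - {0}) x :: ennreal"
  have [measurable]: "cball 0 1 - {0} \<in> sets (borel :: 'a measure)" by auto
  have F: "(\<lambda>x. ?k x * ennreal \<bar>e \<bullet> (x /\<^sub>R norm x)\<bar>) \<in> borel_measurable borel" by measurable
  have K: "K1 u = (\<integral>\<^sup>+x. ?k x * ennreal \<bar>u \<bullet> (x /\<^sub>R norm x)\<bar> \<partial>lborel)" for u :: 'a
    unfolding K1_def by (rule nn_integral_surface_measure) measurable
  have "K1 e = (\<integral>\<^sup>+x. ?k x * ennreal \<bar>e \<bullet> (x /\<^sub>R norm x)\<bar> \<partial>distr lborel borel ?Q)"
    unfolding d K ..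
  also have "\<dots> = (\<integral>\<^sup>+x. ?k (?Q x) * ennreal \<bar>e \<bullet> (?Q x /\<^sub>R norm (?Q x))\<bar> \<partial>lborel)"
    using F by (intro nn_integral_distr) auto
  also have "\<dots> = (\<integral>\<^sup>+x. ?k x * ennreal \<bar>e' \<bullet> (x /\<^sub>R norm x)\<bar> \<partial>lborel)"
  proof (intro nn_integral_cong)
    fix x :: 'a
    have "?Q x = 0 \<longleftrightarrow> x = 0" using reflect_isometric_involution(4)[of "e - e'" x] by (metis norm_eq_zero)
    then have "?k (?Q x) = ?k x" by (auto simp: indicator_def reflect_isometric_involution(4))
    moreover have "e \<bullet> (?Q x /\<^sub>R norm (?Q x)) = e' \<bullet> (x /\<^sub>R norm x)"
      by (simp add: reflect_isometric_involution(3,4) reflect_swaps[OF assms])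
    ultimately show "?k (?Q x) * ennreal \<bar>e \<bullet> (?Q x /\<^sub>R norm (?Q x))\<bar> = ?k x * ennreal \<bar>e' \<bullet> (x /\<^sub>R norm x)\<bar>"
      by simp
  qed
  finally show ?thesis unfolding K .
qed

lemma sphere_area_finite: "sphere_area TYPE('a::euclidean_space) < \<infinity>"
proof -
  have S: "(unit_sphere :: 'a set) \<in> sets sphere_borel" by (auto simp: sets_restrict_space)
  have "emeasure lborel {r *\<^sub>R e |r (e::'a). 0 < r \<and> r \<le> 1 \<and> e \<in> unit_sphere} < \<infinity>"
    by (intro emeasure_bounded_finite) (auto intro!: boundedI[of _ 1])
  then show ?thesis
    unfolding sphere_area_def emeasure_surface_measure[OF S] by (simp add: ennreal_mult_less_top of_nat_less_top)
qed

text \<open>By homogeneity the norm of x factors out, and what remains is \<open>K1\<close> of a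
  unit vector. This is the origin of the quotient of \<open>K1\<close> by the sphere area.\<close>

lemma nn_integral_inner_uniform_sphere:
  fixes x e :: "'a::euclidean_space"
  assumes e: "norm e = 1"
  shows "(\<integral>\<^sup>+\<theta>. ennreal \<bar>x \<bullet> \<theta>\<bar> \<partial>uniform_sphere) = K1 e / sphere_area TYPE('a) * ennreal (norm x)"
proof -
  note m[measurable] = measurable_ident_sphere[OF sets_surface_measure]
  have S: "(unit_sphere :: 'a set) \<in> sets surface_measure"
    unfolding sets_surface_measure by (auto simp: sets_restrict_space)
  have "(\<integral>\<^sup>+\<theta>. ennreal \<bar>x \<bullet> \<theta>\<bar> \<partial>uniform_sphere) = (\<integral>\<^sup>+\<theta>. ennreal \<bar>x \<bullet> \<theta>\<bar> * indicator unit_sphere \<theta> \<partial>surface_measure) / sphere_area TYPE('a)"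
    unfolding uniform_sphere_def sphere_area_def by (rule nn_integral_uniform_measure[OF _ S]) measurable
  also have "(\<integral>\<^sup>+\<theta>. ennreal \<bar>x \<bullet> \<theta>\<bar> * indicator unit_sphere \<theta> \<partial>surface_measure) = (\<integral>\<^sup>+\<theta>. ennreal \<bar>x \<bullet> \<theta>\<bar> \<partial>surface_measure)"
    by (intro nn_integral_cong) (simp add: space_sphere[OF sets_surface_measure])
  also have "\<dots> = K1 e * ennreal (norm x)"
  proof (cases "x = 0")
    case False
    have "(\<integral>\<^sup>+\<theta>. ennreal \<bar>x \<bullet> \<theta>\<bar> \<partial>surface_measure) = (\<integral>\<^sup>+\<theta>. ennreal \<bar>(x /\<^sub>R norm x) \<bullet> \<theta>\<bar> * ennreal (norm x) \<partial>surface_measure)"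
      using False by (intro nn_integral_cong) (simp add: ennreal_mult[symmetric] abs_mult)
    also have "\<dots> = K1 (x /\<^sub>R norm x) * ennreal (norm x)"
      unfolding K1_def by (rule nn_integral_multc) measurable
    also have "K1 (x /\<^sub>R norm x) = K1 e"
      using False e by (intro K1_eq_if_norm_eq) simp
    finally show ?thesis .
  qed simp
  finally show ?thesis by (simp add: divide_ennreal_def mult_ac)
qed

text \<open>The modulus of the difference of indicators separates into the volume leaving
  \<open>E\<close> and the volume entering it under a shift. Their equality for each shift turns the
  energy into twice the perimeter integral, and the factor 1/2 cancels.\<close>

lemma nonlocal_perimeter_eq_energy:
  fixes \<eta> :: "'a::euclidean_space measure"
  assumes p: "prob_space \<eta>" and \<eta>: "sets \<eta> = sets sphere_borel"
    and E[measurable]: "E \<in> sets borel" and fin: "emeasure lborel E < \<infinity>"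
  shows "nonlocal_perimeter (stable_measure \<eta> \<alpha>) E = nonlocal_energy (stable_measure \<eta> \<alpha>) (indicator E)"
proof -
  interpret prob_space \<eta> by fact
  note [measurable] = measurable_ident_sphere[OF \<eta>]
  let ?h = "\<lambda>x y. indicator E y * indicator (- E) (x + y) :: ennreal"
  have exit: "(\<integral>\<^sup>+y. ennreal \<bar>indicator E (x + y) - indicator E y\<bar> \<partial>lborel) = 2 * (\<integral>\<^sup>+y. ?h x y \<partial>lborel)" for x
  proof -
    have d: "distr lborel borel (\<lambda>y. x + y) = (lborel :: 'a measure)" by (rule lborel_distr_plus)
    let ?c = "\<integral>\<^sup>+y. indicator E y * indicator E (x + y) \<partial>lborel :: ennreal"
    let ?g = "\<lambda>y. indicator (- E) y * indicator E (x + y) :: ennreal"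
    have "(\<integral>\<^sup>+y. ?h x y \<partial>lborel) + ?c = (\<integral>\<^sup>+y. ?h x y + indicator E y * indicator E (x + y) \<partial>lborel)"
      by (rule nn_integral_add[symmetric]) measurable
    also have "\<dots> = (\<integral>\<^sup>+y. indicator E y \<partial>lborel)"
      by (rule nn_integral_cong) (simp add: indicator_def)
    also have "\<dots> = (\<integral>\<^sup>+y. indicator E y \<partial>distr lborel borel (\<lambda>y. x + y))" unfolding d ..
    also have "\<dots> = (\<integral>\<^sup>+y. indicator E (x + y) \<partial>lborel)"
      using E by (intro nn_integral_distr) auto
    also have "\<dots> = (\<integral>\<^sup>+y. ?g y + indicator E y * indicator E (x + y) \<partial>lborel)"
      by (rule nn_integral_cong) (simp add: indicator_def)
    also have "\<dots> = (\<integral>\<^sup>+y. ?g y \<partial>lborel) + ?c"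
      by (rule nn_integral_add) measurable
    finally have "(\<integral>\<^sup>+y. ?h x y \<partial>lborel) + ?c = (\<integral>\<^sup>+y. ?g y \<partial>lborel) + ?c" .
    \<comment> \<open>Finite volume of \<open>E\<close> enters here: the common part can be
      cancelled in \<open>ennreal\<close> only if it is finite.\<close>
    moreover have "?c \<noteq> \<infinity>"
    proof -
      have "?c \<le> (\<integral>\<^sup>+y. indicator E y \<partial>lborel)" by (intro nn_integral_mono) (auto simp: indicator_def)
      then show ?thesis using fin by (auto simp: top_unique)
    qed
    ultimately have eq: "(\<integral>\<^sup>+y. ?g y \<partial>lborel) = (\<integral>\<^sup>+y. ?h x y \<partial>lborel)"
      using ennreal_add_left_cancel[of ?c] by (simp add: add.commute[of _ ?c])
    have "(\<integral>\<^sup>+y. ennreal \<bar>indicator E (x + y) - indicator E y\<bar> \<partial>lborel) = (\<integral>\<^sup>+y. ?h x y + ?g y \<partial>lborel)"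
      by (intro nn_integral_cong) (auto simp: indicator_def)
    also have "\<dots> = (\<integral>\<^sup>+y. ?h x y \<partial>lborel) + (\<integral>\<^sup>+y. ?g y \<partial>lborel)" by (rule nn_integral_add) measurable
    finally show ?thesis by (simp add: eq mult_2)
  qed
  have per: "nonlocal_perimeter (stable_measure \<eta> \<alpha>) E = (\<integral>\<^sup>+y. (\<integral>\<^sup>+x. ?h x y \<partial>stable_measure \<eta> \<alpha>) \<partial>lborel)"
    unfolding nonlocal_perimeter_def
  proof (intro nn_integral_cong)
    fix y
    have eq: "(\<lambda>z. z - y) ` (- E) = {z. z + y \<in> - E}" by (force simp: image_iff)
    have m: "{z. z + y \<in> - E} \<in> sets (stable_measure \<eta> \<alpha>)"
      unfolding sets_stable_measure by measurable
    have "(\<integral>\<^sup>+x. ?h x y \<partial>stable_measure \<eta> \<alpha>) = (\<integral>\<^sup>+x. indicator E y * indicator {z. z + y \<in> - E} x \<partial>stable_measure \<eta> \<alpha>)"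
      by (intro nn_integral_cong) (auto simp: indicator_def)
    also have "\<dots> = indicator E y * emeasure (stable_measure \<eta> \<alpha>) {z. z + y \<in> - E}"
      using m by (rule nn_integral_cmult_indicator)
    finally show "emeasure (stable_measure \<eta> \<alpha>) ((\<lambda>z. z - y) ` (- E)) * indicator E y = (\<integral>\<^sup>+x. ?h x y \<partial>stable_measure \<eta> \<alpha>)"
      unfolding eq by (simp add: mult.commute)
  qed
  let ?R = "\<integral>\<^sup>+\<theta>. (\<integral>\<^sup>+r\<in>{0<..}. (\<integral>\<^sup>+y. ?h (r *\<^sub>R \<theta>) y \<partial>lborel) * ennreal (r powr (- 1 - \<alpha>)) \<partial>lborel) \<partial>\<eta>"
  have P: "nonlocal_perimeter (stable_measure \<eta> \<alpha>) E = ?R"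
    unfolding per by (rule nn_integral_stable_measure_swap[OF p \<eta>]) measurable
  have "nonlocal_energy (stable_measure \<eta> \<alpha>) (indicator E) =
      1 / 2 * (\<integral>\<^sup>+\<theta>. (\<integral>\<^sup>+r\<in>{0<..}. (2 * (\<integral>\<^sup>+y. ?h (r *\<^sub>R \<theta>) y \<partial>lborel)) * ennreal (r powr (- 1 - \<alpha>)) \<partial>lborel) \<partial>\<eta>)"
    unfolding nonlocal_energy_def exit[symmetric]
    by (subst nn_integral_stable_measure_swap[OF p \<eta>]) auto
  also have "\<dots> = 1 / 2 * (\<integral>\<^sup>+\<theta>. 2 * (\<integral>\<^sup>+r\<in>{0<..}. (\<integral>\<^sup>+y. ?h (r *\<^sub>R \<theta>) y \<partial>lborel) * ennreal (r powr (- 1 - \<alpha>)) \<partial>lborel) \<partial>\<eta>)"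
    unfolding mult.assoc[of 2] by (subst nn_integral_cmult) auto
  also have "\<dots> = 1 / 2 * (2 * ?R)"
    by (subst nn_integral_cmult) auto
  also have "\<dots> = (1 / 2 * 2) * ?R" by (simp only: mult.assoc)
  also have "1 / 2 * 2 = (1 :: ennreal)"
    unfolding mult.commute[of _ "2 :: ennreal"] ennreal_times_divide by (simp add: ennreal_divide_self)
  finally show ?thesis using P by simp
qed

text \<open>After exchanging the integrals over \<theta> and x, the mean of |G x \<bullet> \<theta>|
  is a fixed multiple of |G x|, so the anisotropic variation collapses to the perimeter.\<close>

lemma nonlocal_perimeter_tendsto:
  fixes E :: "'a::euclidean_space set" and e :: 'a
  assumes p: "prob_space (uniform_sphere :: 'a measure)"
    and E[measurable]: "E \<in> sets borel" and fin: "emeasure lborel E < \<infinity>" and per: "perimeter E < \<infinity>"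
    and e: "norm e = 1"
  shows "((\<lambda>\<alpha>. ennreal (1 - \<alpha>) * nonlocal_perimeter (stable_measure uniform_sphere \<alpha>) E) \<longlongrightarrow>
               K1 e / (2 * sphere_area TYPE('a)) * perimeter E) (at_left 1)"
proof -
  let ?\<eta> = "uniform_sphere :: 'a measure"
  have \<eta>: "sets ?\<eta> = sets sphere_borel"
    by (simp add: uniform_sphere_def sets_surface_measure)
  interpret prob_space ?\<eta> by fact
  \<comment> \<open>\<open>perimeter\<close> is infinite by definition off \<open>BV\<close>, so
    finiteness is what provides membership.\<close>
  have BV: "(indicator E :: 'a \<Rightarrow> real) \<in> BV" using per by (auto simp: perimeter_def split: if_splits)
  let ?g = "grad (indicator E :: 'a \<Rightarrow> real)"
  obtain M :: "'a measure" and G where M: "finite_measure M" "sets M = sets borel" and G: "integrable M G"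
    and v: "variation ?g UNIV = (\<integral>\<^sup>+x. ennreal (norm (G x)) \<partial>M)"
    and vv: "\<And>v. variation (\<lambda>A. ?g A \<bullet> v) UNIV = (\<integral>\<^sup>+x. ennreal \<bar>G x \<bullet> v\<bar> \<partial>M)"
    and "\<And>\<phi> v. \<phi> \<in> test_functions \<Longrightarrow>
      (\<integral>x. indicator E x * frechet_derivative \<phi> (at x) v \<partial>lborel) = - (\<integral>x. \<phi> x * (G x \<bullet> v) \<partial>M)"
    by (rule BV_representation[OF BV]) (rule that)
  interpret M: finite_measure M by fact
  interpret P: pair_sigma_finite M ?\<eta> ..
  note [measurable] = borel_measurable_integrable[OF G] measurable_ident_sphere[OF \<eta>]
  let ?c = "K1 e / sphere_area TYPE('a)"
  have "(\<integral>\<^sup>+\<theta>. variation (\<lambda>A. ?g A \<bullet> \<theta>) UNIV \<partial>?\<eta>) = (\<integral>\<^sup>+x. (\<integral>\<^sup>+\<theta>. ennreal \<bar>G x \<bullet> \<theta>\<bar> \<partial>?\<eta>) \<partial>M)"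
    unfolding vv by (rule P.Fubini') measurable
  also have "\<dots> = ?c * variation ?g UNIV"
    unfolding nn_integral_inner_uniform_sphere[OF e] v by (rule nn_integral_cmult) measurable
  also have "\<dots> = ?c * perimeter E"
    using BV by (simp add: perimeter_def)
  \<comment> \<open>Splitting the inverse of twice the sphere area in \<open>ennreal\<close> uses
    that the area is finite.\<close>
  finally have "1 / 2 * (\<integral>\<^sup>+\<theta>. variation (\<lambda>A. ?g A \<bullet> \<theta>) UNIV \<partial>?\<eta>) = K1 e / (2 * sphere_area TYPE('a)) * perimeter E"
    using sphere_area_finite[where 'a='a]
    by (simp add: divide_ennreal_def ennreal_inverse_mult mult_ac)
  then show ?thesis
    using nonlocal_energy_tendsto[OF p \<eta> BV] by (simp add: nonlocal_perimeter_eq_energy[OF p \<eta> E fin])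
qed

theorem proposition3p5:
  fixes \<eta> :: "'a::euclidean_space measure"
  assumes "prob_space \<eta>" and "sets \<eta> = sets sphere_borel"
  shows
    "(\<exists>\<mu>. weak_limit_on_sphere
        (\<lambda>\<alpha>. angular_measure (normalized_measure (stable_measure \<eta> \<alpha>))) \<mu> (at_left 1)) \<and>
     (\<forall>\<mu>. weak_limit_on_sphere
        (\<lambda>\<alpha>. angular_measure (normalized_measure (stable_measure \<eta> \<alpha>))) \<mu> (at_left 1) \<longrightarrow>
        (\<forall>f\<in>BV.
          ((\<lambda>\<alpha>. ennreal (1 - \<alpha>) * nonlocal_energy (stable_measure \<eta> \<alpha>) f) \<longlongrightarrow>
             1 / 2 * (\<integral>\<^sup>+\<theta>. variation (\<lambda>A. grad f A \<bullet> \<theta>) UNIV \<partial>\<mu>)) (at_left 1))) \<and>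
     (\<eta> = uniform_sphere \<longrightarrow>
        (\<forall>E\<in>sets borel. emeasure lborel E < \<infinity> \<longrightarrow> perimeter E < \<infinity> \<longrightarrow>
          (\<forall>e::'a. norm e = 1 \<longrightarrow>
            ((\<lambda>\<alpha>. ennreal (1 - \<alpha>) * nonlocal_perimeter (stable_measure \<eta> \<alpha>) E) \<longlongrightarrow>
               K1 e / (2 * sphere_area TYPE('a)) * perimeter E) (at_left 1))))"
proof (intro conjI allI impI ballI)
  show "\<exists>\<mu>. weak_limit_on_sphere
      (\<lambda>\<alpha>. angular_measure (normalized_measure (stable_measure \<eta> \<alpha>))) \<mu> (at_left 1)"
    using weak_limit_stable[OF assms] by blast
next
  fix \<mu> and f :: "'a \<Rightarrow> real" assume "weak_limit_on_sphere
      (\<lambda>\<alpha>. angular_measure (normalized_measure (stable_measure \<eta> \<alpha>))) \<mu> (at_left 1)" and f: "f \<in> BV"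
  \<comment> \<open>The claim concerns every weak limit, so uniqueness is required in addition to
    existence.\<close>
  then have "\<mu> = \<eta>" using weak_limit_stable_unique[OF assms] by blast
  then show "((\<lambda>\<alpha>. ennreal (1 - \<alpha>) * nonlocal_energy (stable_measure \<eta> \<alpha>) f) \<longlongrightarrow>
             1 / 2 * (\<integral>\<^sup>+\<theta>. variation (\<lambda>A. grad f A \<bullet> \<theta>) UNIV \<partial>\<mu>)) (at_left 1)"
    using nonlocal_energy_tendsto[OF assms f] by simp
next
  fix E :: "'a set" and e :: 'a
  assume "\<eta> = uniform_sphere" "E \<in> sets borel" "emeasure lborel E < \<infinity>" "perimeter E < \<infinity>" "norm e = 1"
  then show "((\<lambda>\<alpha>. ennreal (1 - \<alpha>) * nonlocal_perimeter (stable_measure \<eta> \<alpha>) E) \<longlongrightarrow>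
               K1 e / (2 * sphere_area TYPE('a)) * perimeter E) (at_left 1)"
    using nonlocal_perimeter_tendsto[of E e] assms(1) by simp
qed

end
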